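(* The functors $D_2:\Pi\text{-2-}\mathcal Cat\to\Pi\text{-2-}\mathcal{SC}at$ and $E_2:\Pi\text{-2-}\mathcal{SC}at\to\Pi\text{-2-}\mathcal Cat$ are mutually inverse equivalences between the category of $\Pi$-2-categories and $\Pi$-2-functors and the category of $\Pi$-2-supercategories and 2-superfunctors.
   Context: Let $k$ be a commutative ground ring. A superspace is a $\mathbb Z/2$-graded $k$-module; $|v|$ denotes parity. A supercategory is a category whose morphism sets are superspaces with bilinear composition that is an even map; superfunctors induce even linear maps on morphisms; an even supernatural transformation is a natural family of even morphisms. $\mathcal A\boxtimes\mathcal B$ has pairs as objects, tensor products of Hom superspaces as Homs and composition $(f\otimes g)\circ(h\otimes k)=(-1)^{|g||h|}(f\circ h)\otimes(g\circ k)$. A 2-supercategory $\mathfrak A$ consists of a set of objects, supercategories $\mathcal Hom_{\mathfrak A}(\lambda,\mu)$ (objects: 1-morphisms $\lambda\to\mu$; morphisms: 2-morphisms; composition: vertical composition $\circ$), unit 1-morphisms $\mathbf 1_\lambda$, horizontal composition superfunctors $\mathcal Hom(\mu,\nu)\boxtimes\mathcal Hom(\lambda,\mu)\to\mathcal Hom(\lambda,\nu)$ written by juxtaposition, and even supernatural isomorphisms $a,l,r$ (associator, left, right unitors) satisfying the usual pentagon and triangle axioms of a bicategory. A 2-superfunctor $\mathbb R:\mathfrak A\to\mathfrak B$ is a function on objects, superfunctors $\mathcal Hom_{\mathfrak A}(\lambda,\mu)\to\mathcal Hom_{\mathfrak B}(\mathbb R\lambda,\mathbb R\mu)$, even supernatural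 isomorphisms $c:(\mathbb R-)(\mathbb R-)\Rightarrow\mathbb R(--)$ and even 2-isomorphisms $i:\mathbf 1_{\mathbb R\lambda}\Rightarrow\mathbb R\mathbf 1_\lambda$, satisfying the usual axioms of a pseudofunctor. In formulas the same symbol denotes a 1-morphism and its identity 2-morphism. Below, the coherence maps $a,l,r$ are suppressed (formulas are written as in the strict case; they are to be inserted where needed). A $\Pi$-2-supercategory $(\mathfrak A,\pi,\zeta)$ is a 2-supercategory with 1-morphisms $\pi_\lambda:\lambda\to\lambda$ and odd 2-isomorphisms $\zeta_\lambda:\pi_\lambda\Rightarrow\mathbf 1_\lambda$ for each object. $\Pi\text{-2-}\mathcal{SC}at$ is the category of these and all 2-superfunctors. A $\Pi$-2-category $(\mathfrak A,\pi,\beta,\xi)$ is a $k$-linear 2-category (bicategory) with 1-morphisms $\pi_\lambda:\lambda\to\lambda$, natural isomorphisms $(\beta_{\mu,\lambda})_F:\pi_\mu F\Rightarrow F\pi_\lambda$ for $F:\lambda\to\mu$, and 2-isomorphisms $\xi_\lambda:\pi_\lambda^2\Rightarrow\mathbf 1_\lambda$, such that: $(\beta_{\nu,\lambda})_{GF}=G(\beta_{\mu,\lambda})_F\circ(\beta_{\nu,\mu})_GF$ for $F:\lambda\to\mu$, $G:\mu\to\nu$; $(\beta_{\lambda,\lambda})_{\mathbf 1_\lambda}=1_{\pi_\lambda}$; $(\beta_{\lambda,\lambda})_{\pi_\lambda}=-1_{\pi_\lambda^2}$; and $\xi_\mu F\xi_\lambda^{-1}=(\beta_{\mu,\lambda})_F\pi_\lambda\circ\pi_\mu(\beta_{\mu,\lambda})_F$.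 A $\Pi$-2-functor $\mathbb R:\mathfrak A\to\mathfrak B$ is a $k$-linear 2-functor (pseudofunctor) with coherence maps $c,i$ and 2-isomorphisms $j:\pi_{\mathbb R\lambda}\Rightarrow\mathbb R\pi_\lambda$ such that, for $F:\lambda\to\mu$, $\mathbb R(\beta_{\mu,\lambda})_F\circ c\circ j(\mathbb RF)=c\circ(\mathbb RF)j\circ(\beta_{\mathbb R\mu,\mathbb R\lambda})_{\mathbb RF}$, and $\mathbb R\xi_\lambda\circ c\circ jj=i\circ\xi_{\mathbb R\lambda}$. $\Pi\text{-2-}\mathcal Cat$ is the category of $\Pi$-2-categories and $\Pi$-2-functors. $E_2$ sends $(\mathfrak A,\pi,\zeta)$ to $(\underline{\mathfrak A},\pi,\beta,\xi)$, where $\underline{\mathfrak A}$ has the same objects and 1-morphisms but only the even 2-morphisms, $(\beta_{\mu,\lambda})_F:=-\zeta_\mu F\zeta_\lambda^{-1}$ and $\xi_\lambda:=\zeta_\lambda\zeta_\lambda$. It sends a 2-superfunctor $\mathbb R$ to its restriction $\underline{\mathbb R}$ with the same $c,i$ and with $j:=(\mathbb R\zeta_\lambda)^{-1}\circ i\circ\zeta_{\mathbb R\lambda}$. $D_2$ sends $(\mathfrak A,\pi,\beta,\xi)$ to $(\widehat{\mathfrak A},\pi,\zeta)$ with the same objects and 1-morphisms as $\mathfrak A$ and, for $F,G:\lambda\to\mu$, $\mathrm{Hom}_{\widehat{\mathfrak A}}(F,G)_{\bar0}:=\mathrm{Hom}_{\mathfrak A}(F,G)$ and $\mathrm{Hom}_{\widehat{\mathfrak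 A}}(F,G)_{\bar1}:=\mathrm{Hom}_{\mathfrak A}(F,\pi_\mu G)$. Write $\hat x$ for the homogeneous 2-morphism given by $x$ in $\mathfrak A$. Vertical composition, for $\hat x:F\Rightarrow G$, $\hat y:G\Rightarrow H$: $\hat y\circ\hat x$ is given by $y\circ x$ if $\hat x$ is even; by $\pi_\mu y\circ x$ if $\hat x$ is odd and $\hat y$ is even; by $\xi_\mu H\circ\pi_\mu y\circ x$ if both are odd. Horizontal composition of 1-morphisms is as in $\mathfrak A$; for 2-morphisms $\hat x:F\Rightarrow H$ with $F,H:\lambda\to\mu$ and $\hat y:G\Rightarrow K$ with $G,K:\mu\to\nu$: $\hat y\hat x$ is given by $yx$ if $\hat x$ is even; by $(\beta_{\nu,\mu})_K^{-1}H\circ yx$ if $\hat x$ is odd and $\hat y$ is even; by $-\xi_\nu KH\circ\pi_\nu(\beta_{\nu,\mu})_K^{-1}H\circ yx$ if both are odd. The 2-morphism $\zeta_\lambda:\pi_\lambda\Rightarrow\mathbf 1_\lambda$ is $1_{\pi_\lambda}$ viewed as an odd 2-isomorphism. On a $\Pi$-2-functor $\mathbb R$, $D_2$ gives $\widehat{\mathbb R}$, which agrees with $\mathbb R$ on objects, 1-morphisms and even 2-morphisms and has the same $c,i$; on an odd $\hat x:F\Rightarrow G$ given by $x:F\Rightarrow\pi_\mu G$, $\widehat{\mathbb R}\hat x$ is the odd 2-morphism given by $j^{-1}(\mathbb RG)\circ c^{-1}\circ\mathbb Rx:\mathbb RF\Rightarrow\pi_{\mathbb R\mu}(\mathbb 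RG)$.
   Formalization: E_2 is taken with ξ_λ := −ζ_λζ_λ instead of ζ_λζ_λ: with the stated sign and Koszul rule, E_2D_2 would send ξ to −ξ, which over the real numbers is not isomorphic to the identity in general. *)

theory Defs
  imports "HOL-Algebra.Module" "HOL-Library.Z2" "HOL-Library.FuncSet"
begin

section \<open>Categories, functors and equivalences\<close>

record ('a, 'f) cat =
  Obj :: "'a set"
  Arr :: "'a \<Rightarrow> 'a \<Rightarrow> 'f set"
  Idt :: "'a \<Rightarrow> 'f"
  Cmp :: "'a \<Rightarrow> 'a \<Rightarrow> 'a \<Rightarrow> 'f \<Rightarrow> 'f \<Rightarrow> 'f"
  \<comment> \<open>\<open>Cmp C A B D g f\<close> is the composite of \<open>f : A \<rightarrow> B\<close> and \<open>g : B \<rightarrow> D\<close>;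
     the hom-sets \<open>Arr C A B\<close> need not be disjoint.\<close>

definition category :: "('a, 'f) cat \<Rightarrow> bool" where
  "category C \<longleftrightarrow>
     (\<forall>A\<in>Obj C. Idt C A \<in> Arr C A A) \<and>
     (\<forall>A\<in>Obj C. \<forall>B\<in>Obj C. \<forall>D\<in>Obj C. \<forall>f\<in>Arr C A B. \<forall>g\<in>Arr C B D. Cmp C A B D g f \<in> Arr C A D) \<and>
     (\<forall>A\<in>Obj C. \<forall>B\<in>Obj C. \<forall>f\<in>Arr C A B.
        Cmp C A A B f (Idt C A) = f \<and> Cmp C A B B (Idt C B) f = f) \<and>
     (\<forall>A\<in>Obj C. \<forall>B\<in>Obj C. \<forall>D\<in>Obj C. \<forall>E\<in>Obj C. \<forall>f\<in>Arr C A B. \<forall>g\<in>Arr C B D. \<forall>h\<in>Arr C D E.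
        Cmp C A D E h (Cmp C A B D g f) = Cmp C A B E (Cmp C B D E h g) f)"

definition cat_iso :: "('a, 'f) cat \<Rightarrow> 'a \<Rightarrow> 'a \<Rightarrow> 'f \<Rightarrow> bool" where
  "cat_iso C A B f \<longleftrightarrow> f \<in> Arr C A B \<and>
     (\<exists>g\<in>Arr C B A. Cmp C A B A g f = Idt C A \<and> Cmp C B A B f g = Idt C B)"

record ('a, 'f, 'b, 'g) cfunctor =
  on_obj :: "'a \<Rightarrow> 'b"
  on_arr :: "'a \<Rightarrow> 'a \<Rightarrow> 'f \<Rightarrow> 'g"

definition is_functor :: "('a, 'f) cat \<Rightarrow> ('b, 'g) cat \<Rightarrow> ('a, 'f, 'b, 'g) cfunctor \<Rightarrow> bool" where
  "is_functor C D F \<longleftrightarrow> category C \<and> category D \<and>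
     (\<forall>A\<in>Obj C. on_obj F A \<in> Obj D) \<and>
     (\<forall>A\<in>Obj C. \<forall>B\<in>Obj C. \<forall>f\<in>Arr C A B. on_arr F A B f \<in> Arr D (on_obj F A) (on_obj F B)) \<and>
     (\<forall>A\<in>Obj C. on_arr F A A (Idt C A) = Idt D (on_obj F A)) \<and>
     (\<forall>A\<in>Obj C. \<forall>B\<in>Obj C. \<forall>E\<in>Obj C. \<forall>f\<in>Arr C A B. \<forall>g\<in>Arr C B E.
        on_arr F A E (Cmp C A B E g f) =
          Cmp D (on_obj F A) (on_obj F B) (on_obj F E) (on_arr F B E g) (on_arr F A B f))"

definition functor_id :: "('a, 'f, 'a, 'f) cfunctor" where
  "functor_id = \<lparr> on_obj = (\<lambda>A. A), on_arr = (\<lambda>A B f. f) \<rparr>"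

definition functor_comp ::
    "('b, 'g, 'c, 'h) cfunctor \<Rightarrow> ('a, 'f, 'b, 'g) cfunctor \<Rightarrow> ('a, 'f, 'c, 'h) cfunctor" where
  "functor_comp G F =
     \<lparr> on_obj = (\<lambda>A. on_obj G (on_obj F A)),
       on_arr = (\<lambda>A B f. on_arr G (on_obj F A) (on_obj F B) (on_arr F A B f)) \<rparr>"

definition naturally_isomorphic ::
    "('a, 'f) cat \<Rightarrow> ('b, 'g) cat \<Rightarrow> ('a, 'f, 'b, 'g) cfunctor \<Rightarrow> ('a, 'f, 'b, 'g) cfunctor \<Rightarrow> bool" where
  "naturally_isomorphic C D F G \<longleftrightarrow>
     (\<exists>\<tau>. (\<forall>A\<in>Obj C. cat_iso D (on_obj F A) (on_obj G A) (\<tau> A)) \<and>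
        (\<forall>A\<in>Obj C. \<forall>B\<in>Obj C. \<forall>f\<in>Arr C A B.
           Cmp D (on_obj F A) (on_obj F B) (on_obj G B) (\<tau> B) (on_arr F A B f) =
           Cmp D (on_obj F A) (on_obj G A) (on_obj G B) (on_arr G A B f) (\<tau> A)))"

definition mutually_inverse_equivalences ::
    "('a, 'f) cat \<Rightarrow> ('b, 'g) cat \<Rightarrow> ('a, 'f, 'b, 'g) cfunctor \<Rightarrow> ('b, 'g, 'a, 'f) cfunctor \<Rightarrow> bool" where
  "mutually_inverse_equivalences C D F G \<longleftrightarrow>
     is_functor C D F \<and> is_functor D C G \<and>
     naturally_isomorphic C C (functor_comp G F) functor_id \<and>
     naturally_isomorphic D D (functor_comp F G) functor_id"


section \<open>Linear 2-categories and 2-supercategories\<close>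

text \<open>
  A superspace \<open>V\<close> is given by its two homogeneous components, that is, by a family of
  \<open>k\<close>-modules indexed by \<open>\<int>/2\<close> (the type \<open>bit\<close>); \<open>V\<close> is their direct sum.  An even linear map is
  then a family of linear maps between components of equal parity, and an even bilinear map
  is a family of bilinear maps \<open>V\<^sub>p \<times> W\<^sub>q \<rightarrow> U\<^sub>p\<^sub>+\<^sub>q\<close>.  So all 2-morphisms below are homogeneous.
  A \<open>cell\<close> consists of an element of a component of a Hom superspace, together with
  the source, target and parity that say which component is meant.
\<close>

datatype ('m, 'c) cell = Cell (cdom: 'm) (ccod: 'm) (par: bit) (cval: 'c)

record ('k, 'o, 'm, 'c) bicat =
  Ob :: "'o set"
  Mor :: "'m set"
  src :: "'m \<Rightarrow> 'o"
  tgt :: "'m \<Rightarrow> 'o"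
  unit1 :: "'o \<Rightarrow> 'm"
  comp1 :: "'m \<Rightarrow> 'm \<Rightarrow> 'm"  (infixl \<open>\<bullet>\<index>\<close> 75)
  Hom2 :: "'m \<Rightarrow> 'm \<Rightarrow> bit \<Rightarrow> ('k, 'c) module"
  id2 :: "'m \<Rightarrow> ('m, 'c) cell"
  vcomp :: "('m, 'c) cell \<Rightarrow> ('m, 'c) cell \<Rightarrow> ('m, 'c) cell"  (infixr \<open>\<cdot>\<index>\<close> 65)
  hcomp :: "('m, 'c) cell \<Rightarrow> ('m, 'c) cell \<Rightarrow> ('m, 'c) cell"  (infixl \<open>\<star>\<index>\<close> 70)
  assoc :: "'m \<Rightarrow> 'm \<Rightarrow> 'm \<Rightarrow> ('m, 'c) cell"  \<comment> \<open>\<open>assoc H G F : (HG)F \<Rightarrow> H(GF)\<close>\<close>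
  lunit :: "'m \<Rightarrow> ('m, 'c) cell"  \<comment> \<open>\<open>lunit F : 1F \<Rightarrow> F\<close>\<close>
  runit :: "'m \<Rightarrow> ('m, 'c) cell"  \<comment> \<open>\<open>runit F : F1 \<Rightarrow> F\<close>\<close>

definition composable :: "('k, 'o, 'm, 'c, 'z) bicat_scheme \<Rightarrow> 'm \<Rightarrow> 'm \<Rightarrow> bool" where
  "composable A G F \<longleftrightarrow> G \<in> Mor A \<and> F \<in> Mor A \<and> src A G = tgt A F"

definition parallel :: "('k, 'o, 'm, 'c, 'z) bicat_scheme \<Rightarrow> 'm \<Rightarrow> 'm \<Rightarrow> bool" where
  "parallel A F G \<longleftrightarrow> F \<in> Mor A \<and> G \<in> Mor A \<and> src A F = src A G \<and> tgt A F = tgt A G"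

definition cells :: "('k, 'o, 'm, 'c, 'z) bicat_scheme \<Rightarrow> 'm \<Rightarrow> 'm \<Rightarrow> bit \<Rightarrow> ('m, 'c) cell set" where
  "cells A F G p = {x. parallel A F G \<and> cdom x = F \<and> ccod x = G \<and> par x = p \<and>
                       cval x \<in> carrier (Hom2 A F G p)}"

definition all_cells :: "('k, 'o, 'm, 'c, 'z) bicat_scheme \<Rightarrow> bit set \<Rightarrow> ('m, 'c) cell set" where
  "all_cells A P = {x. par x \<in> P \<and> x \<in> cells A (cdom x) (ccod x) (par x)}"

abbreviation hom_of :: "('k, 'o, 'm, 'c, 'z) bicat_scheme \<Rightarrow> ('m, 'c) cell \<Rightarrow> ('k, 'c) module" where
  "hom_of A x \<equiv> Hom2 A (cdom x) (ccod x) (par x)"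

definition add2 ::
    "('k, 'o, 'm, 'c, 'z) bicat_scheme \<Rightarrow> ('m, 'c) cell \<Rightarrow> ('m, 'c) cell \<Rightarrow> ('m, 'c) cell" where
  "add2 A x y = Cell (cdom x) (ccod x) (par x) (cval x \<oplus>\<^bsub>hom_of A x\<^esub> cval y)"

definition smult2 ::
    "('k, 'o, 'm, 'c, 'z) bicat_scheme \<Rightarrow> 'k \<Rightarrow> ('m, 'c) cell \<Rightarrow> ('m, 'c) cell" where
  "smult2 A r x = Cell (cdom x) (ccod x) (par x) (r \<odot>\<^bsub>hom_of A x\<^esub> cval x)"

definition neg2 :: "('k, 'o, 'm, 'c, 'z) bicat_scheme \<Rightarrow> ('m, 'c) cell \<Rightarrow> ('m, 'c) cell" where
  "neg2 A x = Cell (cdom x) (ccod x) (par x) (\<ominus>\<^bsub>hom_of A x\<^esub> cval x)"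

text \<open>The Koszul sign: \<open>koszul A p q x\<close> is \<open>(-1)\<^sup>p\<^sup>q x\<close>.\<close>

definition koszul ::
    "('k, 'o, 'm, 'c, 'z) bicat_scheme \<Rightarrow> bit \<Rightarrow> bit \<Rightarrow> ('m, 'c) cell \<Rightarrow> ('m, 'c) cell" where
  "koszul A p q x = (if p = 1 \<and> q = 1 then neg2 A x else x)"

definition inverse2 ::
    "('k, 'o, 'm, 'c, 'z) bicat_scheme \<Rightarrow> ('m, 'c) cell \<Rightarrow> ('m, 'c) cell \<Rightarrow> bool" where
  "inverse2 A x y \<longleftrightarrow> y \<in> cells A (ccod x) (cdom x) (par x) \<and>
     y \<cdot>\<^bsub>A\<^esub> x = id2 A (cdom x) \<and> x \<cdot>\<^bsub>A\<^esub> y = id2 A (ccod x)"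

definition isos :: "('k, 'o, 'm, 'c, 'z) bicat_scheme \<Rightarrow> 'm \<Rightarrow> 'm \<Rightarrow> bit \<Rightarrow> ('m, 'c) cell set" where
  "isos A F G p = {x \<in> cells A F G p. \<exists>y. inverse2 A x y}"

definition inv2 :: "('k, 'o, 'm, 'c, 'z) bicat_scheme \<Rightarrow> ('m, 'c) cell \<Rightarrow> ('m, 'c) cell" where
  "inv2 A x = (THE y. inverse2 A x y)"

text \<open>
  \<open>P\<close> is the set of parities that occur.  For \<open>P = UNIV\<close> the following are the axioms of a
  2-supercategory over \<open>k\<close>.  For \<open>P = {0}\<close> no axiom refers to \<open>Hom2 A F G 1\<close>, all Koszul signs
  are trivial, and these are the axioms of a \<open>k\<close>-linear bicategory, with Hom modules
  \<open>Hom2 A F G 0\<close>.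
\<close>

locale linear_bicategory =
  fixes k :: "'k ring" and P :: "bit set" and A :: "('k, 'o, 'm, 'c, 'z) bicat_scheme" (structure)
  assumes ground: "cring k"
    and zero_parity: "0 \<in> P"
    and add_parity: "\<lbrakk>p \<in> P; q \<in> P\<rbrakk> \<Longrightarrow> p + q \<in> P"
    \<comment> \<open>1-morphisms\<close>
    and mor_ends: "F \<in> Mor A \<Longrightarrow> src A F \<in> Ob A \<and> tgt A F \<in> Ob A"
    and unit1: "u \<in> Ob A \<Longrightarrow> unit1 A u \<in> Mor A \<and> src A (unit1 A u) = u \<and> tgt A (unit1 A u) = u"
    and comp1: "composable A G F \<Longrightarrow>
      G \<bullet> F \<in> Mor A \<and> src A (G \<bullet> F) = src A F \<and> tgt A (G \<bullet> F) = tgt A G"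
    \<comment> \<open>the supercategories of 1-morphisms\<close>
    and Hom2_module: "\<lbrakk>parallel A F G; p \<in> P\<rbrakk> \<Longrightarrow> module k (Hom2 A F G p)"
    and id2_cell: "F \<in> Mor A \<Longrightarrow> id2 A F \<in> cells A F F 0"
    and vcomp_cell: "\<lbrakk>x \<in> cells A F G p; y \<in> cells A G H q; p \<in> P; q \<in> P\<rbrakk> \<Longrightarrow>
      y \<cdot> x \<in> cells A F H (q + p)"
    and vcomp_add_right: "\<lbrakk>x \<in> cells A F G p; x' \<in> cells A F G p; y \<in> cells A G H q; p \<in> P; q \<in> P\<rbrakk> \<Longrightarrow>
      y \<cdot> add2 A x x' = add2 A (y \<cdot> x) (y \<cdot> x')"
    and vcomp_add_left: "\<lbrakk>x \<in> cells A F G p; y \<in> cells A G H q; y' \<in> cells A G H q; p \<in> P; q \<in> P\<rbrakk> \<Longrightarrow>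
      add2 A y y' \<cdot> x = add2 A (y \<cdot> x) (y' \<cdot> x)"
    and vcomp_smult: "\<lbrakk>x \<in> cells A F G p; y \<in> cells A G H q; p \<in> P; q \<in> P; r \<in> carrier k\<rbrakk> \<Longrightarrow>
      y \<cdot> smult2 A r x = smult2 A r (y \<cdot> x) \<and> smult2 A r y \<cdot> x = smult2 A r (y \<cdot> x)"
    and vcomp_id: "\<lbrakk>x \<in> cells A F G p; p \<in> P\<rbrakk> \<Longrightarrow> x \<cdot> id2 A F = x \<and> id2 A G \<cdot> x = x"
    and vcomp_assoc: "\<lbrakk>x \<in> cells A F G p; y \<in> cells A G H q; z \<in> cells A H K s; p \<in> P; q \<in> P; s \<in> P\<rbrakk> \<Longrightarrow>
      (z \<cdot> y) \<cdot> x = z \<cdot> (y \<cdot> x)"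
    \<comment> \<open>horizontal composition is a superfunctor\<close>
    and hcomp_cell: "\<lbrakk>composable A G F; x \<in> cells A F H p; y \<in> cells A G K q; p \<in> P; q \<in> P\<rbrakk> \<Longrightarrow>
      y \<star> x \<in> cells A (G \<bullet> F) (K \<bullet> H) (q + p)"
    and hcomp_add_right: "\<lbrakk>composable A G F; x \<in> cells A F H p; x' \<in> cells A F H p; y \<in> cells A G K q;
      p \<in> P; q \<in> P\<rbrakk> \<Longrightarrow> y \<star> add2 A x x' = add2 A (y \<star> x) (y \<star> x')"
    and hcomp_add_left: "\<lbrakk>composable A G F; x \<in> cells A F H p; y \<in> cells A G K q; y' \<in> cells A G K q;
      p \<in> P; q \<in> P\<rbrakk> \<Longrightarrow> add2 A y y' \<star> x = add2 A (y \<star> x) (y' \<star> x)"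
    and hcomp_smult: "\<lbrakk>composable A G F; x \<in> cells A F H p; y \<in> cells A G K q; p \<in> P; q \<in> P;
      r \<in> carrier k\<rbrakk> \<Longrightarrow>
      y \<star> smult2 A r x = smult2 A r (y \<star> x) \<and> smult2 A r y \<star> x = smult2 A r (y \<star> x)"
    and hcomp_id: "composable A G F \<Longrightarrow> id2 A G \<star> id2 A F = id2 A (G \<bullet> F)"
    and interchange: "\<lbrakk>composable A G F; x \<in> cells A F F' p; x' \<in> cells A F' F'' p';
      y \<in> cells A G G' q; y' \<in> cells A G' G'' q'; p \<in> P; p' \<in> P; q \<in> P; q' \<in> P\<rbrakk> \<Longrightarrow>
      (y' \<star> x') \<cdot> (y \<star> x) = koszul A p' q ((y' \<cdot> y) \<star> (x' \<cdot> x))"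
    \<comment> \<open>coherence\<close>
    and assoc_iso: "\<lbrakk>composable A H G; composable A G F\<rbrakk> \<Longrightarrow>
      assoc A H G F \<in> isos A ((H \<bullet> G) \<bullet> F) (H \<bullet> (G \<bullet> F)) 0"
    and assoc_natural: "\<lbrakk>composable A H G; composable A G F; x \<in> cells A F F' p; y \<in> cells A G G' q;
      z \<in> cells A H H' s; p \<in> P; q \<in> P; s \<in> P\<rbrakk> \<Longrightarrow>
      assoc A H' G' F' \<cdot> ((z \<star> y) \<star> x) = (z \<star> (y \<star> x)) \<cdot> assoc A H G F"
    and lunit_iso: "F \<in> Mor A \<Longrightarrow> lunit A F \<in> isos A (unit1 A (tgt A F) \<bullet> F) F 0"
    and lunit_natural: "\<lbrakk>x \<in> cells A F G p; p \<in> P\<rbrakk> \<Longrightarrow>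
      lunit A G \<cdot> (id2 A (unit1 A (tgt A F)) \<star> x) = x \<cdot> lunit A F"
    and runit_iso: "F \<in> Mor A \<Longrightarrow> runit A F \<in> isos A (F \<bullet> unit1 A (src A F)) F 0"
    and runit_natural: "\<lbrakk>x \<in> cells A F G p; p \<in> P\<rbrakk> \<Longrightarrow>
      runit A G \<cdot> (x \<star> id2 A (unit1 A (src A F))) = x \<cdot> runit A F"
    and pentagon: "\<lbrakk>composable A K H; composable A H G; composable A G F\<rbrakk> \<Longrightarrow>
      assoc A K H (G \<bullet> F) \<cdot> assoc A (K \<bullet> H) G F =
      (id2 A K \<star> assoc A H G F) \<cdot> assoc A K (H \<bullet> G) F \<cdot> (assoc A K H G \<star> id2 A F)"
    and triangle: "composable A G F \<Longrightarrow>
      (id2 A G \<star> lunit A F) \<cdot> assoc A G (unit1 A (src A G)) F = runit A G \<star> id2 A F"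

text \<open>
  \<open>cmap R (G, F) : (RG)(RF) \<Rightarrow> R(GF)\<close> and \<open>imap R u : 1 \<Rightarrow> R 1\<close> are the coherence maps \<open>c\<close> and \<open>i\<close>.
  All components of a pseudofunctor are required to be \<open>undefined\<close> off their domains, so that
  equality of records is equality of pseudofunctors.
\<close>

record ('o, 'm, 'c) psfunctor =
  fob :: "'o \<Rightarrow> 'o"
  fmor :: "'m \<Rightarrow> 'm"
  fcell :: "('m, 'c) cell \<Rightarrow> ('m, 'c) cell"
  cmap :: "'m \<times> 'm \<Rightarrow> ('m, 'c) cell"
  imap :: "'o \<Rightarrow> ('m, 'c) cell"

locale linear_pseudofunctor =
  fixes k :: "'k ring" and P :: "bit set"
    and A :: "('k, 'o, 'm, 'c, 'z) bicat_scheme"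
    and B :: "('k, 'o, 'm, 'c, 'y) bicat_scheme" (structure)
    and R :: "('o, 'm, 'c, 'w) psfunctor_scheme"
  assumes ext: "fob R \<in> extensional (Ob A)" "fmor R \<in> extensional (Mor A)"
      "fcell R \<in> extensional (all_cells A P)" "cmap R \<in> extensional {(G, F). composable A G F}"
      "imap R \<in> extensional (Ob A)"
    and fob: "u \<in> Ob A \<Longrightarrow> fob R u \<in> Ob B"
    and fmor: "F \<in> Mor A \<Longrightarrow> fmor R F \<in> Mor B \<and>
      src B (fmor R F) = fob R (src A F) \<and> tgt B (fmor R F) = fob R (tgt A F)"
    and fcell: "\<lbrakk>x \<in> cells A F G p; p \<in> P\<rbrakk> \<Longrightarrow> fcell R x \<in> cells B (fmor R F) (fmor R G) p"
    and fcell_add: "\<lbrakk>x \<in> cells A F G p; x' \<in> cells A F G p; p \<in> P\<rbrakk> \<Longrightarrow>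
      fcell R (add2 A x x') = add2 B (fcell R x) (fcell R x')"
    and fcell_smult: "\<lbrakk>x \<in> cells A F G p; p \<in> P; r \<in> carrier k\<rbrakk> \<Longrightarrow>
      fcell R (smult2 A r x) = smult2 B r (fcell R x)"
    and fcell_id: "F \<in> Mor A \<Longrightarrow> fcell R (id2 A F) = id2 B (fmor R F)"
    and fcell_vcomp: "\<lbrakk>x \<in> cells A F G p; y \<in> cells A G H q; p \<in> P; q \<in> P\<rbrakk> \<Longrightarrow>
      fcell R (y \<cdot>\<^bsub>A\<^esub> x) = fcell R y \<cdot> fcell R x"
    and cmap_iso: "composable A G F \<Longrightarrow>
      cmap R (G, F) \<in> isos B (fmor R G \<bullet> fmor R F) (fmor R (G \<bullet>\<^bsub>A\<^esub> F)) 0"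
    and cmap_natural: "\<lbrakk>composable A G F; x \<in> cells A F F' p; y \<in> cells A G G' q; p \<in> P; q \<in> P\<rbrakk> \<Longrightarrow>
      cmap R (G', F') \<cdot> (fcell R y \<star> fcell R x) = fcell R (y \<star>\<^bsub>A\<^esub> x) \<cdot> cmap R (G, F)"
    and imap_iso: "u \<in> Ob A \<Longrightarrow>
      imap R u \<in> isos B (unit1 B (fob R u)) (fmor R (unit1 A u)) 0"
    and coh_assoc: "\<lbrakk>composable A H G; composable A G F\<rbrakk> \<Longrightarrow>
      fcell R (assoc A H G F) \<cdot> cmap R (H \<bullet>\<^bsub>A\<^esub> G, F) \<cdot> (cmap R (H, G) \<star> id2 B (fmor R F)) =
      cmap R (H, G \<bullet>\<^bsub>A\<^esub> F) \<cdot> (id2 B (fmor R H) \<star> cmap R (G, F)) \<cdot>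
        assoc B (fmor R H) (fmor R G) (fmor R F)"
    and coh_lunit: "F \<in> Mor A \<Longrightarrow>
      fcell R (lunit A F) \<cdot> cmap R (unit1 A (tgt A F), F) \<cdot> (imap R (tgt A F) \<star> id2 B (fmor R F)) =
      lunit B (fmor R F)"
    and coh_runit: "F \<in> Mor A \<Longrightarrow>
      fcell R (runit A F) \<cdot> cmap R (F, unit1 A (src A F)) \<cdot> (id2 B (fmor R F) \<star> imap R (src A F)) =
      runit B (fmor R F)"

definition psf_id :: "bit set \<Rightarrow> ('k, 'o, 'm, 'c, 'z) bicat_scheme \<Rightarrow> ('o, 'm, 'c) psfunctor" where
  "psf_id P A =
     \<lparr> fob = (\<lambda>u\<in>Ob A. u),
       fmor = (\<lambda>F\<in>Mor A. F),
       fcell = (\<lambda>x\<in>all_cells A P. x),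
       cmap = (\<lambda>(G, F)\<in>{(G, F). composable A G F}. id2 A (G \<bullet>\<^bsub>A\<^esub> F)),
       imap = (\<lambda>u\<in>Ob A. id2 A (unit1 A u)) \<rparr>"

text \<open>The composite \<open>SR\<close> of \<open>R : A \<rightarrow> B\<close> and \<open>S : B \<rightarrow> C\<close>.\<close>

definition psf_comp ::
    "bit set \<Rightarrow> ('k, 'o, 'm, 'c, 'z) bicat_scheme \<Rightarrow> ('k, 'o, 'm, 'c, 'z) bicat_scheme \<Rightarrow>
     ('o, 'm, 'c, 'w) psfunctor_scheme \<Rightarrow> ('o, 'm, 'c, 'w) psfunctor_scheme \<Rightarrow>
     ('o, 'm, 'c) psfunctor" where
  "psf_comp P A C S R =
     \<lparr> fob = (\<lambda>u\<in>Ob A. fob S (fob R u)),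
       fmor = (\<lambda>F\<in>Mor A. fmor S (fmor R F)),
       fcell = (\<lambda>x\<in>all_cells A P. fcell S (fcell R x)),
       cmap = (\<lambda>(G, F)\<in>{(G, F). composable A G F}.
                 fcell S (cmap R (G, F)) \<cdot>\<^bsub>C\<^esub> cmap S (fmor R G, fmor R F)),
       imap = (\<lambda>u\<in>Ob A. fcell S (imap R u) \<cdot>\<^bsub>C\<^esub> imap S (fob R u)) \<rparr>"


section \<open>\<open>\<Pi>\<close>-2-supercategories and \<open>\<Pi>\<close>-2-categories\<close>

record ('k, 'o, 'm, 'c) pi_bicat = "('k, 'o, 'm, 'c) bicat" +
  pi1 :: "'o \<Rightarrow> 'm"

record ('k, 'o, 'm, 'c) pi_2scat = "('k, 'o, 'm, 'c) pi_bicat" +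
  zeta :: "'o \<Rightarrow> ('m, 'c) cell"

record ('k, 'o, 'm, 'c) pi_2cat = "('k, 'o, 'm, 'c) pi_bicat" +
  beta :: "'m \<Rightarrow> ('m, 'c) cell"  \<comment> \<open>\<open>beta F : \<pi> F \<Rightarrow> F \<pi>\<close>\<close>
  xi :: "'o \<Rightarrow> ('m, 'c) cell"

record ('o, 'm, 'c) pi_psfunctor = "('o, 'm, 'c) psfunctor" +
  jmap :: "'o \<Rightarrow> ('m, 'c) cell"  \<comment> \<open>\<open>jmap R u : \<pi> \<Rightarrow> R \<pi>\<close>\<close>

locale pi_2supercategory = linear_bicategory k UNIV A
  for k :: "'k ring" and A :: "('k, 'o, 'm, 'c) pi_2scat" (structure) +
  assumes pi1: "u \<in> Ob A \<Longrightarrow> pi1 A u \<in> Mor A \<and> src A (pi1 A u) = u \<and> tgt A (pi1 A u) = u"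
    and zeta_iso: "u \<in> Ob A \<Longrightarrow> zeta A u \<in> isos A (pi1 A u) (unit1 A u) 1"

locale pi_2category = linear_bicategory k "{0}" A
  for k :: "'k ring" and A :: "('k, 'o, 'm, 'c) pi_2cat" (structure) +
  assumes pi1: "u \<in> Ob A \<Longrightarrow> pi1 A u \<in> Mor A \<and> src A (pi1 A u) = u \<and> tgt A (pi1 A u) = u"
    and beta_iso: "F \<in> Mor A \<Longrightarrow>
      beta A F \<in> isos A (pi1 A (tgt A F) \<bullet> F) (F \<bullet> pi1 A (src A F)) 0"
    and beta_natural: "x \<in> cells A F G 0 \<Longrightarrow>
      beta A G \<cdot> (id2 A (pi1 A (tgt A F)) \<star> x) = (x \<star> id2 A (pi1 A (src A F))) \<cdot> beta A F"
    and xi_iso: "u \<in> Ob A \<Longrightarrow> xi A u \<in> isos A (pi1 A u \<bullet> pi1 A u) (unit1 A u) 0"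
    and beta_comp: "composable A G F \<Longrightarrow>
      beta A (G \<bullet> F) =
        inv2 A (assoc A G F (pi1 A (src A F))) \<cdot> (id2 A G \<star> beta A F) \<cdot>
        assoc A G (pi1 A (tgt A F)) F \<cdot> (beta A G \<star> id2 A F) \<cdot>
        inv2 A (assoc A (pi1 A (tgt A G)) G F)"
    and beta_unit: "u \<in> Ob A \<Longrightarrow>
      beta A (unit1 A u) = inv2 A (lunit A (pi1 A u)) \<cdot> runit A (pi1 A u)"
    and beta_pi: "u \<in> Ob A \<Longrightarrow> beta A (pi1 A u) = neg2 A (id2 A (pi1 A u \<bullet> pi1 A u))"
    \<comment> \<open>both sides are 2-morphisms \<open>(\<pi>\<pi>)F \<Rightarrow> F(\<pi>\<pi>)\<close>\<close>
    and xi_beta: "F \<in> Mor A \<Longrightarrow>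
      (lunit A F \<star> id2 A (pi1 A (src A F) \<bullet> pi1 A (src A F))) \<cdot>
      ((xi A (tgt A F) \<star> id2 A F) \<star> inv2 A (xi A (src A F))) \<cdot>
      inv2 A (runit A ((pi1 A (tgt A F) \<bullet> pi1 A (tgt A F)) \<bullet> F)) =
      assoc A F (pi1 A (src A F)) (pi1 A (src A F)) \<cdot>
      (beta A F \<star> id2 A (pi1 A (src A F))) \<cdot>
      inv2 A (assoc A (pi1 A (tgt A F)) F (pi1 A (src A F))) \<cdot>
      (id2 A (pi1 A (tgt A F)) \<star> beta A F) \<cdot>
      assoc A (pi1 A (tgt A F)) (pi1 A (tgt A F)) F"

locale pi_2functor = linear_pseudofunctor k "{0}" A B R
  for k :: "'k ring" and A :: "('k, 'o, 'm, 'c) pi_2cat"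
    and B :: "('k, 'o, 'm, 'c) pi_2cat" (structure) and R :: "('o, 'm, 'c) pi_psfunctor" +
  assumes ext_j: "jmap R \<in> extensional (Ob A)"
    and jmap_iso: "u \<in> Ob A \<Longrightarrow> jmap R u \<in> isos B (pi1 B (fob R u)) (fmor R (pi1 A u)) 0"
    and jmap_beta: "F \<in> Mor A \<Longrightarrow>
      fcell R (beta A F) \<cdot> cmap R (pi1 A (tgt A F), F) \<cdot> (jmap R (tgt A F) \<star> id2 B (fmor R F)) =
      cmap R (F, pi1 A (src A F)) \<cdot> (id2 B (fmor R F) \<star> jmap R (src A F)) \<cdot> beta B (fmor R F)"
    and jmap_xi: "u \<in> Ob A \<Longrightarrow>
      fcell R (xi A u) \<cdot> cmap R (pi1 A u, pi1 A u) \<cdot> (jmap R u \<star> jmap R u) =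
      imap R u \<cdot> xi B (fob R u)"

definition Pi_2_SCat ::
    "'k ring \<Rightarrow> (('k, 'o, 'm, 'c) pi_2scat, ('o, 'm, 'c) psfunctor) cat" where
  "Pi_2_SCat k =
     \<lparr> Obj = {A. pi_2supercategory k A},
       Arr = (\<lambda>A B. {R. linear_pseudofunctor k UNIV A B R}),
       Idt = psf_id UNIV,
       Cmp = (\<lambda>A B C S R. psf_comp UNIV A C S R) \<rparr>"

definition Pi_2_Cat ::
    "'k ring \<Rightarrow> (('k, 'o, 'm, 'c) pi_2cat, ('o, 'm, 'c) pi_psfunctor) cat" where
  "Pi_2_Cat k =
     \<lparr> Obj = {A. pi_2category k A},
       Arr = (\<lambda>A B. {R. pi_2functor k A B R}),
       Idt = (\<lambda>A. psfunctor.extend (psf_id {0} A)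
                (pi_psfunctor.fields (\<lambda>u\<in>Ob A. id2 A (pi1 A u)))),
       Cmp = (\<lambda>A B C S R. psfunctor.extend (psf_comp {0} A C S R)
                (pi_psfunctor.fields
                   (\<lambda>u\<in>Ob A. fcell S (jmap R u) \<cdot>\<^bsub>C\<^esub> jmap S (fob R u)))) \<rparr>"


section \<open>The functor \<open>E\<^sub>2\<close>\<close>

text \<open>
  The underlying \<open>k\<close>-linear bicategory has the same data; its axioms (the case \<open>P = {0}\<close>) only
  see the even 2-morphisms.

  Sign of \<open>\<xi>\<close>: juxtaposition of 2-morphisms is horizontal composition, so by the Koszul rule
  \<open>\<zeta> \<circ> (\<zeta>\<pi>) = (1\<zeta>) \<circ> (\<zeta>1) = - \<zeta>\<zeta>\<close>.  The composition formulas of \<open>D\<^sub>2\<close> (with \<open>+ \<xi>\<close> in the vertical and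
  \<open>- \<xi>\<close> in the horizontal composition of two odd 2-morphisms) give \<open>\<zeta> \<circ> (\<zeta>\<pi>) = \<xi>\<close> and \<open>\<zeta>\<zeta> = - \<xi>\<close>
  in the image of \<open>D\<^sub>2\<close>, so the \<open>\<xi>\<close> recovered from \<open>\<zeta>\<close> is \<open>- \<zeta>\<zeta>\<close>.  This corrects the sign in the
  formula \<open>\<xi> := \<zeta>\<zeta>\<close>: read as a horizontal composite, \<open>+ \<zeta>\<zeta>\<close> would make \<open>E\<^sub>2 D\<^sub>2\<close> replace
  \<open>\<xi>\<close> by \<open>- \<xi>\<close>, which over the real numbers, say, is not naturally isomorphic to the identity.
\<close>

definition E2_obj :: "('k, 'o, 'm, 'c) pi_2scat \<Rightarrow> ('k, 'o, 'm, 'c) pi_2cat" where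
  "E2_obj A = pi_bicat.extend (pi_bicat.truncate A)
     (pi_2cat.fields
        (\<lambda>F. neg2 A
           ((lunit A F \<star>\<^bsub>A\<^esub> id2 A (pi1 A (src A F))) \<cdot>\<^bsub>A\<^esub>
            ((zeta A (tgt A F) \<star>\<^bsub>A\<^esub> id2 A F) \<star>\<^bsub>A\<^esub> inv2 A (zeta A (src A F))) \<cdot>\<^bsub>A\<^esub>
            inv2 A (runit A (pi1 A (tgt A F) \<bullet>\<^bsub>A\<^esub> F))))
        (\<lambda>u. neg2 A (lunit A (unit1 A u) \<cdot>\<^bsub>A\<^esub> (zeta A u \<star>\<^bsub>A\<^esub> zeta A u))))"

definition E2_arr ::
    "('k, 'o, 'm, 'c) pi_2scat \<Rightarrow> ('k, 'o, 'm, 'c) pi_2scat \<Rightarrow>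
     ('o, 'm, 'c) psfunctor \<Rightarrow> ('o, 'm, 'c) pi_psfunctor" where
  "E2_arr A B R =
     \<lparr> fob = fob R,
       fmor = fmor R,
       fcell = restrict (fcell R) (all_cells A {0}),
       cmap = cmap R,
       imap = imap R,
       jmap = (\<lambda>u\<in>Ob A. inv2 B (fcell R (zeta A u)) \<cdot>\<^bsub>B\<^esub> imap R u \<cdot>\<^bsub>B\<^esub> zeta B (fob R u)) \<rparr>"

definition E2 ::
    "(('k, 'o, 'm, 'c) pi_2scat, ('o, 'm, 'c) psfunctor,
      ('k, 'o, 'm, 'c) pi_2cat, ('o, 'm, 'c) pi_psfunctor) cfunctor" where
  "E2 = \<lparr> on_obj = E2_obj, on_arr = E2_arr \<rparr>"


section \<open>The functor \<open>D\<^sub>2\<close>\<close>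

definition pi_comp :: "('k, 'o, 'm, 'c) pi_2cat \<Rightarrow> 'm \<Rightarrow> 'm" where
  "pi_comp A F = pi1 A (tgt A F) \<bullet>\<^bsub>A\<^esub> F"

text \<open>The 2-morphism \<open>x\<close> of \<open>A\<close> underlying a homogeneous 2-morphism of the associated supercategory.\<close>

definition underlying :: "('k, 'o, 'm, 'c) pi_2cat \<Rightarrow> ('m, 'c) cell \<Rightarrow> ('m, 'c) cell" where
  "underlying A x =
     (if par x = 0 then x else Cell (cdom x) (pi_comp A (ccod x)) 0 (cval x))"

text \<open>
  \<open>xi_at A H : \<pi>(\<pi>H) \<Rightarrow> H\<close> is \<open>\<xi>H\<close>, and \<open>beta_inv_at A K H : K(\<pi>H) \<Rightarrow> \<pi>(KH)\<close> is
  \<open>\<beta>\<^sub>K\<^sup>-\<^sup>1 H\<close>, with the coherence maps inserted.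
\<close>

definition xi_at :: "('k, 'o, 'm, 'c) pi_2cat \<Rightarrow> 'm \<Rightarrow> ('m, 'c) cell" where
  "xi_at A H =
     lunit A H \<cdot>\<^bsub>A\<^esub> (xi A (tgt A H) \<star>\<^bsub>A\<^esub> id2 A H) \<cdot>\<^bsub>A\<^esub>
     inv2 A (assoc A (pi1 A (tgt A H)) (pi1 A (tgt A H)) H)"

definition beta_inv_at :: "('k, 'o, 'm, 'c) pi_2cat \<Rightarrow> 'm \<Rightarrow> 'm \<Rightarrow> ('m, 'c) cell" where
  "beta_inv_at A K H =
     assoc A (pi1 A (tgt A K)) K H \<cdot>\<^bsub>A\<^esub> (inv2 A (beta A K) \<star>\<^bsub>A\<^esub> id2 A H) \<cdot>\<^bsub>A\<^esub>
     inv2 A (assoc A K (pi1 A (src A K)) H)"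

definition D2_vcomp ::
    "('k, 'o, 'm, 'c) pi_2cat \<Rightarrow> ('m, 'c) cell \<Rightarrow> ('m, 'c) cell \<Rightarrow> ('m, 'c) cell" where
  "D2_vcomp A y' x' =
     (let x = underlying A x'; y = underlying A y'; H = ccod y';
          \<pi>y = id2 A (pi1 A (tgt A H)) \<star>\<^bsub>A\<^esub> y
      in Cell (cdom x') (ccod y') (par y' + par x') (cval
        (if par x' = 0 then y \<cdot>\<^bsub>A\<^esub> x
         else if par y' = 0 then \<pi>y \<cdot>\<^bsub>A\<^esub> x
         else xi_at A H \<cdot>\<^bsub>A\<^esub> \<pi>y \<cdot>\<^bsub>A\<^esub> x)))"

text \<open>
  If \<open>y'\<close> is odd, then \<open>y \<star> x\<close> has target \<open>(\<pi>K)H\<close> or \<open>(\<pi>K)(\<pi>H)\<close>, which is first reassociated.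
\<close>

definition D2_hcomp ::
    "('k, 'o, 'm, 'c) pi_2cat \<Rightarrow> ('m, 'c) cell \<Rightarrow> ('m, 'c) cell \<Rightarrow> ('m, 'c) cell" where
  "D2_hcomp A y' x' =
     (let x = underlying A x'; y = underlying A y'; H = ccod x'; K = ccod y';
          \<pi> = pi1 A (tgt A K)
      in Cell (cdom y' \<bullet>\<^bsub>A\<^esub> cdom x') (K \<bullet>\<^bsub>A\<^esub> H) (par y' + par x') (cval
        (if par x' = 0 then
           (if par y' = 0 then y \<star>\<^bsub>A\<^esub> x else assoc A \<pi> K H \<cdot>\<^bsub>A\<^esub> (y \<star>\<^bsub>A\<^esub> x))
         else if par y' = 0 then beta_inv_at A K H \<cdot>\<^bsub>A\<^esub> (y \<star>\<^bsub>A\<^esub> x)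
         else neg2 A
           (xi_at A (K \<bullet>\<^bsub>A\<^esub> H) \<cdot>\<^bsub>A\<^esub> (id2 A \<pi> \<star>\<^bsub>A\<^esub> beta_inv_at A K H) \<cdot>\<^bsub>A\<^esub>
            assoc A \<pi> K (pi_comp A H) \<cdot>\<^bsub>A\<^esub> (y \<star>\<^bsub>A\<^esub> x)))))"

text \<open>
  \<open>\<zeta> : \<pi> \<Rightarrow> 1\<close> is the identity of \<open>\<pi>\<close> viewed as an odd 2-morphism, that is, the inverse unitor
  \<open>\<pi> \<Rightarrow> \<pi>1\<close> once coherence maps are inserted.
\<close>

definition D2_obj :: "('k, 'o, 'm, 'c) pi_2cat \<Rightarrow> ('k, 'o, 'm, 'c) pi_2scat" where
  "D2_obj A =
     \<lparr> Ob = Ob A, Mor = Mor A, src = src A, tgt = tgt A, unit1 = unit1 A, comp1 = comp1 A,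
       Hom2 = (\<lambda>F G p. if p = 0 then Hom2 A F G 0 else Hom2 A F (pi_comp A G) 0),
       id2 = id2 A,
       vcomp = D2_vcomp A,
       hcomp = D2_hcomp A,
       assoc = assoc A, lunit = lunit A, runit = runit A,
       pi1 = pi1 A,
       zeta = (\<lambda>u. Cell (pi1 A u) (unit1 A u) 1 (cval (inv2 A (runit A (pi1 A u))))) \<rparr>"

definition D2_arr ::
    "('k, 'o, 'm, 'c) pi_2cat \<Rightarrow> ('k, 'o, 'm, 'c) pi_2cat \<Rightarrow>
     ('o, 'm, 'c) pi_psfunctor \<Rightarrow> ('o, 'm, 'c) psfunctor" where
  "D2_arr A B R =
     \<lparr> fob = fob R,
       fmor = fmor R,
       fcell = (\<lambda>x'\<in>all_cells (D2_obj A) UNIV.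
          if par x' = 0 then fcell R x'
          else let G = ccod x'; \<pi> = pi1 A (tgt A G) in
            Cell (fmor R (cdom x')) (fmor R G) 1 (cval
              ((inv2 B (jmap R (tgt A G)) \<star>\<^bsub>B\<^esub> id2 B (fmor R G)) \<cdot>\<^bsub>B\<^esub>
               inv2 B (cmap R (\<pi>, G)) \<cdot>\<^bsub>B\<^esub> fcell R (underlying A x')))),
       cmap = cmap R,
       imap = imap R \<rparr>"

definition D2 ::
    "(('k, 'o, 'm, 'c) pi_2cat, ('o, 'm, 'c) pi_psfunctor,
      ('k, 'o, 'm, 'c) pi_2scat, ('o, 'm, 'c) psfunctor) cfunctor" where
  "D2 = \<lparr> on_obj = D2_obj, on_arr = D2_arr \<rparr>"

end

theory Submission
  imports Defs
begin

text \<open>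
  The axioms of \<open>D\<^sub>2 A\<close> are reduced to whiskerings \<open>K \<triangleright> x\<close> and \<open>y \<triangleleft> F\<close>: once these are functorial, satisfy
  the exchange law up to the Koszul sign and \<open>y \<star> x = (y \<triangleleft> H) \<cdot> (G \<triangleright> x)\<close>, interchange and naturality of the
  associator follow formally, without distinguishing parities.  For whiskerings one needs that \<open>\<xi>H\<close> is natural
  and satisfies \<open>\<xi>\<pi>H = \<pi>\<xi>H\<close>, and that \<open>\<beta>\<^sub>K\<^sup>-\<^sup>1H\<close> is natural, multiplicative in \<open>K\<close>, equal to \<open>-1\<close> for \<open>K = \<pi>\<close>
  and compatible with \<open>\<xi>\<close>.

  In a \<open>\<Pi>\<close>-2-supercategory put \<open>l\<^sub>F = \<zeta>F : \<pi>F \<Rightarrow> F\<close> and \<open>r\<^sub>F = F\<zeta> : F\<pi> \<Rightarrow> F\<close>.  Then \<open>\<beta>\<^sub>F\<close> is the unique solution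
  of \<open>r\<^sub>F \<cdot> \<beta>\<^sub>F = l\<^sub>F\<close>, and \<open>\<xi> = \<zeta> \<cdot> l\<^sub>\<pi>\<close>; the axioms of a \<open>\<Pi>\<close>-2-category follow by cancelling \<open>r\<^sub>F\<close>.

  The functor \<open>E\<^sub>2 D\<^sub>2\<close> is the identity up to irrelevant values, because \<open>l\<^sub>F\<close> and \<open>r\<^sub>F\<close> in \<open>D\<^sub>2 A\<close> are given by \<open>1\<close> and
  \<open>\<beta>\<^sub>F\<^sup>-\<^sup>1\<close>.  The isomorphism \<open>D\<^sub>2 E\<^sub>2 A \<rightarrow> A\<close> is the identity on 1-morphisms and on even 2-morphisms and sends the
  odd 2-morphism \<open>F \<Rightarrow> G\<close> given by \<open>u : F \<Rightarrow> \<pi>G\<close> to \<open>l\<^sub>G \<cdot> u\<close>.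
\<close>

section \<open>Calculus of 2-morphisms\<close>

text \<open>The obstacle is that nothing is strict: the formulas for \<open>D2\<close> and
  \<open>E2\<close> contain associators and unitors. These are moved by naturality towards the
  source of a composite and removed there by a few consequences of pentagon and triangle. On
  morphisms the same two patterns recur. For a 2-superfunctor R, j is the unique solution of
  R\<zeta> \<cdot> j = i \<cdot> \<zeta>; by unit coherence R then carries l_F and r_F to those of
  RF up to c and j, and the axioms of a \<Pi>-2-functor follow by cancelling the image of r_F. For a
  \<Pi>-2-functor R, odd 2-morphisms are transported along an isomorphism R(\<pi>G) \<Rightarrow>
  \<pi>(RG) built from c and j; the two axioms on j make it compatible with \<beta> and \<xi>, which
  is what vertical composition and whiskering of odd 2-morphisms require. Each side has one origin
  of signs: in D2 A it is \<beta>_\<pi> = -1, in E2 A the oddness of \<zeta>, which gives l_\<pi> =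
  - r_\<pi>.\<close>

abbreviation lwhisk :: "('k, 'o, 'm, 'c, 'z) bicat_scheme \<Rightarrow> 'm \<Rightarrow> ('m, 'c) cell \<Rightarrow> ('m, 'c) cell"
    (infixr \<open>\<triangleright>\<index>\<close> 72) where
  "G \<triangleright>\<^bsub>A\<^esub> x \<equiv> id2 A G \<star>\<^bsub>A\<^esub> x"

abbreviation rwhisk :: "('k, 'o, 'm, 'c, 'z) bicat_scheme \<Rightarrow> ('m, 'c) cell \<Rightarrow> 'm \<Rightarrow> ('m, 'c) cell"
    (infixl \<open>\<triangleleft>\<index>\<close> 73) where
  "y \<triangleleft>\<^bsub>A\<^esub> F \<equiv> y \<star>\<^bsub>A\<^esub> id2 A F"

lemma bit_cases [case_names 0 1]: "(p = 0 \<Longrightarrow> Q) \<Longrightarrow> (p = 1 \<Longrightarrow> Q) \<Longrightarrow> Q" for p :: bit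
  by (cases p) auto

text \<open>Otherwise the simplifier turns sums of parities into bitwise exclusive or.\<close>

declare add_bit_eq_xor [simp del]

lemma all_cells_zero_iff: "x \<in> all_cells A {0} \<longleftrightarrow> x \<in> all_cells A UNIV \<and> par x = 0"
  by (auto simp: all_cells_def)

lemma cells_imp_all_cells: "x \<in> cells A F G p \<Longrightarrow> p \<in> P \<Longrightarrow> x \<in> all_cells A P"
  by (auto simp: all_cells_def cells_def)

lemma all_cells_imp_cells: "x \<in> all_cells A P \<Longrightarrow> x \<in> cells A (cdom x) (ccod x) (par x)"
  by (auto simp: all_cells_def)

text \<open>
  A cell carries its source, target and parity, so typing becomes membership in \<open>all_cells\<close> together with
  equations for \<open>cdom\<close>, \<open>ccod\<close> and \<open>par\<close>, which the simplifier can handle.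
\<close>

lemma mem_cells_iff:
  "p \<in> P \<Longrightarrow> x \<in> cells A F G p \<longleftrightarrow> x \<in> all_cells A P \<and> cdom x = F \<and> ccod x = G \<and> par x = p"
  by (auto simp: all_cells_def cells_def)

lemma all_cells_parallel: "x \<in> all_cells A P \<Longrightarrow> parallel A (cdom x) (ccod x)"
  and all_cells_carrier: "x \<in> all_cells A P \<Longrightarrow> cval x \<in> carrier (Hom2 A (cdom x) (ccod x) (par x))"
  by (auto simp: all_cells_def cells_def)

lemma all_cellsI:
  "\<lbrakk>parallel A F G; p \<in> P; v \<in> carrier (Hom2 A F G p)\<rbrakk> \<Longrightarrow> Cell F G p v \<in> all_cells A P"
  by (auto simp: all_cells_def cells_def)

lemma cells_cdom: "x \<in> cells A F G p \<Longrightarrow> cdom x = F"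
  and cells_ccod: "x \<in> cells A F G p \<Longrightarrow> ccod x = G"
  and cells_par: "x \<in> cells A F G p \<Longrightarrow> par x = p"
  by (auto simp: cells_def)

lemmas cells_simps = cells_cdom cells_ccod cells_par

text \<open>Unlike \<open>isos\<close>, this takes no source, target or parity, so invertibility is
  stated like membership in \<open>all_cells\<close>, by the cell alone.\<close>

definition iso2 :: "('k, 'o, 'm, 'c, 'z) bicat_scheme \<Rightarrow> ('m, 'c) cell \<Rightarrow> bool" where
  "iso2 A x \<longleftrightarrow> x \<in> isos A (cdom x) (ccod x) (par x)"

section \<open>Typing of 2-morphisms, whiskering and interchange\<close>

context linear_bicategory
begin

abbreviation arr :: "('m, 'c) cell \<Rightarrow> bool" where
  "arr x \<equiv> x \<in> all_cells A P"

lemma arr_parallel: "arr x \<Longrightarrow> parallel A (cdom x) (ccod x)"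
  by (auto simp: all_cells_def cells_def)

lemma arr_dom [simp]: "arr x \<Longrightarrow> cdom x \<in> Mor A"
  and arr_cod [simp]: "arr x \<Longrightarrow> ccod x \<in> Mor A"
  and src_cod [simp]: "arr x \<Longrightarrow> src A (ccod x) = src A (cdom x)"
  and tgt_cod [simp]: "arr x \<Longrightarrow> tgt A (ccod x) = tgt A (cdom x)"
  and arr_par [simp]: "arr x \<Longrightarrow> par x \<in> P"
  using arr_parallel[of x] by (auto simp: parallel_def all_cells_def)

lemmas arr_cells = all_cells_imp_cells[of _ A P]

lemma mor_simps [simp]:
  "F \<in> Mor A \<Longrightarrow> src A F \<in> Ob A"
  "F \<in> Mor A \<Longrightarrow> tgt A F \<in> Ob A"
  "u \<in> Ob A \<Longrightarrow> unit1 A u \<in> Mor A"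
  "u \<in> Ob A \<Longrightarrow> src A (unit1 A u) = u"
  "u \<in> Ob A \<Longrightarrow> tgt A (unit1 A u) = u"
  "\<lbrakk>G \<in> Mor A; F \<in> Mor A; src A G = tgt A F\<rbrakk> \<Longrightarrow> G \<bullet> F \<in> Mor A"
  "\<lbrakk>G \<in> Mor A; F \<in> Mor A; src A G = tgt A F\<rbrakk> \<Longrightarrow> src A (G \<bullet> F) = src A F"
  "\<lbrakk>G \<in> Mor A; F \<in> Mor A; src A G = tgt A F\<rbrakk> \<Longrightarrow> tgt A (G \<bullet> F) = tgt A G"
  using mor_ends unit1 comp1 by (auto simp: composable_def)

lemma id2_simps [simp]:
  "F \<in> Mor A \<Longrightarrow> arr (id2 A F)"
  "F \<in> Mor A \<Longrightarrow> cdom (id2 A F) = F"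
  "F \<in> Mor A \<Longrightarrow> ccod (id2 A F) = F"
  "F \<in> Mor A \<Longrightarrow> par (id2 A F) = 0"
  using id2_cell[of F] cells_imp_all_cells[OF _ zero_parity] by (auto simp: cells_simps)

lemma vcomp_simps [simp]:
  assumes "arr x" "arr y" "ccod x = cdom y"
  shows "arr (y \<cdot> x)" "cdom (y \<cdot> x) = cdom x" "ccod (y \<cdot> x) = ccod y" "par (y \<cdot> x) = par y + par x"
proof -
  have "y \<cdot> x \<in> cells A (cdom x) (ccod y) (par y + par x)"
    using vcomp_cell[of x "cdom x" "ccod x" "par x" y "ccod y" "par y"] assms arr_cells[of x] arr_cells[of y]
    by auto
  then show "arr (y \<cdot> x)" "cdom (y \<cdot> x) = cdom x" "ccod (y \<cdot> x) = ccod y" "par (y \<cdot> x) = par y + par x"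
    using cells_imp_all_cells add_parity[of "par y" "par x"] assms by (auto simp: cells_simps intro: cells_imp_all_cells)
qed

lemma hcomp_simps [simp]:
  assumes "arr x" "arr y" "src A (cdom y) = tgt A (cdom x)"
  shows "arr (y \<star> x)" "cdom (y \<star> x) = cdom y \<bullet> cdom x"
    "ccod (y \<star> x) = ccod y \<bullet> ccod x" "par (y \<star> x) = par y + par x"
proof -
  have "y \<star> x \<in> cells A (cdom y \<bullet> cdom x) (ccod y \<bullet> ccod x) (par y + par x)"
    using hcomp_cell[of "cdom y" "cdom x" x "ccod x" "par x" y "ccod y" "par y"] assms
      arr_cells[of x] arr_cells[of y]
    by (auto simp: composable_def)
  then show "arr (y \<star> x)" "cdom (y \<star> x) = cdom y \<bullet> cdom x"
    "ccod (y \<star> x) = ccod y \<bullet> ccod x" "par (y \<star> x) = par y + par x"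
    using cells_imp_all_cells add_parity[of "par y" "par x"] assms by (auto simp: cells_simps intro: cells_imp_all_cells)
qed

lemma vid [simp]:
  "\<lbrakk>arr x; cdom x = F\<rbrakk> \<Longrightarrow> x \<cdot> id2 A F = x"
  "\<lbrakk>arr x; ccod x = F\<rbrakk> \<Longrightarrow> id2 A F \<cdot> x = x"
  using vcomp_id[OF arr_cells, of x] by auto

lemma vassoc [simp]:
  "\<lbrakk>arr x; arr y; arr z; ccod x = cdom y; ccod y = cdom z\<rbrakk> \<Longrightarrow> (z \<cdot> y) \<cdot> x = z \<cdot> y \<cdot> x"
  using vcomp_assoc[of x "cdom x" "cdom y" "par x" y "cdom z" "par y" z "ccod z" "par z"]
  by (auto simp: mem_cells_iff[of _ P])

lemma hid [simp]:
  "\<lbrakk>G \<in> Mor A; F \<in> Mor A; src A G = tgt A F\<rbrakk> \<Longrightarrow> id2 A G \<star> id2 A F = id2 A (G \<bullet> F)"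
  using hcomp_id by (auto simp: composable_def)

lemma interchange_arr:
  assumes "arr x" "arr x'" "arr y" "arr y'" "ccod x = cdom x'" "ccod y = cdom y'"
    "src A (cdom y) = tgt A (cdom x)"
  shows "(y' \<star> x') \<cdot> (y \<star> x) = koszul A (par x') (par y) ((y' \<cdot> y) \<star> (x' \<cdot> x))"
  using interchange[of "cdom y" "cdom x" x "cdom x'" "par x" x' "ccod x'" "par x'" y "cdom y'" "par y"
    y' "ccod y'" "par y'"] assms by (auto simp: mem_cells_iff[of _ P] composable_def)

lemma koszul_simps [simp]:
  "koszul A 0 q x = x" "koszul A q 0 x = x" "koszul A 1 1 x = neg2 A x"
  by (auto simp: koszul_def)

lemma lw_vcomp:
  "\<lbrakk>arr x; arr x'; ccod x = cdom x'; G \<in> Mor A; src A G = tgt A (cdom x)\<rbrakk> \<Longrightarrow>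
    G \<triangleright> (x' \<cdot> x) = (G \<triangleright> x') \<cdot> (G \<triangleright> x)"
  by (subst interchange_arr) auto

lemma rw_vcomp:
  "\<lbrakk>arr x; arr x'; ccod x = cdom x'; F \<in> Mor A; src A (cdom x) = tgt A F\<rbrakk> \<Longrightarrow>
    (x' \<cdot> x) \<triangleleft> F = (x' \<triangleleft> F) \<cdot> (x \<triangleleft> F)"
  by (subst interchange_arr) auto

text \<open>The two 2-morphisms exchanged here are identities, hence even, and no sign appears. In
  the opposite order of the whiskers \<open>x\<close> and \<open>y\<close> themselves are exchanged,
  whence the sign in \<open>hcomp_split'\<close>.\<close>

lemma hcomp_split:
  "\<lbrakk>arr x; arr y; src A (cdom y) = tgt A (cdom x)\<rbrakk> \<Longrightarrow>
    y \<star> x = (y \<triangleleft> ccod x) \<cdot> (cdom y \<triangleright> x)"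
  by (subst interchange_arr) auto

lemma hcomp_split':
  "\<lbrakk>arr x; arr y; src A (cdom y) = tgt A (cdom x)\<rbrakk> \<Longrightarrow>
    (ccod y \<triangleright> x) \<cdot> (y \<triangleleft> cdom x) = koszul A (par x) (par y) (y \<star> x)"
  by (subst interchange_arr) auto

section \<open>Inverses of 2-morphisms and cancellation\<close>

lemma inverse2_arr:
  assumes "arr x" "inverse2 A x y"
  shows "arr y" "cdom y = ccod x" "ccod y = cdom x" "par y = par x"
  using assms by (auto simp: inverse2_def mem_cells_iff[of _ P])

lemma inverse2_unique:
  assumes "arr x" "inverse2 A x y" "inverse2 A x z"
  shows "y = z"
proof -
  have "y = y \<cdot> (x \<cdot> z)" 
    using assms inverse2_arr[OF assms(1,2)] inverse2_arr[OF assms(1,3)] by (auto simp: inverse2_def)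
  also have "\<dots> = (y \<cdot> x) \<cdot> z"
    using assms inverse2_arr[OF assms(1,2)] inverse2_arr[OF assms(1,3)] by simp
  also have "\<dots> = z"
    using assms inverse2_arr[OF assms(1,2)] inverse2_arr[OF assms(1,3)] by (auto simp: inverse2_def)
  finally show ?thesis .
qed

lemma inv2_eqI: "arr x \<Longrightarrow> inverse2 A x y \<Longrightarrow> inv2 A x = y"
  unfolding inv2_def using inverse2_unique by blast

lemma iso_inverse2: "arr x \<Longrightarrow> iso2 A x \<Longrightarrow> inverse2 A x (inv2 A x)"
  using inv2_eqI by (auto simp: isos_def iso2_def)

lemma isoI: "arr x \<Longrightarrow> inverse2 A x y \<Longrightarrow> iso2 A x"
  by (auto simp: isos_def iso2_def arr_cells)

lemma isosD:
  assumes "x \<in> isos A F G p" "p \<in> P"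
  shows "arr x" "iso2 A x" "cdom x = F" "ccod x = G" "par x = p"
  using assms by (auto simp: isos_def iso2_def mem_cells_iff[of _ P])

lemma isosI: "\<lbrakk>iso2 A x; cdom x = F; ccod x = G; par x = p\<rbrakk> \<Longrightarrow> x \<in> isos A F G p"
  by (auto simp: iso2_def)

lemma iso_simps [simp]:
  assumes "arr x" "iso2 A x"
  shows "arr (inv2 A x)" "cdom (inv2 A x) = ccod x" "ccod (inv2 A x) = cdom x" "par (inv2 A x) = par x"
    "inv2 A x \<cdot> x = id2 A (cdom x)" "x \<cdot> inv2 A x = id2 A (ccod x)"
    "iso2 A (inv2 A x)" "inv2 A (inv2 A x) = x"
proof -
  note i = iso_inverse2[OF assms]
  show *: "arr (inv2 A x)" "cdom (inv2 A x) = ccod x" "ccod (inv2 A x) = cdom x" "par (inv2 A x) = par x"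
    using inverse2_arr[OF assms(1) i] by auto
  show "inv2 A x \<cdot> x = id2 A (cdom x)" "x \<cdot> inv2 A x = id2 A (ccod x)"
    using i by (auto simp: inverse2_def)
  then have "inverse2 A (inv2 A x) x"
    using * assms by (auto simp: inverse2_def arr_cells)
  then show "iso2 A (inv2 A x)" "inv2 A (inv2 A x) = x"
    using * isoI inv2_eqI by blast+
qed

lemma iso_cancel [simp]:
  assumes "arr x" "iso2 A x" "arr t"
  shows "ccod t = cdom x \<Longrightarrow> inv2 A x \<cdot> x \<cdot> t = t" "ccod t = ccod x \<Longrightarrow> x \<cdot> inv2 A x \<cdot> t = t"
  using assms by (simp_all flip: vassoc)

lemma iso_lcancel:
  "\<lbrakk>x \<cdot> s = x \<cdot> t; iso2 A x; arr x; arr s; arr t; ccod s = cdom x; ccod t = cdom x\<rbrakk> \<Longrightarrow> s = t"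
  by (metis iso_cancel(1))

lemma iso_rcancel:
  assumes "s \<cdot> x = t \<cdot> x" "iso2 A x" "arr x" "arr s" "arr t" "cdom s = ccod x" "cdom t = ccod x"
  shows "s = t"
proof -
  have "(s \<cdot> x) \<cdot> inv2 A x = (t \<cdot> x) \<cdot> inv2 A x"
    by (simp add: assms(1))
  then show ?thesis
    using assms(2-) by simp
qed

lemma iso_lmove:
  assumes "x \<cdot> s = t" "iso2 A x" "arr x" "arr s" "ccod s = cdom x"
  shows "s = inv2 A x \<cdot> t"
  unfolding assms(1)[symmetric] using assms(2-) by simp

lemma iso_rmove:
  assumes "s \<cdot> x = t" "iso2 A x" "arr x" "arr s" "cdom s = ccod x"
  shows "s = t \<cdot> inv2 A x"
  unfolding assms(1)[symmetric] using assms(2-) by simp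

text \<open>Composites are kept associated to the right, so an equation for
  \<open>x \<cdot> y\<close> is not visible inside \<open>x \<cdot> y \<cdot> t\<close>; this form
  applies it there.\<close>

lemma reassoc:
  assumes "x \<cdot> y = z" "arr x" "arr y" "arr t" "ccod y = cdom x" "ccod t = cdom y"
  shows "x \<cdot> y \<cdot> t = z \<cdot> t"
  using assms vassoc[of t y x] by simp

lemma reassoc3:
  assumes "x \<cdot> y \<cdot> w = z" "arr x" "arr y" "arr w" "arr t" "ccod y = cdom x" "ccod w = cdom y" "ccod t = cdom w"
  shows "x \<cdot> y \<cdot> w \<cdot> t = z \<cdot> t"
  using assms reassoc[of x "y \<cdot> w" z t] by simp

lemma id2_iso [simp]: "F \<in> Mor A \<Longrightarrow> iso2 A (id2 A F)" "F \<in> Mor A \<Longrightarrow> inv2 A (id2 A F) = id2 A F"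
proof -
  assume F: "F \<in> Mor A"
  then have i: "inverse2 A (id2 A F) (id2 A F)"
    by (auto simp: inverse2_def id2_cell)
  show "iso2 A (id2 A F)" 
    using i F isoI by simp
  show "inv2 A (id2 A F) = id2 A F"
    using inv2_eqI i F by simp
qed

lemma vcomp_iso:
  assumes "arr x" "iso2 A x" "arr y" "iso2 A y" "ccod x = cdom y"
  shows "iso2 A (y \<cdot> x)" "inv2 A (y \<cdot> x) = inv2 A x \<cdot> inv2 A y"
proof -
  have "inverse2 A (y \<cdot> x) (inv2 A x \<cdot> inv2 A y)"
    using assms by (auto simp: inverse2_def mem_cells_iff[of _ P] add_parity add.commute)
  then show "iso2 A (y \<cdot> x)" "inv2 A (y \<cdot> x) = inv2 A x \<cdot> inv2 A y"
    using assms isoI[of "y \<cdot> x"] inv2_eqI[of "y \<cdot> x"] by (auto simp del: vcomp_simps(2-))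
qed

text \<open>A 1-morphism enters as an even 2-morphism, so there is no sign, even for odd
  \<open>x\<close>.\<close>

lemma lw_iso:
  assumes "arr x" "iso2 A x" "G \<in> Mor A" "src A G = tgt A (cdom x)"
  shows "iso2 A (G \<triangleright> x)" "inv2 A (G \<triangleright> x) = G \<triangleright> inv2 A x"
proof -
  have "inverse2 A (G \<triangleright> x) (G \<triangleright> inv2 A x)"
    using assms by (auto simp: inverse2_def mem_cells_iff[of _ P] simp flip: lw_vcomp)
  then show "iso2 A (G \<triangleright> x)" "inv2 A (G \<triangleright> x) = G \<triangleright> inv2 A x"
    using assms isoI[of "G \<triangleright> x"] inv2_eqI[of "G \<triangleright> x"] by (auto simp del: hcomp_simps(2-))
qed

lemma rw_iso:
  assumes "arr x" "iso2 A x" "F \<in> Mor A" "src A (cdom x) = tgt A F"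
  shows "iso2 A (x \<triangleleft> F)" "inv2 A (x \<triangleleft> F) = inv2 A x \<triangleleft> F"
proof -
  have "inverse2 A (x \<triangleleft> F) (inv2 A x \<triangleleft> F)"
    using assms by (auto simp: inverse2_def mem_cells_iff[of _ P] simp flip: rw_vcomp)
  then show "iso2 A (x \<triangleleft> F)" "inv2 A (x \<triangleleft> F) = inv2 A x \<triangleleft> F"
    using assms isoI[of "x \<triangleleft> F"] inv2_eqI[of "x \<triangleleft> F"] by (auto simp del: hcomp_simps(2-))
qed

section \<open>Associators and unitors\<close>

abbreviation assoc' :: "'m \<Rightarrow> 'm \<Rightarrow> 'm \<Rightarrow> ('m, 'c) cell" where
  "assoc' H G F \<equiv> inv2 A (assoc A H G F)"
abbreviation lunit' :: "'m \<Rightarrow> ('m, 'c) cell" where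
  "lunit' F \<equiv> inv2 A (lunit A F)"
abbreviation runit' :: "'m \<Rightarrow> ('m, 'c) cell" where
  "runit' F \<equiv> inv2 A (runit A F)"

lemma assoc_simps [simp]:
  assumes "H \<in> Mor A" "G \<in> Mor A" "F \<in> Mor A" "src A H = tgt A G" "src A G = tgt A F"
  shows "arr (assoc A H G F)" "cdom (assoc A H G F) = (H \<bullet> G) \<bullet> F" "ccod (assoc A H G F) = H \<bullet> (G \<bullet> F)"
    "par (assoc A H G F) = 0" "iso2 A (assoc A H G F)"
  using isosD[OF assoc_iso[of H G F] zero_parity] assoc_iso[of H G F] assms by (auto simp: composable_def)

lemma lunit_simps [simp]:
  assumes "F \<in> Mor A"
  shows "arr (lunit A F)" "cdom (lunit A F) = unit1 A (tgt A F) \<bullet> F" "ccod (lunit A F) = F"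
    "par (lunit A F) = 0" "iso2 A (lunit A F)"
  using isosD[OF lunit_iso[of F] zero_parity] lunit_iso[of F] assms by (auto simp: composable_def)

lemma runit_simps [simp]:
  assumes "F \<in> Mor A"
  shows "arr (runit A F)" "cdom (runit A F) = F \<bullet> unit1 A (src A F)" "ccod (runit A F) = F"
    "par (runit A F) = 0" "iso2 A (runit A F)"
  using isosD[OF runit_iso[of F] zero_parity] runit_iso[of F] assms by (auto simp: composable_def)

lemma assoc_nat:
  assumes "arr x" "arr y" "arr z" "src A (cdom z) = tgt A (cdom y)" "src A (cdom y) = tgt A (cdom x)"
    "H' = ccod z" "G' = ccod y" "F' = ccod x"
  shows "assoc A H' G' F' \<cdot> ((z \<star> y) \<star> x) = (z \<star> (y \<star> x)) \<cdot> assoc A (cdom z) (cdom y) (cdom x)"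
  using assoc_natural[of "cdom z" "cdom y" "cdom x" x F' "par x" y G' "par y" z H' "par z"] assms
  by (auto simp: composable_def mem_cells_iff[of _ P])

lemma assoc'_nat:
  assumes "arr x" "arr y" "arr z" "src A (cdom z) = tgt A (cdom y)" "src A (cdom y) = tgt A (cdom x)"
    "H' = ccod z" "G' = ccod y" "F' = ccod x"
  shows "assoc' H' G' F' \<cdot> (z \<star> (y \<star> x)) = ((z \<star> y) \<star> x) \<cdot> assoc' (cdom z) (cdom y) (cdom x)"
proof (rule iso_lcancel)
  show "assoc A H' G' F' \<cdot> assoc' H' G' F' \<cdot> (z \<star> (y \<star> x)) =
     assoc A H' G' F' \<cdot> ((z \<star> y) \<star> x) \<cdot> assoc' (cdom z) (cdom y) (cdom x)"
    using assms by (subst reassoc[OF assoc_nat[of x y z]]) auto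
qed (use assms in auto)

lemma lunit_nat:
  "\<lbrakk>arr x; u = tgt A (cdom x); G = ccod x\<rbrakk> \<Longrightarrow> lunit A G \<cdot> (unit1 A u \<triangleright> x) = x \<cdot> lunit A (cdom x)"
  using lunit_natural[of x "cdom x" G "par x"] by (auto simp: mem_cells_iff[of _ P])

lemma runit_nat:
  "\<lbrakk>arr x; u = src A (cdom x); G = ccod x\<rbrakk> \<Longrightarrow> runit A G \<cdot> (x \<triangleleft> unit1 A u) = x \<cdot> runit A (cdom x)"
  using runit_natural[of x "cdom x" G "par x"] by (auto simp: mem_cells_iff[of _ P])

lemma runit'_nat:
  "\<lbrakk>arr x; u = src A (cdom x); G = ccod x; F = cdom x\<rbrakk> \<Longrightarrow>
    runit' G \<cdot> x = (x \<triangleleft> unit1 A u) \<cdot> runit' F"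
  by (rule iso_lcancel[of "runit A G"]) (auto simp: reassoc[OF runit_nat[of x]])

text \<open>Naturality of the left unitor recovers \<open>x\<close> from
  \<open>unit1 A u \<triangleright> x\<close> by conjugation with unitors. This and its mirror image
  allow the unit identities to be checked after whiskering with a unit.\<close>

lemma lw_unit_faithful:
  assumes "unit1 A u \<triangleright> x = unit1 A u \<triangleright> y" "u = tgt A (cdom x)"
    "arr x" "arr y" "cdom x = cdom y" "ccod x = ccod y"
  shows "x = y"
  using lunit_nat[of x u "ccod x"] lunit_nat[of y u "ccod x"]
  by (metis assms iso_rcancel lunit_simps(1,3,5) arr_dom)

lemma rw_unit_faithful:
  assumes "x \<triangleleft> unit1 A u = y \<triangleleft> unit1 A u" "u = src A (cdom x)"
    "arr x" "arr y" "cdom x = cdom y" "ccod x = ccod y"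
  shows "x = y"
  using runit_nat[of x u "ccod x"] runit_nat[of y u "ccod x"]
  by (metis assms iso_rcancel runit_simps(1,3,5) arr_dom)

lemma pentagon_arr:
  assumes "K \<in> Mor A" "H \<in> Mor A" "G \<in> Mor A" "F \<in> Mor A"
    "src A K = tgt A H" "src A H = tgt A G" "src A G = tgt A F"
  shows "(K \<triangleright> assoc A H G F) \<cdot> assoc A K (H \<bullet> G) F \<cdot> (assoc A K H G \<triangleleft> F) =
      assoc A K H (G \<bullet> F) \<cdot> assoc A (K \<bullet> H) G F"
  using pentagon[of K H G F] assms by (auto simp: composable_def)

lemma triangle_arr:
  assumes "G \<in> Mor A" "F \<in> Mor A" "src A G = tgt A F" "u = src A G"
  shows "(G \<triangleright> lunit A F) \<cdot> assoc A G (unit1 A u) F = runit A G \<triangleleft> F"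
  using triangle[of G F] assms by (auto simp: composable_def)

end

context linear_bicategory
begin

text \<open>Inverses of whiskers are written as whiskers of inverses, so cancellation is needed
  again in that form, with and without a further factor.\<close>

lemma lw_cancel [simp]:
  assumes "arr x" "iso2 A x" "G \<in> Mor A" "src A G = tgt A (cdom x)"
  shows "(G \<triangleright> inv2 A x) \<cdot> (G \<triangleright> x) = id2 A (G \<bullet> cdom x)"
    "(G \<triangleright> x) \<cdot> (G \<triangleright> inv2 A x) = id2 A (G \<bullet> ccod x)"
    "\<lbrakk>arr t; ccod t = G \<bullet> cdom x\<rbrakk> \<Longrightarrow> (G \<triangleright> inv2 A x) \<cdot> (G \<triangleright> x) \<cdot> t = t"
    "\<lbrakk>arr t; ccod t = G \<bullet> ccod x\<rbrakk> \<Longrightarrow> (G \<triangleright> x) \<cdot> (G \<triangleright> inv2 A x) \<cdot> t = t"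
proof -
  show 1: "(G \<triangleright> inv2 A x) \<cdot> (G \<triangleright> x) = id2 A (G \<bullet> cdom x)"
    using assms by (simp flip: lw_vcomp)
  show 2: "(G \<triangleright> x) \<cdot> (G \<triangleright> inv2 A x) = id2 A (G \<bullet> ccod x)"
    using assms by (simp flip: lw_vcomp)
  show "(G \<triangleright> inv2 A x) \<cdot> (G \<triangleright> x) \<cdot> t = t" if "arr t" "ccod t = G \<bullet> cdom x"
    using that assms by (simp add: reassoc[OF 1])
  show "(G \<triangleright> x) \<cdot> (G \<triangleright> inv2 A x) \<cdot> t = t" if "arr t" "ccod t = G \<bullet> ccod x"
    using that assms by (simp add: reassoc[OF 2])
qed

lemma rw_cancel [simp]:
  assumes "arr x" "iso2 A x" "F \<in> Mor A" "src A (cdom x) = tgt A F"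
  shows "(inv2 A x \<triangleleft> F) \<cdot> (x \<triangleleft> F) = id2 A (cdom x \<bullet> F)"
    "(x \<triangleleft> F) \<cdot> (inv2 A x \<triangleleft> F) = id2 A (ccod x \<bullet> F)"
    "\<lbrakk>arr t; ccod t = cdom x \<bullet> F\<rbrakk> \<Longrightarrow> (inv2 A x \<triangleleft> F) \<cdot> (x \<triangleleft> F) \<cdot> t = t"
    "\<lbrakk>arr t; ccod t = ccod x \<bullet> F\<rbrakk> \<Longrightarrow> (x \<triangleleft> F) \<cdot> (inv2 A x \<triangleleft> F) \<cdot> t = t"
proof -
  show 1: "(inv2 A x \<triangleleft> F) \<cdot> (x \<triangleleft> F) = id2 A (cdom x \<bullet> F)"
    using assms by (simp flip: rw_vcomp)
  show 2: "(x \<triangleleft> F) \<cdot> (inv2 A x \<triangleleft> F) = id2 A (ccod x \<bullet> F)"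
    using assms by (simp flip: rw_vcomp)
  show "(inv2 A x \<triangleleft> F) \<cdot> (x \<triangleleft> F) \<cdot> t = t" if "arr t" "ccod t = cdom x \<bullet> F"
    using that assms by (simp add: reassoc[OF 1])
  show "(x \<triangleleft> F) \<cdot> (inv2 A x \<triangleleft> F) \<cdot> t = t" if "arr t" "ccod t = ccod x \<bullet> F"
    using that assms by (simp add: reassoc[OF 2])
qed

lemma assoc_lw:
  assumes "arr x" "F = ccod x" "H \<in> Mor A" "G \<in> Mor A" "src A H = tgt A G" "src A G = tgt A (cdom x)"
  shows "assoc A H G F \<cdot> (H \<bullet> G \<triangleright> x) = (H \<triangleright> (G \<triangleright> x)) \<cdot> assoc A H G (cdom x)"
    "assoc' H G F \<cdot> (H \<triangleright> (G \<triangleright> x)) = (H \<bullet> G \<triangleright> x) \<cdot> assoc' H G (cdom x)"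
  using assoc_nat[of x "id2 A G" "id2 A H"] assoc'_nat[of x "id2 A G" "id2 A H"] assms by auto

lemma assoc_rw:
  assumes "arr z" "H = ccod z" "F \<in> Mor A" "G \<in> Mor A" "src A (cdom z) = tgt A G" "src A G = tgt A F"
  shows "assoc A H G F \<cdot> (z \<triangleleft> G \<triangleleft> F) = (z \<triangleleft> (G \<bullet> F)) \<cdot> assoc A (cdom z) G F"
    "assoc' H G F \<cdot> (z \<triangleleft> (G \<bullet> F)) = (z \<triangleleft> G \<triangleleft> F) \<cdot> assoc' (cdom z) G F"
  using assoc_nat[of "id2 A F" "id2 A G" z] assoc'_nat[of "id2 A F" "id2 A G" z] assms by auto

text \<open>Oriented so that associators travel past other 2-morphisms towards the source of a
  composite.\<close>

lemmas nat_rules =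
  assoc_nat assoc_nat[THEN reassoc] assoc'_nat assoc'_nat[THEN reassoc]
  assoc_lw assoc_lw(1)[THEN reassoc] assoc_lw(2)[THEN reassoc]
  assoc_rw assoc_rw(1)[THEN reassoc] assoc_rw(2)[THEN reassoc]
lemmas lunit_rules = lunit_nat lunit_nat[THEN reassoc] 
lemmas runit_rules = runit_nat runit_nat[THEN reassoc] 

section \<open>Forms of the pentagon and Kelly's identities for the unitors\<close>

context
  fixes K H G F
  assumes mor: "K \<in> Mor A" "H \<in> Mor A" "G \<in> Mor A" "F \<in> Mor A"
    "src A K = tgt A H" "src A H = tgt A G" "src A G = tgt A F"
begin

text \<open>The edges of the pentagon are isomorphisms, so it can be solved for various pairs of
  adjacent edges. The five versions cover the pairs of associators that meet later on.\<close>

lemma pentagon1: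
  "(assoc A K H G \<triangleleft> F) \<cdot> assoc' (K \<bullet> H) G F =
    assoc' K (H \<bullet> G) F \<cdot> (K \<triangleright> assoc' H G F) \<cdot> assoc A K H (G \<bullet> F)"
proof -
  \<comment> \<open>An inverse pair is inserted so that one full side of the pentagon
    appears.\<close>
  have "assoc' K (H \<bullet> G) F \<cdot> (K \<triangleright> assoc' H G F) \<cdot> assoc A K H (G \<bullet> F) =
     assoc' K (H \<bullet> G) F \<cdot> (K \<triangleright> assoc' H G F) \<cdot> (assoc A K H (G \<bullet> F) \<cdot> assoc A (K \<bullet> H) G F) \<cdot> assoc' (K \<bullet> H) G F"
    using mor by simp
  also have "\<dots> = (assoc A K H G \<triangleleft> F) \<cdot> assoc' (K \<bullet> H) G F"
    unfolding pentagon_arr[OF mor, symmetric] using mor by simp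
  finally show ?thesis ..
qed

lemma pentagon2:
  "(assoc A K H G \<triangleleft> F) \<cdot> assoc' (K \<bullet> H) G F \<cdot> assoc' K H (G \<bullet> F) =
    assoc' K (H \<bullet> G) F \<cdot> (K \<triangleright> assoc' H G F)"
  using mor by (subst reassoc[OF pentagon1]) simp_all

lemma pentagon3:
  "(assoc' K H G \<triangleleft> F) \<cdot> assoc' K (H \<bullet> G) F =
    assoc' (K \<bullet> H) G F \<cdot> assoc' K H (G \<bullet> F) \<cdot> (K \<triangleright> assoc A H G F)"
  by (rule iso_lcancel[of "assoc A K H G \<triangleleft> F"])
    (use mor in \<open>simp_all add: rw_iso reassoc[OF pentagon1]\<close>)

lemma pentagon4:
  "assoc A (K \<bullet> H) G F \<cdot> (assoc' K H G \<triangleleft> F) =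
    assoc' K H (G \<bullet> F) \<cdot> (K \<triangleright> assoc A H G F) \<cdot> assoc A K (H \<bullet> G) F"
  by (rule iso_rcancel[of _ "assoc A K H G \<triangleleft> F"])
    (use mor in \<open>simp_all add: rw_iso pentagon_arr\<close>)

lemma pentagon5:
  "(K \<triangleright> assoc A H G F) \<cdot> assoc A K (H \<bullet> G) F =
    assoc A K H (G \<bullet> F) \<cdot> assoc A (K \<bullet> H) G F \<cdot> (assoc' K H G \<triangleleft> F)"
  using mor by (simp add: pentagon4)

end

lemma triangle1:
  assumes "G \<in> Mor A" "F \<in> Mor A" "src A G = tgt A F" "u = src A G"
  shows "(runit A G \<triangleleft> F) \<cdot> assoc' G (unit1 A u) F = G \<triangleright> lunit A F"
  using assms by (simp flip: triangle_arr)

text \<open>Kelly's identity, checked after whiskering with the unit: the pentagon and the triangles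
  for \<open>G\<close> and for \<open>G \<bullet> F\<close> give equality up to an isomorphism on
  the right, which is cancelled.\<close>

lemma lunit_comp:
  assumes "G \<in> Mor A" "F \<in> Mor A" "src A G = tgt A F" "u = tgt A G"
  shows "lunit A (G \<bullet> F) \<cdot> assoc A (unit1 A u) G F = lunit A G \<triangleleft> F" (is "?a = ?b")
proof -
  let ?I = "unit1 A (tgt A G)"
  have "(?I \<triangleright> ?a) \<cdot> assoc A ?I (?I \<bullet> G) F \<cdot> (assoc A ?I ?I G \<triangleleft> F) =
    (?I \<triangleright> lunit A (G \<bullet> F)) \<cdot> assoc A ?I ?I (G \<bullet> F) \<cdot> assoc A (?I \<bullet> ?I) G F"
    using assms by (simp add: lw_vcomp pentagon_arr)
  also have "\<dots> = (runit A ?I \<triangleleft> (G \<bullet> F)) \<cdot> assoc A (?I \<bullet> ?I) G F"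
    using assms by (simp add: reassoc[OF triangle_arr])
  also have "\<dots> = assoc A ?I G F \<cdot> (runit A ?I \<triangleleft> G \<triangleleft> F)"
    using assms by (simp add: nat_rules)
  also have "\<dots> = assoc A ?I G F \<cdot> ((?I \<triangleright> lunit A G) \<triangleleft> F) \<cdot> (assoc A ?I ?I G \<triangleleft> F)"
    using assms by (simp flip: rw_vcomp add: triangle_arr)
  also have "\<dots> = (?I \<triangleright> ?b) \<cdot> assoc A ?I (?I \<bullet> G) F \<cdot> (assoc A ?I ?I G \<triangleleft> F)"
    using assms by (simp add: nat_rules)
  finally have "(?I \<triangleright> ?a) = (?I \<triangleright> ?b)"
    by (rule iso_rcancel[of _ "assoc A ?I (?I \<bullet> G) F \<cdot> (assoc A ?I ?I G \<triangleleft> F)"])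
      (use assms in \<open>simp_all add: vcomp_iso rw_iso\<close>)
  then show ?thesis
    by (rule lw_unit_faithful) (use assms in simp_all)
qed

lemma lunit_comp':
  assumes "G \<in> Mor A" "F \<in> Mor A" "src A G = tgt A F"
  shows "lunit A (G \<bullet> F) = (lunit A G \<triangleleft> F) \<cdot> assoc' (unit1 A (tgt A G)) G F"
  using assms by (simp flip: lunit_comp)

text \<open>The mirror image: after whiskering with the unit on the right, the pentagon joins the
  triangle for \<open>F\<close> to the one for \<open>G \<bullet> F\<close>.\<close>

lemma runit_comp:
  assumes "G \<in> Mor A" "F \<in> Mor A" "src A G = tgt A F" "u = src A F"
  shows "(G \<triangleright> runit A F) \<cdot> assoc A G F (unit1 A u) = runit A (G \<bullet> F)" (is "?a = ?b")
proof -
  let ?I = "unit1 A (src A F)"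
  have "assoc A G F ?I \<cdot> (?a \<triangleleft> ?I) = 
    (G \<triangleright> (runit A F \<triangleleft> ?I)) \<cdot> assoc A G (F \<bullet> ?I) ?I \<cdot> (assoc A G F ?I \<triangleleft> ?I)"
    using assms by (simp add: nat_rules rw_vcomp)
  also have "\<dots> = (G \<triangleright> (F \<triangleright> lunit A ?I)) \<cdot> (G \<triangleright> assoc A F ?I ?I) \<cdot> assoc A G (F \<bullet> ?I) ?I \<cdot> (assoc A G F ?I \<triangleleft> ?I)"
    using assms by (subst triangle_arr[of F ?I "src A F", symmetric]) (simp_all add: lw_vcomp)
  also have "\<dots> = (G \<triangleright> (F \<triangleright> lunit A ?I)) \<cdot> assoc A G F (?I \<bullet> ?I) \<cdot> assoc A (G \<bullet> F) ?I ?I"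
    using assms by (simp add: pentagon_arr)
  also have "\<dots> = assoc A G F ?I \<cdot> (G \<bullet> F \<triangleright> lunit A ?I) \<cdot> assoc A (G \<bullet> F) ?I ?I"
    using assms by (simp add: nat_rules)
  also have "\<dots> = assoc A G F ?I \<cdot> (?b \<triangleleft> ?I)"
    using assms by (simp add: triangle_arr)
  finally have "(?a \<triangleleft> ?I) = (?b \<triangleleft> ?I)"
    by (rule iso_lcancel[of "assoc A G F ?I"]) (use assms in simp_all)
  then show ?thesis
    by (rule rw_unit_faithful) (use assms in simp_all)
qed

text \<open>Naturality of the left unitor along itself shows that at a square of the unit it is a
  whiskered unitor. With \<open>lunit_comp\<close> and the triangle, the two unitors then agree
  after whiskering with the unit.\<close>

lemma lunit_eq_runit:
  assumes "u \<in> Ob A"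
  shows "lunit A (unit1 A u) = runit A (unit1 A u)"
proof -
  let ?I = "unit1 A u"
  have "lunit A (?I \<bullet> ?I) = ?I \<triangleright> lunit A ?I"
    by (rule iso_lcancel[of "lunit A ?I"]) (use assms in \<open>simp_all add: lunit_nat\<close>)
  then have "lunit A ?I \<triangleleft> ?I = runit A ?I \<triangleleft> ?I"
    using lunit_comp[of ?I ?I u] triangle_arr[of ?I ?I u] assms by simp
  then show ?thesis
    by (rule rw_unit_faithful) (use assms in simp_all)
qed

text \<open>Reduces signs to multiplication by the scalar -1, so that bilinearity pulls them out of
  both compositions.\<close>

lemma minus_one_cell:
  assumes "arr x"
  shows "neg2 A x = smult2 A (\<ominus>\<^bsub>k\<^esub> \<one>\<^bsub>k\<^esub>) x"
proof -
  have c: "cval x \<in> carrier (hom_of A x)"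
    using arr_cells[OF assms] by (auto simp: cells_def)
  interpret module k "hom_of A x"
    using Hom2_module arr_parallel assms by simp
  show ?thesis
    using c smult_l_minus[of "\<one>\<^bsub>k\<^esub>"] by (auto simp: neg2_def smult2_def)
qed

lemma neg2_simps [simp]:
  assumes "arr x"
  shows "arr (neg2 A x)" "cdom (neg2 A x) = cdom x" "ccod (neg2 A x) = ccod x" "par (neg2 A x) = par x"
    "neg2 A (neg2 A x) = x"
proof -
  have c: "cval x \<in> carrier (hom_of A x)"
    using arr_cells[OF assms] by (auto simp: cells_def)
  interpret module k "hom_of A x"
    using Hom2_module arr_parallel assms by simp
  show "cdom (neg2 A x) = cdom x" "ccod (neg2 A x) = ccod x" "par (neg2 A x) = par x"
    by (auto simp: neg2_def)
  show "arr (neg2 A x)"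
    unfolding neg2_def using arr_parallel arr_par assms a_inv_closed[OF c] by (intro all_cellsI)
  show "neg2 A (neg2 A x) = x"
    unfolding neg2_def cell.sel minus_minus[OF c] by (rule cell.collapse)
qed

lemma minus_one_closed: "\<ominus>\<^bsub>k\<^esub> \<one>\<^bsub>k\<^esub> \<in> carrier k"
proof -
  interpret cring k by (rule ground)
  show ?thesis by simp
qed

lemma neg2_vcomp [simp]:
  assumes "arr x" "arr y" "ccod x = cdom y"
  shows "neg2 A y \<cdot> x = neg2 A (y \<cdot> x)" "y \<cdot> neg2 A x = neg2 A (y \<cdot> x)"
proof -
  have "y \<cdot> smult2 A (\<ominus>\<^bsub>k\<^esub> \<one>\<^bsub>k\<^esub>) x = smult2 A (\<ominus>\<^bsub>k\<^esub> \<one>\<^bsub>k\<^esub>) (y \<cdot> x) \<and>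
    smult2 A (\<ominus>\<^bsub>k\<^esub> \<one>\<^bsub>k\<^esub>) y \<cdot> x = smult2 A (\<ominus>\<^bsub>k\<^esub> \<one>\<^bsub>k\<^esub>) (y \<cdot> x)"
    using assms by (intro vcomp_smult[of x "cdom x" "cdom y" "par x" y "ccod y" "par y"] minus_one_closed) (auto simp: mem_cells_iff[of _ P])
  then show "neg2 A y \<cdot> x = neg2 A (y \<cdot> x)" "y \<cdot> neg2 A x = neg2 A (y \<cdot> x)"
    using assms by (simp_all only: minus_one_cell vcomp_simps)
qed

lemma neg2_hcomp [simp]:
  assumes "arr x" "arr y" "src A (cdom y) = tgt A (cdom x)"
  shows "neg2 A y \<star> x = neg2 A (y \<star> x)" "y \<star> neg2 A x = neg2 A (y \<star> x)"
proof -
  have "y \<star> smult2 A (\<ominus>\<^bsub>k\<^esub> \<one>\<^bsub>k\<^esub>) x = smult2 A (\<ominus>\<^bsub>k\<^esub> \<one>\<^bsub>k\<^esub>) (y \<star> x) \<and>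
    smult2 A (\<ominus>\<^bsub>k\<^esub> \<one>\<^bsub>k\<^esub>) y \<star> x = smult2 A (\<ominus>\<^bsub>k\<^esub> \<one>\<^bsub>k\<^esub>) (y \<star> x)"
    using assms by (intro hcomp_smult[of "cdom y" "cdom x" x "ccod x" "par x" y "ccod y" "par y"] minus_one_closed)
      (auto simp: mem_cells_iff[of _ P] composable_def)
  then show "neg2 A y \<star> x = neg2 A (y \<star> x)" "y \<star> neg2 A x = neg2 A (y \<star> x)"
    using assms by (simp_all only: minus_one_cell hcomp_simps)
qed

lemma koszul_cell [simp]:
  assumes "arr x"
  shows "arr (koszul A p q x)" "cdom (koszul A p q x) = cdom x" "ccod (koszul A p q x) = ccod x"
    "par (koszul A p q x) = par x"
  using assms by (simp_all add: koszul_def)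

lemma koszul_vcomp [simp]:
  assumes "arr x" "arr y" "ccod x = cdom y"
  shows "koszul A p q y \<cdot> x = koszul A p q (y \<cdot> x)" "y \<cdot> koszul A p q x = koszul A p q (y \<cdot> x)"
  using assms by (simp_all add: koszul_def)

lemma koszul_hcomp [simp]:
  assumes "arr x" "arr y" "src A (cdom y) = tgt A (cdom x)"
  shows "koszul A p q y \<star> x = koszul A p q (y \<star> x)" "y \<star> koszul A p q x = koszul A p q (y \<star> x)"
  using assms by (simp_all add: koszul_def)

lemma neg2_iso:
  assumes "arr x" "iso2 A x"
  shows "iso2 A (neg2 A x)" "inv2 A (neg2 A x) = neg2 A (inv2 A x)"
proof -
  have "inverse2 A (neg2 A x) (neg2 A (inv2 A x))"
    using assms by (auto simp: inverse2_def mem_cells_iff[of _ P])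
  then show "iso2 A (neg2 A x)" "inv2 A (neg2 A x) = neg2 A (inv2 A x)"
    using assms isoI[of "neg2 A x"] inv2_eqI[of "neg2 A x"] by simp_all
qed

end

section \<open>The 2-morphisms \<open>\<xi>H\<close> and \<open>\<beta>\<^sub>K\<^sup>-\<^sup>1H\<close> of a \<open>\<Pi>\<close>-2-category\<close>

context linear_bicategory
begin

text \<open>The composite occurring in the axiom \<open>xi_beta\<close> and in the definition of \<open>\<beta>\<close> in \<open>E\<^sub>2\<close>.\<close>

lemma unit_conj:
  assumes "F \<in> Mor A" "arr s" "arr t" "iso2 A t" "ccod s = unit1 A (tgt A F)" "ccod t = unit1 A (src A F)"
    "cdom s = a" "cdom t = b"
  shows "runit A F \<cdot> (F \<triangleright> t) \<cdot> (lunit A F \<triangleleft> b) \<cdot> ((s \<triangleleft> F) \<star> inv2 A t) \<cdot> runit' (a \<bullet> F) =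
    koszul A (par t) (par s) (lunit A F \<cdot> (s \<triangleleft> F))"
proof -
  have o: "src A a = tgt A F" "tgt A b = src A F" "tgt A a = tgt A F" "src A b = src A F" "a \<in> Mor A" "b \<in> Mor A"
    using assms(2,3) by (auto simp: assms(1) assms(5,6) simp flip: assms(7,8) src_cod tgt_cod)
  let ?z = "lunit A F \<cdot> (s \<triangleleft> F)"
  have "runit A F \<cdot> (F \<triangleright> t) \<cdot> (lunit A F \<triangleleft> b) \<cdot> ((s \<triangleleft> F) \<star> inv2 A t) \<cdot> runit' (a \<bullet> F) =
    runit A F \<cdot> (F \<triangleright> t) \<cdot> (?z \<triangleleft> b) \<cdot> (a \<bullet> F \<triangleright> inv2 A t) \<cdot> runit' (a \<bullet> F)"
    using assms o by (subst hcomp_split[of "inv2 A t"]) (simp_all add: rw_vcomp)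
  also have "\<dots> = koszul A (par t) (par s) (runit A F \<cdot> (?z \<triangleleft> unit1 A (src A F)) \<cdot> (a \<bullet> F \<triangleright> t) \<cdot> (a \<bullet> F \<triangleright> inv2 A t) \<cdot> runit' (a \<bullet> F))"
  proof -
    \<comment> \<open>The only step that costs a sign: \<open>t\<close> is moved past
      \<open>?z\<close>, after which it meets its inverse.\<close>
    have "(F \<triangleright> t) \<cdot> (?z \<triangleleft> b) = koszul A (par t) (par s) ((?z \<triangleleft> unit1 A (src A F)) \<cdot> (a \<bullet> F \<triangleright> t))"
      using assms o hcomp_split'[of t ?z] hcomp_split[of t ?z] by simp
    from reassoc[OF this] show ?thesis
      using assms o by simp
  qed
  also have "\<dots> = koszul A (par t) (par s) ?z"
    using assms o by (simp add: reassoc[OF runit_nat])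
  finally show ?thesis .
qed

end

context pi_2category
begin

abbreviation p :: "'o \<Rightarrow> 'm" where "p \<equiv> pi1 A"

lemma arr_par0 [simp]: "arr x \<Longrightarrow> par x = 0"
  using arr_par by blast

lemma p_simps [simp]:
  "u \<in> Ob A \<Longrightarrow> p u \<in> Mor A" "u \<in> Ob A \<Longrightarrow> src A (p u) = u" "u \<in> Ob A \<Longrightarrow> tgt A (p u) = u"
  using pi1 by auto

lemma beta_simps [simp]:
  assumes "F \<in> Mor A"
  shows "arr (beta A F)" "cdom (beta A F) = p (tgt A F) \<bullet> F" "ccod (beta A F) = F \<bullet> p (src A F)"
    "iso2 A (beta A F)"
  using isosD[OF beta_iso zero_parity] assms by auto

lemma xi_simps [simp]:
  assumes "u \<in> Ob A"
  shows "arr (xi A u)" "cdom (xi A u) = p u \<bullet> p u" "ccod (xi A u) = unit1 A u" "iso2 A (xi A u)"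
  using isosD[OF xi_iso zero_parity] assms by auto

abbreviation beta' :: "'m \<Rightarrow> ('m, 'c) cell" where "beta' F \<equiv> inv2 A (beta A F)"

lemma beta_nat:
  "\<lbrakk>arr x; G = ccod x; u = tgt A (cdom x)\<rbrakk> \<Longrightarrow>
    beta A G \<cdot> (p u \<triangleright> x) = (x \<triangleleft> p (src A (cdom x))) \<cdot> beta A (cdom x)"
  using beta_natural[of x "cdom x" "ccod x"] by (auto simp: mem_cells_iff[of _ "{0}"])

lemma beta'_nat:
  assumes "arr x" "G = ccod x" "u = src A (cdom x)"
  shows "beta' G \<cdot> (x \<triangleleft> p u) = (p (tgt A (cdom x)) \<triangleright> x) \<cdot> beta' (cdom x)"
  by (rule iso_lcancel[of "beta A G"]) (use assms in \<open>simp_all add: reassoc[OF beta_nat]\<close>)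

lemma xi_at_simps [simp]:
  assumes "H \<in> Mor A"
  shows "arr (xi_at A H)" "cdom (xi_at A H) = p (tgt A H) \<bullet> (p (tgt A H) \<bullet> H)" "ccod (xi_at A H) = H"
    "iso2 A (xi_at A H)"
  unfolding xi_at_def using assms by (simp_all add: vcomp_iso rw_iso)

lemma xi_at_nat:
  assumes "arr x" "H = ccod x" "u = tgt A (cdom x)"
  shows "xi_at A H \<cdot> (p u \<triangleright> (p u \<triangleright> x)) = x \<cdot> xi_at A (cdom x)"
proof -
  have "(xi A u \<triangleleft> H) \<cdot> ((p u \<bullet> p u) \<triangleright> x) = (unit1 A u \<triangleright> x) \<cdot> (xi A u \<triangleleft> cdom x)"
    using assms hcomp_split[of x "xi A u"] hcomp_split'[of x "xi A u"] by simp
  from reassoc[OF this] show ?thesis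
    unfolding xi_at_def using assms by (simp add: nat_rules lunit_rules)
qed

text \<open>Compatibility of \<xi> with whiskering on the right; it makes right whiskering in
  \<open>D2_obj A\<close> preserve composites of two odd 2-morphisms.\<close>

lemma xi_at_comp:
  assumes "G \<in> Mor A" "F \<in> Mor A" "src A G = tgt A F" "u = tgt A G"
  shows "xi_at A (G \<bullet> F) \<cdot> (p u \<triangleright> assoc A (p u) G F) \<cdot> assoc A (p u) (p u \<bullet> G) F = xi_at A G \<triangleleft> F"
proof -
  have "xi_at A (G \<bullet> F) \<cdot> (p u \<triangleright> assoc A (p u) G F) \<cdot> assoc A (p u) (p u \<bullet> G) F =
    lunit A (G \<bullet> F) \<cdot> (xi A u \<triangleleft> (G \<bullet> F)) \<cdot> assoc A (p u \<bullet> p u) G F \<cdot> (assoc' (p u) (p u) G \<triangleleft> F)"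
    unfolding xi_at_def using assms by (simp add: pentagon5)
  also have "\<dots> = lunit A (G \<bullet> F) \<cdot> assoc A (unit1 A u) G F \<cdot> (xi A u \<triangleleft> G \<triangleleft> F) \<cdot> (assoc' (p u) (p u) G \<triangleleft> F)"
    using assms by (simp add: nat_rules)
  also have "\<dots> = xi_at A G \<triangleleft> F"
    unfolding xi_at_def using assms by (simp add: rw_vcomp reassoc[OF lunit_comp])
  finally show ?thesis .
qed

lemma beta_inv_at_simps [simp]:
  assumes "K \<in> Mor A" "H \<in> Mor A" "src A K = tgt A H"
  shows "arr (beta_inv_at A K H)" "cdom (beta_inv_at A K H) = K \<bullet> (p (src A K) \<bullet> H)"
    "ccod (beta_inv_at A K H) = p (tgt A K) \<bullet> (K \<bullet> H)" "iso2 A (beta_inv_at A K H)"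
    "inv2 A (beta_inv_at A K H) = assoc A K (p (src A K)) H \<cdot> (beta A K \<triangleleft> H) \<cdot> assoc' (p (tgt A K)) K H"
  unfolding beta_inv_at_def using assms by (simp_all add: vcomp_iso rw_iso)

text \<open>Interchange treats both variables at once and reduces the claim to naturality of \<beta>
  and of the associators.\<close>

lemma beta_inv_at_nat:
  assumes "arr y" "arr x" "src A (cdom y) = tgt A (cdom x)" "K' = ccod y" "H' = ccod x" "u = src A (cdom y)"
  shows "beta_inv_at A K' H' \<cdot> (y \<star> (p u \<triangleright> x)) = (p (tgt A (cdom y)) \<triangleright> (y \<star> x)) \<cdot> beta_inv_at A (cdom y) (cdom x)"
proof -
  have "(beta' K' \<triangleleft> H') \<cdot> ((y \<triangleleft> p u) \<star> x) = ((p (tgt A (cdom y)) \<triangleright> y) \<star> x) \<cdot> (beta' (cdom y) \<triangleleft> cdom x)"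
    using assms by (simp add: interchange_arr beta'_nat)
  from reassoc[OF this] show ?thesis
    unfolding beta_inv_at_def using assms by (simp add: nat_rules)
qed

text \<open>This is \<beta>_\<pi> = -1 with the associators cancelled. It accounts for the minus
  sign in the horizontal composite of two odd 2-morphisms.\<close>

lemma beta_inv_at_pi:
  assumes "H \<in> Mor A" "u = tgt A H"
  shows "beta_inv_at A (p u) H = neg2 A (id2 A (p u \<bullet> (p u \<bullet> H)))"
  unfolding beta_inv_at_def using assms by (simp add: beta_pi neg2_iso)

text \<open>\<beta> at a unit is made of the two unitors of \<pi>, and the triangle removes the
  right one. Naturality of the left unitor at odd 2-morphisms depends on this.\<close>

lemma beta_inv_at_unit:
  assumes "H \<in> Mor A" "u = tgt A H"
  shows "(p u \<triangleright> lunit A H) \<cdot> beta_inv_at A (unit1 A u) H = lunit A (p u \<bullet> H)"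
proof -
  have "(p u \<triangleright> lunit A H) \<cdot> beta_inv_at A (unit1 A u) H =
    (p u \<triangleright> lunit A H) \<cdot> assoc A (p u) (unit1 A u) H \<cdot> (runit' (p u) \<triangleleft> H) \<cdot> (lunit A (p u) \<triangleleft> H) \<cdot> assoc' (unit1 A u) (p u) H"
    unfolding beta_inv_at_def using assms by (simp add: beta_unit vcomp_iso rw_vcomp)
  also have "\<dots> = (lunit A (p u) \<triangleleft> H) \<cdot> assoc' (unit1 A u) (p u) H"
    using assms by (simp add: reassoc[OF triangle_arr])
  also have "\<dots> = lunit A (p u \<bullet> H)"
    using assms by (simp flip: lunit_comp)
  finally show ?thesis .
qed

text \<open>Used to compute \<open>F \<triangleright> \<zeta>\<close> in \<open>D2_obj A\<close>,
  where the target of \<zeta> is a unit.\<close>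

lemma beta_inv_at_unit_right:
  assumes "F \<in> Mor A" "u = tgt A F" "w = src A F"
  shows "(p u \<triangleright> runit A F) \<cdot> beta_inv_at A F (unit1 A w) = beta' F \<cdot> (F \<triangleright> runit A (p w))"
proof -
  have "(p u \<triangleright> runit A F) \<cdot> beta_inv_at A F (unit1 A w) =
    runit A (p u \<bullet> F) \<cdot> (beta' F \<triangleleft> unit1 A w) \<cdot> assoc' F (p w) (unit1 A w)"
    unfolding beta_inv_at_def using assms by (simp add: reassoc[OF runit_comp])
  also have "\<dots> = beta' F \<cdot> runit A (F \<bullet> p w) \<cdot> assoc' F (p w) (unit1 A w)"
    using assms by (simp add: runit_rules)
  also have "\<dots> = beta' F \<cdot> (F \<triangleright> runit A (p w))"
    using assms by (simp flip: runit_comp)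
  finally show ?thesis .
qed

text \<open>Serves naturality of the associator at an odd 2-morphism in the middle position.\<close>

lemma beta_inv_at_whisker:
  assumes "G \<in> Mor A" "H \<in> Mor A" "X \<in> Mor A" "src A G = tgt A H" "src A H = tgt A X"
    "u = tgt A G" "w = src A G"
  shows "(p u \<triangleright> assoc A G H X) \<cdot> assoc A (p u) (G \<bullet> H) X \<cdot> (beta_inv_at A G H \<triangleleft> X) =
    beta_inv_at A G (H \<bullet> X) \<cdot> (G \<triangleright> assoc A (p w) H X) \<cdot> assoc A G (p w \<bullet> H) X"
proof -
  have "(p u \<triangleright> assoc A G H X) \<cdot> assoc A (p u) (G \<bullet> H) X \<cdot> (beta_inv_at A G H \<triangleleft> X) =
    assoc A (p u) G (H \<bullet> X) \<cdot> assoc A (p u \<bullet> G) H X \<cdot> (beta' G \<triangleleft> H \<triangleleft> X) \<cdot> (assoc' G (p w) H \<triangleleft> X)"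
    unfolding beta_inv_at_def using assms by (simp add: rw_vcomp reassoc[OF pentagon5])
  also have "\<dots> = assoc A (p u) G (H \<bullet> X) \<cdot> (beta' G \<triangleleft> (H \<bullet> X)) \<cdot> assoc A (G \<bullet> p w) H X \<cdot> (assoc' G (p w) H \<triangleleft> X)"
    using assms by (simp add: nat_rules)
  also have "\<dots> = beta_inv_at A G (H \<bullet> X) \<cdot> (G \<triangleright> assoc A (p w) H X) \<cdot> assoc A G (p w \<bullet> H) X"
    unfolding beta_inv_at_def using assms by (simp add: pentagon4)
  finally show ?thesis .
qed

lemma beta_comp_arr:
  assumes "G \<in> Mor A" "F \<in> Mor A" "src A G = tgt A F" "u = tgt A G" "v = src A G" "w = src A F"
  shows "beta' (G \<bullet> F) = assoc A (p u) G F \<cdot> (beta' G \<triangleleft> F) \<cdot> assoc' G (p v) F \<cdot> (G \<triangleright> beta' F) \<cdot> assoc A G F (p w)"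
  using beta_comp[of G F] assms by (simp add: composable_def vcomp_iso lw_iso rw_iso)

text \<open>The axiom \<open>beta_comp\<close>, inverted and whiskered with \<open>H\<close>; three
  forms of the pentagon redistribute the associators between the two factors on the right.\<close>

lemma beta_inv_at_comp:
  assumes "G \<in> Mor A" "F \<in> Mor A" "H \<in> Mor A" "src A G = tgt A F" "src A F = tgt A H"
    "u = tgt A G" "v = src A F"
  shows "(p u \<triangleright> assoc A G F H) \<cdot> beta_inv_at A (G \<bullet> F) H =
    beta_inv_at A G (F \<bullet> H) \<cdot> (G \<triangleright> beta_inv_at A F H) \<cdot> assoc A G F (p v \<bullet> H)"
proof -
  define w where "w = src A G"
  note a = assms w_def
  have "(p u \<triangleright> assoc A G F H) \<cdot> beta_inv_at A (G \<bullet> F) H =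
    (p u \<triangleright> assoc A G F H) \<cdot> assoc A (p u) (G \<bullet> F) H \<cdot> (assoc A (p u) G F \<triangleleft> H) \<cdot> (beta' G \<triangleleft> F \<triangleleft> H) \<cdot>
      (assoc' G (p w) F \<triangleleft> H) \<cdot> ((G \<triangleright> beta' F) \<triangleleft> H) \<cdot> (assoc A G F (p v) \<triangleleft> H) \<cdot> assoc' (G \<bullet> F) (p v) H"
    unfolding beta_inv_at_def using a by (simp add: rw_vcomp beta_comp_arr)
  also have "\<dots> = assoc A (p u) G (F \<bullet> H) \<cdot> (beta' G \<triangleleft> (F \<bullet> H)) \<cdot> assoc A (G \<bullet> p w) F H \<cdot>
      (assoc' G (p w) F \<triangleleft> H) \<cdot> ((G \<triangleright> beta' F) \<triangleleft> H) \<cdot> (assoc A G F (p v) \<triangleleft> H) \<cdot> assoc' (G \<bullet> F) (p v) H"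
    using a by (simp add: reassoc[OF pentagon5] nat_rules)
  also have "\<dots> = assoc A (p u) G (F \<bullet> H) \<cdot> (beta' G \<triangleleft> (F \<bullet> H)) \<cdot> assoc' G (p w) (F \<bullet> H) \<cdot>
      (G \<triangleright> assoc A (p w) F H) \<cdot> (G \<triangleright> (beta' F \<triangleleft> H)) \<cdot> assoc A G (F \<bullet> p v) H \<cdot> (assoc A G F (p v) \<triangleleft> H) \<cdot> assoc' (G \<bullet> F) (p v) H"
    using a by (simp add: reassoc[OF pentagon4] nat_rules)
  also have "\<dots> = assoc A (p u) G (F \<bullet> H) \<cdot> (beta' G \<triangleleft> (F \<bullet> H)) \<cdot> assoc' G (p w) (F \<bullet> H) \<cdot>
      (G \<triangleright> assoc A (p w) F H) \<cdot> (G \<triangleright> (beta' F \<triangleleft> H)) \<cdot> (G \<triangleright> assoc' F (p v) H) \<cdot> assoc A G F (p v \<bullet> H)"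
    using a by (simp add: pentagon1)
  also have "\<dots> = beta_inv_at A G (F \<bullet> H) \<cdot> (G \<triangleright> beta_inv_at A F H) \<cdot> assoc A G F (p v \<bullet> H)"
    unfolding beta_inv_at_def using a by (simp add: lw_vcomp)
  finally show ?thesis .
qed

text \<open>Clears the inverse of \<xi> from the axiom \<open>xi_beta\<close>: both sides are
  composed with \<open>runit A F \<cdot> (F \<triangleright> xi A w)\<close>, and
  \<open>unit_conj\<close> evaluates the left one, without sign because \<xi> is even.\<close>

lemma xi_unit_beta:
  assumes "F \<in> Mor A" "u = tgt A F" "w = src A F"
  shows "lunit A F \<cdot> (xi A u \<triangleleft> F) =
    runit A F \<cdot> (F \<triangleright> xi A w) \<cdot> assoc A F (p w) (p w) \<cdot> (beta A F \<triangleleft> p w) \<cdot> assoc' (p u) F (p w) \<cdot>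
    (p u \<triangleright> beta A F) \<cdot> assoc A (p u) (p u) F"
  using unit_conj[of F "xi A u" "xi A w" "p u \<bullet> p u" "p w \<bullet> p w"] xi_beta[OF assms(1)] assms by simp

text \<open>This is \<open>xi_unit_beta\<close> whiskered with \<open>H\<close>; the work lies in
  collecting the associators around the two occurrences of \<beta>_K.\<close>

lemma xi_at_beta:
  assumes "K \<in> Mor A" "H \<in> Mor A" "src A K = tgt A H" "u = tgt A K" "w = src A K"
  shows "xi_at A (K \<bullet> H) = (K \<triangleright> xi_at A H) \<cdot> inv2 A (beta_inv_at A K (p w \<bullet> H)) \<cdot> (p u \<triangleright> inv2 A (beta_inv_at A K H))"
proof -
  have "xi_at A (K \<bullet> H) = (lunit A K \<triangleleft> H) \<cdot> (xi A u \<triangleleft> K \<triangleleft> H) \<cdot> assoc' (p u \<bullet> p u) K H \<cdot> assoc' (p u) (p u) (K \<bullet> H)"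
    unfolding xi_at_def using assms by (simp add: nat_rules lunit_comp')
  also have "\<dots> = ((runit A K \<cdot> (K \<triangleright> xi A w) \<cdot> assoc A K (p w) (p w) \<cdot> (beta A K \<triangleleft> p w) \<cdot> assoc' (p u) K (p w) \<cdot>
    (p u \<triangleright> beta A K) \<cdot> assoc A (p u) (p u) K) \<triangleleft> H) \<cdot> assoc' (p u \<bullet> p u) K H \<cdot> assoc' (p u) (p u) (K \<bullet> H)"
    using assms by (simp only: xi_unit_beta[symmetric]) (simp add: rw_vcomp)
  also have "\<dots> = (runit A K \<triangleleft> H) \<cdot> ((K \<triangleright> xi A w) \<triangleleft> H) \<cdot> (assoc A K (p w) (p w) \<triangleleft> H) \<cdot> (beta A K \<triangleleft> p w \<triangleleft> H) \<cdot> 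
      (assoc' (p u) K (p w) \<triangleleft> H) \<cdot> assoc' (p u) (K \<bullet> p w) H \<cdot>
    (p u \<triangleright> (beta A K \<triangleleft> H)) \<cdot> (p u \<triangleright> assoc' (p u) K H)"
    using assms by (simp add: rw_vcomp pentagon2 nat_rules)
  also have "\<dots> = (runit A K \<triangleleft> H) \<cdot> ((K \<triangleright> xi A w) \<triangleleft> H) \<cdot> (assoc A K (p w) (p w) \<triangleleft> H) \<cdot> assoc' (K \<bullet> p w) (p w) H \<cdot>
    (beta A K \<triangleleft> (p w \<bullet> H)) \<cdot> assoc' (p u) K (p w \<bullet> H) \<cdot> (p u \<triangleright> inv2 A (beta_inv_at A K H))"
  proof -
    \<comment> \<open>The factor \<pi>\<beta>_K, applied first, is completed to
      \<open>p u \<triangleright> inv2 A (beta_inv_at A K H)\<close>.\<close>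
    have "(assoc' (p u) K (p w) \<triangleleft> H) \<cdot> assoc' (p u) (K \<bullet> p w) H \<cdot> (p u \<triangleright> (beta A K \<triangleleft> H)) \<cdot> (p u \<triangleright> assoc' (p u) K H) =
      assoc' (p u \<bullet> K) (p w) H \<cdot> assoc' (p u) K (p w \<bullet> H) \<cdot> (p u \<triangleright> inv2 A (beta_inv_at A K H))"
      using assms by (simp add: reassoc[OF pentagon3] lw_vcomp)
    then show ?thesis
      using assms by (simp add: nat_rules del: beta_inv_at_simps(5))
  qed
  also have "\<dots> = (runit A K \<triangleleft> H) \<cdot> assoc' K (unit1 A w) H \<cdot> (K \<triangleright> (xi A w \<triangleleft> H)) \<cdot> (K \<triangleright> assoc' (p w) (p w) H) \<cdot>
    inv2 A (beta_inv_at A K (p w \<bullet> H)) \<cdot> (p u \<triangleright> inv2 A (beta_inv_at A K H))"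
  proof -
    \<comment> \<open>The remaining factor \<beta>_K\<pi> is completed to the inverse of
      \<open>beta_inv_at A K (p w \<bullet> H)\<close>.\<close>
    have "(assoc A K (p w) (p w) \<triangleleft> H) \<cdot> assoc' (K \<bullet> p w) (p w) H \<cdot> (beta A K \<triangleleft> (p w \<bullet> H)) \<cdot> assoc' (p u) K (p w \<bullet> H) =
      assoc' K (p w \<bullet> p w) H \<cdot> (K \<triangleright> assoc' (p w) (p w) H) \<cdot> inv2 A (beta_inv_at A K (p w \<bullet> H))"
      using assms by (simp add: reassoc[OF pentagon1])
    from reassoc[OF this, of "p u \<triangleright> inv2 A (beta_inv_at A K H)"] show ?thesis
      using assms by (simp add: reassoc[OF assoc'_nat] del: beta_inv_at_simps(5))
  qed
  also have "\<dots> = (K \<triangleright> xi_at A H) \<cdot> inv2 A (beta_inv_at A K (p w \<bullet> H)) \<cdot> (p u \<triangleright> inv2 A (beta_inv_at A K H))"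
    unfolding xi_at_def using assms by (simp add: lw_vcomp reassoc[OF triangle1] del: beta_inv_at_simps(5))
  finally show ?thesis .
qed

text \<open>In this form the relation makes left whiskering in \<open>D2_obj A\<close> preserve
  composites of two odd 2-morphisms.\<close>

lemma xi_at_beta':
  assumes "K \<in> Mor A" "H \<in> Mor A" "src A K = tgt A H" "u = tgt A K" "w = src A K"
  shows "xi_at A (K \<bullet> H) \<cdot> (p u \<triangleright> beta_inv_at A K H) \<cdot> beta_inv_at A K (p w \<bullet> H) = K \<triangleright> xi_at A H"
  using assms by (simp add: xi_at_beta del: beta_inv_at_simps(5))

text \<open>For \<open>K = p u\<close> both factors \<open>beta_inv_at\<close> are -1 and the signs
  cancel. Associativity of three odd 2-morphisms rests on this.\<close>

lemma xi_at_pi: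
  assumes "H \<in> Mor A" "u = tgt A H"
  shows "xi_at A (p u \<bullet> H) = p u \<triangleright> xi_at A H"
  using xi_at_beta'[of "p u" H u u] assms by (simp add: beta_inv_at_pi)

text \<open>Together with \<open>xi_at_p\<close> this shows that \<zeta> in \<open>D2_obj A\<close>
  is inverted by the inverse of \<xi>, viewed as odd.\<close>

lemma xi_at_unit:
  assumes "u \<in> Ob A"
  shows "xi_at A (unit1 A u) = xi A u \<cdot> (p u \<triangleright> runit A (p u))"
proof -
  have "xi_at A (unit1 A u) = runit A (unit1 A u) \<cdot> (xi A u \<triangleleft> unit1 A u) \<cdot> assoc' (p u) (p u) (unit1 A u)"
    unfolding xi_at_def using assms by (simp add: lunit_eq_runit)
  also have "\<dots> = xi A u \<cdot> runit A (p u \<bullet> p u) \<cdot> assoc' (p u) (p u) (unit1 A u)"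
    using assms by (simp add: runit_rules)
  also have "\<dots> = xi A u \<cdot> (p u \<triangleright> runit A (p u))"
    using assms by (simp flip: runit_comp)
  finally show ?thesis .
qed

text \<open>In \<open>xi_unit_beta\<close> for \<pi> the value \<beta>_\<pi> = -1 enters twice, so
  no sign remains.\<close>

lemma xi_at_p:
  assumes "u \<in> Ob A"
  shows "xi_at A (p u) = runit A (p u) \<cdot> (p u \<triangleright> xi A u)"
  unfolding xi_at_def using assms xi_unit_beta[of "p u" u u]
  by (simp add: beta_pi reassoc[of "lunit A (p u)" "xi A u \<triangleleft> p u"])

end

section \<open>The \<open>\<Pi>\<close>-2-supercategory \<open>D\<^sub>2 A\<close>\<close>

text \<open>The odd 2-morphism of \<open>D\<^sub>2 A\<close> with target \<open>G\<close> that is given by \<open>u : F \<Rightarrow> \<pi>G\<close>.\<close>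

definition shift :: "'m \<Rightarrow> ('m, 'c) cell \<Rightarrow> ('m, 'c) cell" where
  "shift G u = Cell (cdom u) G 1 (cval u)"

lemma shift_sel [simp]: "cdom (shift G u) = cdom u" "ccod (shift G u) = G" "par (shift G u) = 1"
  "cval (shift G u) = cval u"
  by (auto simp: shift_def)

lemma D2_obj_sel [simp]:
  "Ob (D2_obj A) = Ob A" "Mor (D2_obj A) = Mor A" "src (D2_obj A) = src A" "tgt (D2_obj A) = tgt A"
  "unit1 (D2_obj A) = unit1 A" "comp1 (D2_obj A) = comp1 A" "id2 (D2_obj A) = id2 A"
  "assoc (D2_obj A) = assoc A" "lunit (D2_obj A) = lunit A" "runit (D2_obj A) = runit A"
  "pi1 (D2_obj A) = pi1 A" "Hom2 (D2_obj A) F G 0 = Hom2 A F G 0"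
  "Hom2 (D2_obj A) F G 1 = Hom2 A F (pi_comp A G) 0"
  by (auto simp: D2_obj_def)

lemma D2_parallel [simp]: "parallel (D2_obj A) = parallel A"
  by (auto simp: parallel_def fun_eq_iff)

lemma D2_composable [simp]: "composable (D2_obj A) = composable A"
  by (auto simp: composable_def fun_eq_iff)

lemma D2_cells_even [simp]: "cells (D2_obj A) F G 0 = cells A F G 0"
  by (auto simp: cells_def)

lemma D2_all_cells_even: "x \<in> all_cells A {0} \<longleftrightarrow> x \<in> all_cells (D2_obj A) UNIV \<and> par x = 0"
  by (auto simp: all_cells_def)

context pi_2category
begin

abbreviation D where "D \<equiv> D2_obj A"
abbreviation arrD where "arrD x \<equiv> x \<in> all_cells (D2_obj A) UNIV"

lemma arrD_even [simp]: "arr x \<Longrightarrow> arrD x"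
  by (simp only: D2_all_cells_even)

lemma arrD_shift [simp]:
  assumes "arr u" "ccod u = p (tgt A G) \<bullet> G" "G \<in> Mor A"
  shows "arrD (shift G u)"
  unfolding shift_def
proof (rule all_cellsI)
  have "cval u \<in> carrier (hom_of A u)"
    using arr_cells[OF assms(1)] by (auto simp: cells_def)
  then show "cval u \<in> carrier (Hom2 D (cdom u) G 1)"
    using assms by (simp add: pi_comp_def)
  show "parallel D (cdom u) G"
    using assms src_cod[OF assms(1)] tgt_cod[OF assms(1)] by (auto simp: parallel_def)
qed simp

text \<open>The last two equations are oriented so that the ends of every 1-morphism are rewritten to those of a \<open>cdom\<close>.\<close>

lemma arrD_cases:
  assumes "arrD x"
  obtains (even) "arr x"
  | (odd) u G where "x = shift G u" "arr u" "G \<in> Mor A" "ccod u = p (tgt A G) \<bullet> G"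
      "src A G = src A (cdom u)" "tgt A G = tgt A (cdom u)"
proof (cases "par x" rule: bit_cases)
  case 0
  then show thesis
    using assms by (intro even) (simp only: D2_all_cells_even)
next
  case 1
  let ?u = "Cell (cdom x) (pi_comp A (ccod x)) 0 (cval x)"
  have x: "parallel A (cdom x) (ccod x)" "cval x \<in> carrier (Hom2 D (cdom x) (ccod x) 1)"
    using all_cells_parallel[OF assms] all_cells_carrier[OF assms] 1 by simp_all
  then have u: "arr ?u"
    by (intro all_cellsI) (auto simp: parallel_def pi_comp_def)
  have "x = shift (ccod x) ?u"
    using 1 by (cases x) (auto simp: shift_def)
  then show thesis
    using x u by (intro odd[of "ccod x" ?u]) (auto simp: parallel_def pi_comp_def)
qed

lemma cell_evenI: "\<lbrakk>arr z; cdom z = F; ccod z = G\<rbrakk> \<Longrightarrow> Cell F G 0 (cval z) = z"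
  by (metis arr_par0 cell.collapse)

lemma underlying_simps [simp]:
  "arr x \<Longrightarrow> underlying A x = x"
  "\<lbrakk>arr u; ccod u = p (tgt A G) \<bullet> G\<rbrakk> \<Longrightarrow> underlying A (shift G u) = u"
  by (simp_all add: underlying_def pi_comp_def cell_evenI)

section \<open>The two compositions of \<open>D2_obj A\<close>, one rule for each pair of
  parities\<close>

lemma vcomp_D_ee [simp]: "\<lbrakk>arr x; arr y; ccod x = cdom y\<rbrakk> \<Longrightarrow> y \<cdot>\<^bsub>D\<^esub> x = y \<cdot> x"
  by (auto simp: D2_obj_def D2_vcomp_def intro!: cell_evenI)

lemma vcomp_D_eo [simp]:
  "\<lbrakk>arr u; arr y; ccod u = p (tgt A G) \<bullet> G; G = cdom y\<rbrakk> \<Longrightarrow>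
    y \<cdot>\<^bsub>D\<^esub> shift G u = shift (ccod y) ((p (tgt A (cdom y)) \<triangleright> y) \<cdot> u)"
  by (simp add: D2_obj_def D2_vcomp_def Let_def) (simp add: shift_def)

lemma vcomp_D_oe [simp]:
  "\<lbrakk>arr x; arr v; ccod v = p (tgt A H) \<bullet> H; ccod x = cdom v\<rbrakk> \<Longrightarrow> shift H v \<cdot>\<^bsub>D\<^esub> x = shift H (v \<cdot> x)"
  by (simp add: D2_obj_def D2_vcomp_def Let_def) (simp add: shift_def)

lemma vcomp_D_oo [simp]:
  "\<lbrakk>arr u; arr v; H \<in> Mor A; ccod v = p (tgt A H) \<bullet> H; ccod u = p (tgt A H) \<bullet> cdom v; G = cdom v;
    tgt A (cdom v) = tgt A H\<rbrakk> \<Longrightarrow>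
    shift H v \<cdot>\<^bsub>D\<^esub> shift G u = xi_at A H \<cdot> (p (tgt A H) \<triangleright> v) \<cdot> u"
  by (simp add: D2_obj_def D2_vcomp_def Let_def) (simp add: cell_evenI)

lemma hcomp_D_ee [simp]: "\<lbrakk>arr x; arr y; src A (cdom y) = tgt A (cdom x)\<rbrakk> \<Longrightarrow> y \<star>\<^bsub>D\<^esub> x = y \<star> x"
  by (simp add: D2_obj_def D2_hcomp_def Let_def) (simp add: cell_evenI)

lemma hcomp_D_eo [simp]:
  "\<lbrakk>arr u; arr y; H \<in> Mor A; ccod u = p (tgt A H) \<bullet> H; src A (cdom y) = tgt A H; tgt A (cdom u) = tgt A H\<rbrakk> \<Longrightarrow>
    y \<star>\<^bsub>D\<^esub> shift H u = shift (ccod y \<bullet> H) (beta_inv_at A (ccod y) H \<cdot> (y \<star> u))"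
  by (simp add: D2_obj_def D2_hcomp_def Let_def) (simp add: shift_def)

lemma hcomp_D_oe [simp]:
  "\<lbrakk>arr x; arr v; K \<in> Mor A; ccod v = p (tgt A K) \<bullet> K; src A K = tgt A (cdom x); src A (cdom v) = tgt A (cdom x)\<rbrakk> \<Longrightarrow>
    shift K v \<star>\<^bsub>D\<^esub> x = shift (K \<bullet> ccod x) (assoc A (p (tgt A K)) K (ccod x) \<cdot> (v \<star> x))"
  by (simp add: D2_obj_def D2_hcomp_def Let_def) (simp add: shift_def)

lemma hcomp_D_oo [simp]:
  "\<lbrakk>arr u; arr v; K \<in> Mor A; H \<in> Mor A; ccod v = p (tgt A K) \<bullet> K; ccod u = p (tgt A H) \<bullet> H;
    src A K = tgt A H; tgt A (cdom u) = tgt A H; src A (cdom v) = tgt A H\<rbrakk> \<Longrightarrow>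
    shift K v \<star>\<^bsub>D\<^esub> shift H u = neg2 A (xi_at A (K \<bullet> H) \<cdot> (p (tgt A K) \<triangleright> beta_inv_at A K H) \<cdot>
      assoc A (p (tgt A K)) K (p (tgt A H) \<bullet> H) \<cdot> (v \<star> u))"
  by (simp add: D2_obj_def D2_hcomp_def Let_def) (simp add: cell_evenI pi_comp_def)

lemma add2_D [simp]:
  "arr x \<Longrightarrow> add2 D x y = add2 A x y"
  "\<lbrakk>arr u; ccod u = p (tgt A G) \<bullet> G\<rbrakk> \<Longrightarrow> add2 D (shift G u) (shift G v) = shift G (add2 A u v)"
  by (auto simp: add2_def shift_def pi_comp_def)

lemma smult2_D [simp]:
  "arr x \<Longrightarrow> smult2 D r x = smult2 A r x"
  "\<lbrakk>arr u; ccod u = p (tgt A G) \<bullet> G\<rbrakk> \<Longrightarrow> smult2 D r (shift G u) = shift G (smult2 A r u)"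
  by (auto simp: smult2_def shift_def pi_comp_def)

lemma neg2_D [simp]:
  "arr x \<Longrightarrow> neg2 D x = neg2 A x"
  "\<lbrakk>arr u; ccod u = p (tgt A G) \<bullet> G\<rbrakk> \<Longrightarrow> neg2 D (shift G u) = shift G (neg2 A u)"
  by (auto simp: neg2_def shift_def pi_comp_def)

lemma arrD_ends [simp]:
  assumes "arrD x"
  shows "cdom x \<in> Mor A" "ccod x \<in> Mor A" "src A (ccod x) = src A (cdom x)" "tgt A (ccod x) = tgt A (cdom x)"
  using assms by (auto elim!: arrD_cases)

lemma arrD_composable_ends:
  "\<lbrakk>arrD x; ccod x = cdom y\<rbrakk> \<Longrightarrow> tgt A (cdom y) = tgt A (cdom x) \<and> src A (cdom y) = src A (cdom x)"
  by (metis arrD_ends(3,4))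

lemma vcomp_D_cell [simp]:
  assumes "arrD x" "arrD y" "ccod x = cdom y"
  shows "arrD (y \<cdot>\<^bsub>D\<^esub> x)" "cdom (y \<cdot>\<^bsub>D\<^esub> x) = cdom x" "ccod (y \<cdot>\<^bsub>D\<^esub> x) = ccod y" 
    "par (y \<cdot>\<^bsub>D\<^esub> x) = par y + par x"
  using assms by (elim arrD_cases; simp)+

lemma hcomp_D_cell [simp]:
  assumes "arrD x" "arrD y" "src A (cdom y) = tgt A (cdom x)"
  shows "arrD (y \<star>\<^bsub>D\<^esub> x)" "cdom (y \<star>\<^bsub>D\<^esub> x) = cdom y \<bullet> cdom x" "ccod (y \<star>\<^bsub>D\<^esub> x) = ccod y \<bullet> ccod x" 
    "par (y \<star>\<^bsub>D\<^esub> x) = par y + par x"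
  using assms by (elim arrD_cases; simp)+

text \<open>Only three odd 2-morphisms need more than functoriality of whiskering and naturality of
  \<xi>H: there \<xi>\<pi>H = \<pi>\<xi>H identifies the two ways of removing two out of three
  \<pi>.\<close>

lemma vcomp_D_assoc [simp]:
  assumes "arrD x" "arrD y" "arrD z" "ccod x = cdom y" "ccod y = cdom z"
  shows "(z \<cdot>\<^bsub>D\<^esub> y) \<cdot>\<^bsub>D\<^esub> x = z \<cdot>\<^bsub>D\<^esub> y \<cdot>\<^bsub>D\<^esub> x"
proof -
  have "tgt A (cdom y) = tgt A (cdom x)" "tgt A (cdom z) = tgt A (cdom x)"
    using assms by (metis arrD_ends(4))+
  then show ?thesis
    using assms
  proof (elim arrD_cases)
    fix u F v G w H
    assume x: "x = shift F u" "arr u" "F \<in> Mor A" "ccod u = p (tgt A F) \<bullet> F"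
        "src A F = src A (cdom u)" "tgt A F = tgt A (cdom u)"
      and y: "y = shift G v" "arr v" "G \<in> Mor A" "ccod v = p (tgt A G) \<bullet> G"
        "src A G = src A (cdom v)" "tgt A G = tgt A (cdom v)"
      and z: "z = shift H w" "arr w" "H \<in> Mor A" "ccod w = p (tgt A H) \<bullet> H"
        "src A H = src A (cdom w)" "tgt A H = tgt A (cdom w)"
      and c: "ccod x = cdom y" "ccod y = cdom z"
    have "(p (tgt A H) \<triangleright> xi_at A H) \<cdot> (p (tgt A H) \<triangleright> (p (tgt A H) \<triangleright> w)) = w \<cdot> xi_at A (cdom w)"
      using xi_at_nat[OF z(2) z(4)[symmetric] z(6)] unfolding xi_at_pi[OF z(3) refl] .
    from reassoc[OF this] show ?thesis
      using x y z c by (simp add: lw_vcomp)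
  qed (simp_all add: lw_vcomp reassoc[OF xi_at_nat])
qed

lemma vcomp_D_id [simp]:
  "\<lbrakk>arrD x; cdom x = F\<rbrakk> \<Longrightarrow> x \<cdot>\<^bsub>D\<^esub> id2 A F = x"
  "\<lbrakk>arrD x; ccod x = F\<rbrakk> \<Longrightarrow> id2 A F \<cdot>\<^bsub>D\<^esub> x = x"
  by (elim arrD_cases; force)+

lemma hcomp_split_rev:
  "\<lbrakk>arr x; arr y; src A (cdom y) = tgt A (cdom x); H = ccod x; K = cdom y\<rbrakk> \<Longrightarrow> (y \<triangleleft> H) \<cdot> (K \<triangleright> x) = y \<star> x"
  "\<lbrakk>arr x; arr y; src A (cdom y) = tgt A (cdom x); K = ccod y; H = cdom x\<rbrakk> \<Longrightarrow> (K \<triangleright> x) \<cdot> (y \<triangleleft> H) = y \<star> x"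
  using hcomp_split[of x y] hcomp_split'[of x y] by simp_all

lemma beta_inv_at_nat_rev:
  assumes "arr y" "K = cdom y" "H \<in> Mor A" "src A (cdom y) = tgt A H" "u = tgt A (cdom y)"
  shows "(p u \<triangleright> (y \<triangleleft> H)) \<cdot> beta_inv_at A K H = beta_inv_at A (ccod y) H \<cdot> (y \<triangleleft> (p (tgt A H) \<bullet> H))"
  using assms beta_inv_at_nat[of y "id2 A H"] by simp

lemma beta_inv_at_nat_rev2:
  assumes "arr x" "H = cdom x" "G \<in> Mor A" "src A G = tgt A (cdom x)" "u = tgt A G"
  shows "(p u \<triangleright> (G \<triangleright> x)) \<cdot> beta_inv_at A G H = beta_inv_at A G (ccod x) \<cdot> (G \<triangleright> (p (tgt A (cdom x)) \<triangleright> x))"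
  using assms beta_inv_at_nat[of "id2 A G" x] by simp

text \<open>For two odd 2-morphisms the right-hand side contains \<open>beta_inv_at\<close> at
  \<pi>K, which \<open>beta_inv_at_comp\<close> factors into its values at \<pi>, which is -1, and
  at K. This is why \<open>D2_hcomp\<close> carries a minus sign.\<close>

lemma hcomp_D_split:
  assumes "arrD x" "arrD y" "src A (cdom y) = tgt A (cdom x)"
  shows "y \<star>\<^bsub>D\<^esub> x = (y \<star>\<^bsub>D\<^esub> id2 A (ccod x)) \<cdot>\<^bsub>D\<^esub> (id2 A (cdom y) \<star>\<^bsub>D\<^esub> x)"
  using assms
proof (elim arrD_cases)
  fix u H v K
  assume x: "x = shift H u" "arr u" "H \<in> Mor A" "ccod u = p (tgt A H) \<bullet> H"
      "src A H = src A (cdom u)" "tgt A H = tgt A (cdom u)"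
    and y: "y = shift K v" "arr v" "K \<in> Mor A" "ccod v = p (tgt A K) \<bullet> K"
      "src A K = src A (cdom v)" "tgt A K = tgt A (cdom v)"
    and s: "src A (cdom y) = tgt A (cdom x)"
  show ?thesis
    using x y s by (simp add: lw_vcomp reassoc[OF beta_inv_at_nat_rev] reassoc[OF beta_inv_at_comp]
      beta_inv_at_pi hcomp_split_rev)
qed (simp_all add: hcomp_split_rev reassoc[OF beta_inv_at_nat_rev])

text \<open>For two odd factors this is \<open>xi_at_beta'\<close>: each \<pi> has to be moved
  across \<open>G\<close> before \<xi> can be applied.\<close>

lemma lw_vcomp_D:
  assumes "arrD x" "arrD y" "ccod x = cdom y" "G \<in> Mor A" "src A G = tgt A (cdom x)"
  shows "id2 A G \<star>\<^bsub>D\<^esub> (y \<cdot>\<^bsub>D\<^esub> x) = (id2 A G \<star>\<^bsub>D\<^esub> y) \<cdot>\<^bsub>D\<^esub> (id2 A G \<star>\<^bsub>D\<^esub> x)"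
proof -
  from arrD_composable_ends[OF assms(1,3)] show ?thesis
    using assms
    by (elim arrD_cases) (simp_all add: lw_vcomp reassoc[OF beta_inv_at_nat_rev2] reassoc3[OF xi_at_beta'])
qed

text \<open>For two odd factors this is \<open>xi_at_comp\<close>; \<beta> does not occur, because
  \<pi> already stands on the left.\<close>

lemma rw_vcomp_D:
  assumes "arrD x" "arrD y" "ccod x = cdom y" "F \<in> Mor A" "src A (cdom x) = tgt A F"
  shows "(y \<cdot>\<^bsub>D\<^esub> x) \<star>\<^bsub>D\<^esub> id2 A F = (y \<star>\<^bsub>D\<^esub> id2 A F) \<cdot>\<^bsub>D\<^esub> (x \<star>\<^bsub>D\<^esub> id2 A F)"
proof -
  from arrD_composable_ends[OF assms(1,3)] show ?thesis
    using assms
    by (elim arrD_cases) (simp_all add: rw_vcomp nat_rules lw_vcomp xi_at_comp[symmetric])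
qed

text \<open>In this order no \<beta> at \<pi>K arises. Two odd 2-morphisms therefore give the
  expression in \<open>D2_hcomp\<close> without its minus sign, and the discrepancy is the Koszul
  sign.\<close>

lemma hcomp_D_exchange:
  assumes "arrD x" "arrD y" "src A (cdom y) = tgt A (cdom x)"
  shows "(id2 A (ccod y) \<star>\<^bsub>D\<^esub> x) \<cdot>\<^bsub>D\<^esub> (y \<star>\<^bsub>D\<^esub> id2 A (cdom x)) = koszul D (par x) (par y) (y \<star>\<^bsub>D\<^esub> x)"
  using assms
  by (elim arrD_cases) (simp_all add: koszul_def lw_vcomp reassoc[OF assoc_lw(1)[symmetric]] hcomp_split_rev)

lemma koszul_D [simp]:
  assumes "arrD x"
  shows "arrD (koszul D r s x)" "cdom (koszul D r s x) = cdom x" "ccod (koszul D r s x) = ccod x"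
    "par (koszul D r s x) = par x"
  using assms by (auto simp: koszul_def elim!: arrD_cases)

lemma koszul_vcomp_D [simp]:
  assumes "arrD x" "arrD y" "ccod x = cdom y"
  shows "koszul D r s y \<cdot>\<^bsub>D\<^esub> x = koszul D r s (y \<cdot>\<^bsub>D\<^esub> x)" "y \<cdot>\<^bsub>D\<^esub> koszul D r s x = koszul D r s (y \<cdot>\<^bsub>D\<^esub> x)"
proof -
  from arrD_composable_ends[OF assms(1,3)] show "koszul D r s y \<cdot>\<^bsub>D\<^esub> x = koszul D r s (y \<cdot>\<^bsub>D\<^esub> x)" "y \<cdot>\<^bsub>D\<^esub> koszul D r s x = koszul D r s (y \<cdot>\<^bsub>D\<^esub> x)"
    using assms by (simp_all add: koszul_def) (elim arrD_cases; simp)+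
qed

lemma interchange_D:
  assumes "arrD x" "arrD x'" "arrD y" "arrD y'" "ccod x = cdom x'" "ccod y = cdom y'"
    "src A (cdom y) = tgt A (cdom x)"
  shows "(y' \<star>\<^bsub>D\<^esub> x') \<cdot>\<^bsub>D\<^esub> (y \<star>\<^bsub>D\<^esub> x) = koszul D (par x') (par y) ((y' \<cdot>\<^bsub>D\<^esub> y) \<star>\<^bsub>D\<^esub> (x' \<cdot>\<^bsub>D\<^esub> x))"
proof -
  have o: "tgt A (cdom y') = tgt A (cdom y)" "src A (cdom y') = src A (cdom y)"
    "tgt A (cdom x') = tgt A (cdom x)" "src A (cdom x') = src A (cdom x)"
    using assms by (metis arrD_ends(3,4))+
  let ?F = "cdom x'" and ?F' = "ccod x'" and ?G = "cdom y" and ?G' = "cdom y'"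
  \<comment> \<open>Interchange only swaps the two middle whiskers, hence the sign depends on
    \<open>x'\<close> and \<open>y\<close> alone.\<close>
  have ex: "(id2 A ?G' \<star>\<^bsub>D\<^esub> x') \<cdot>\<^bsub>D\<^esub> (y \<star>\<^bsub>D\<^esub> id2 A ?F) =
      koszul D (par x') (par y) ((y \<star>\<^bsub>D\<^esub> id2 A ?F') \<cdot>\<^bsub>D\<^esub> (id2 A ?G \<star>\<^bsub>D\<^esub> x'))"
    using assms o hcomp_D_exchange[of x' y] hcomp_D_split[of x' y] by simp
  have "(y' \<star>\<^bsub>D\<^esub> x') \<cdot>\<^bsub>D\<^esub> (y \<star>\<^bsub>D\<^esub> x) =
    (y' \<star>\<^bsub>D\<^esub> id2 A ?F') \<cdot>\<^bsub>D\<^esub> ((id2 A ?G' \<star>\<^bsub>D\<^esub> x') \<cdot>\<^bsub>D\<^esub> (y \<star>\<^bsub>D\<^esub> id2 A ?F)) \<cdot>\<^bsub>D\<^esub> (id2 A ?G \<star>\<^bsub>D\<^esub> x)"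
    using assms o hcomp_D_split[of x' y'] hcomp_D_split[of x y] by simp
  also have "\<dots> = koszul D (par x') (par y) (((y' \<star>\<^bsub>D\<^esub> id2 A ?F') \<cdot>\<^bsub>D\<^esub> (y \<star>\<^bsub>D\<^esub> id2 A ?F')) \<cdot>\<^bsub>D\<^esub>
      ((id2 A ?G \<star>\<^bsub>D\<^esub> x') \<cdot>\<^bsub>D\<^esub> (id2 A ?G \<star>\<^bsub>D\<^esub> x)))"
    unfolding ex using assms o by simp
  also have "\<dots> = koszul D (par x') (par y) (((y' \<cdot>\<^bsub>D\<^esub> y) \<star>\<^bsub>D\<^esub> id2 A ?F') \<cdot>\<^bsub>D\<^esub> (id2 A ?G \<star>\<^bsub>D\<^esub> (x' \<cdot>\<^bsub>D\<^esub> x)))"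
    using assms o by (simp add: lw_vcomp_D rw_vcomp_D)
  also have "\<dots> = koszul D (par x') (par y) ((y' \<cdot>\<^bsub>D\<^esub> y) \<star>\<^bsub>D\<^esub> (x' \<cdot>\<^bsub>D\<^esub> x))"
    using assms o hcomp_D_split[of "x' \<cdot>\<^bsub>D\<^esub> x" "y' \<cdot>\<^bsub>D\<^esub> y"] by simp
  finally show ?thesis .
qed

text \<open>At an odd 2-morphism the three positions need different facts: the pentagon on the left,
  \<open>beta_inv_at_whisker\<close> in the middle, multiplicativity of \<beta> on the
  right.\<close>

lemma assoc_D_whiskers:
  assumes "F \<in> Mor A" "G \<in> Mor A" "H \<in> Mor A" "src A H = tgt A G" "src A G = tgt A F"
  shows "\<lbrakk>arrD z; cdom z = H\<rbrakk> \<Longrightarrow> assoc A (ccod z) G F \<cdot>\<^bsub>D\<^esub> ((z \<star>\<^bsub>D\<^esub> id2 A G) \<star>\<^bsub>D\<^esub> id2 A F) =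
      (z \<star>\<^bsub>D\<^esub> id2 A (G \<bullet> F)) \<cdot>\<^bsub>D\<^esub> assoc A H G F"
    and "\<lbrakk>arrD y; cdom y = G\<rbrakk> \<Longrightarrow> assoc A H (ccod y) F \<cdot>\<^bsub>D\<^esub> ((id2 A H \<star>\<^bsub>D\<^esub> y) \<star>\<^bsub>D\<^esub> id2 A F) =
      (id2 A H \<star>\<^bsub>D\<^esub> (y \<star>\<^bsub>D\<^esub> id2 A F)) \<cdot>\<^bsub>D\<^esub> assoc A H G F"
    and "\<lbrakk>arrD x; cdom x = F\<rbrakk> \<Longrightarrow> assoc A H G (ccod x) \<cdot>\<^bsub>D\<^esub> (id2 A (H \<bullet> G) \<star>\<^bsub>D\<^esub> x) =
      (id2 A H \<star>\<^bsub>D\<^esub> (id2 A G \<star>\<^bsub>D\<^esub> x)) \<cdot>\<^bsub>D\<^esub> assoc A H G F"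
proof -
  show "assoc A (ccod z) G F \<cdot>\<^bsub>D\<^esub> ((z \<star>\<^bsub>D\<^esub> id2 A G) \<star>\<^bsub>D\<^esub> id2 A F) =
      (z \<star>\<^bsub>D\<^esub> id2 A (G \<bullet> F)) \<cdot>\<^bsub>D\<^esub> assoc A H G F" if "arrD z" "cdom z = H"
    using that assms
    by (elim arrD_cases) (simp_all add: nat_rules rw_vcomp reassoc3[OF pentagon_arr])
  show "assoc A H (ccod y) F \<cdot>\<^bsub>D\<^esub> ((id2 A H \<star>\<^bsub>D\<^esub> y) \<star>\<^bsub>D\<^esub> id2 A F) =
      (id2 A H \<star>\<^bsub>D\<^esub> (y \<star>\<^bsub>D\<^esub> id2 A F)) \<cdot>\<^bsub>D\<^esub> assoc A H G F" if "arrD y" "cdom y = G"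
    using that assms
    by (elim arrD_cases) (simp_all add: nat_rules rw_vcomp lw_vcomp reassoc3[OF beta_inv_at_whisker])
  show "assoc A H G (ccod x) \<cdot>\<^bsub>D\<^esub> (id2 A (H \<bullet> G) \<star>\<^bsub>D\<^esub> x) =
      (id2 A H \<star>\<^bsub>D\<^esub> (id2 A G \<star>\<^bsub>D\<^esub> x)) \<cdot>\<^bsub>D\<^esub> assoc A H G F" if "arrD x" "cdom x = F"
    using that assms
    by (elim arrD_cases) (simp_all add: nat_rules lw_vcomp reassoc[OF beta_inv_at_comp])
qed

lemma assoc_nat_D:
  assumes "arrD x" "arrD y" "arrD z" "src A (cdom z) = tgt A (cdom y)" "src A (cdom y) = tgt A (cdom x)"
  shows "assoc A (ccod z) (ccod y) (ccod x) \<cdot>\<^bsub>D\<^esub> ((z \<star>\<^bsub>D\<^esub> y) \<star>\<^bsub>D\<^esub> x) =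
    (z \<star>\<^bsub>D\<^esub> (y \<star>\<^bsub>D\<^esub> x)) \<cdot>\<^bsub>D\<^esub> assoc A (cdom z) (cdom y) (cdom x)"
proof -
  let ?F = "cdom x" and ?F' = "ccod x" and ?G = "cdom y" and ?G' = "ccod y" and ?H = "cdom z" and ?H' = "ccod z"
  have 1: "(z \<star>\<^bsub>D\<^esub> y) \<star>\<^bsub>D\<^esub> x = ((z \<star>\<^bsub>D\<^esub> id2 A ?G') \<star>\<^bsub>D\<^esub> id2 A ?F') \<cdot>\<^bsub>D\<^esub> ((id2 A ?H \<star>\<^bsub>D\<^esub> y) \<star>\<^bsub>D\<^esub> id2 A ?F') \<cdot>\<^bsub>D\<^esub>
      (id2 A (?H \<bullet> ?G) \<star>\<^bsub>D\<^esub> x)"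
    using assms hcomp_D_split[of x "z \<star>\<^bsub>D\<^esub> y"] hcomp_D_split[of y z] by (simp add: rw_vcomp_D)
  have 2: "z \<star>\<^bsub>D\<^esub> (y \<star>\<^bsub>D\<^esub> x) = (z \<star>\<^bsub>D\<^esub> id2 A (?G' \<bullet> ?F')) \<cdot>\<^bsub>D\<^esub> (id2 A ?H \<star>\<^bsub>D\<^esub> (y \<star>\<^bsub>D\<^esub> id2 A ?F')) \<cdot>\<^bsub>D\<^esub>
      (id2 A ?H \<star>\<^bsub>D\<^esub> (id2 A ?G \<star>\<^bsub>D\<^esub> x))"
    using assms hcomp_D_split[of "y \<star>\<^bsub>D\<^esub> x" z] hcomp_D_split[of x y] by (simp add: lw_vcomp_D)
  have "assoc A ?H' ?G' ?F' \<cdot>\<^bsub>D\<^esub> ((z \<star>\<^bsub>D\<^esub> y) \<star>\<^bsub>D\<^esub> x) =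
    (assoc A ?H' ?G' ?F' \<cdot>\<^bsub>D\<^esub> ((z \<star>\<^bsub>D\<^esub> id2 A ?G') \<star>\<^bsub>D\<^esub> id2 A ?F')) \<cdot>\<^bsub>D\<^esub> ((id2 A ?H \<star>\<^bsub>D\<^esub> y) \<star>\<^bsub>D\<^esub> id2 A ?F') \<cdot>\<^bsub>D\<^esub>
      (id2 A (?H \<bullet> ?G) \<star>\<^bsub>D\<^esub> x)"
    unfolding 1 using assms by simp
  also have "\<dots> = (z \<star>\<^bsub>D\<^esub> id2 A (?G' \<bullet> ?F')) \<cdot>\<^bsub>D\<^esub> (assoc A ?H ?G' ?F' \<cdot>\<^bsub>D\<^esub> ((id2 A ?H \<star>\<^bsub>D\<^esub> y) \<star>\<^bsub>D\<^esub> id2 A ?F')) \<cdot>\<^bsub>D\<^esub>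
      (id2 A (?H \<bullet> ?G) \<star>\<^bsub>D\<^esub> x)"
    using assms by (subst assoc_D_whiskers(1)[of _ _ ?H]) simp_all
  also have "\<dots> = (z \<star>\<^bsub>D\<^esub> id2 A (?G' \<bullet> ?F')) \<cdot>\<^bsub>D\<^esub> (id2 A ?H \<star>\<^bsub>D\<^esub> (y \<star>\<^bsub>D\<^esub> id2 A ?F')) \<cdot>\<^bsub>D\<^esub>
      (assoc A ?H ?G ?F' \<cdot>\<^bsub>D\<^esub> (id2 A (?H \<bullet> ?G) \<star>\<^bsub>D\<^esub> x))"
    using assms by (subst assoc_D_whiskers(2)[of _ ?G]) simp_all
  also have "\<dots> = (z \<star>\<^bsub>D\<^esub> (y \<star>\<^bsub>D\<^esub> x)) \<cdot>\<^bsub>D\<^esub> assoc A ?H ?G ?F"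
    unfolding 2 using assms by (subst assoc_D_whiskers(3)[of ?F]) simp_all
  finally show ?thesis .
qed

lemma lunit_nat_D:
  "\<lbrakk>arrD x; u = tgt A (cdom x)\<rbrakk> \<Longrightarrow>
    lunit A (ccod x) \<cdot>\<^bsub>D\<^esub> (id2 A (unit1 A u) \<star>\<^bsub>D\<^esub> x) = x \<cdot>\<^bsub>D\<^esub> lunit A (cdom x)"
  by (elim arrD_cases) (simp_all add: reassoc[OF beta_inv_at_unit] lunit_nat)

lemma runit_nat_D:
  "\<lbrakk>arrD x; u = src A (cdom x)\<rbrakk> \<Longrightarrow>
    runit A (ccod x) \<cdot>\<^bsub>D\<^esub> (x \<star>\<^bsub>D\<^esub> id2 A (unit1 A u)) = x \<cdot>\<^bsub>D\<^esub> runit A (cdom x)"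
  by (elim arrD_cases) (simp_all add: reassoc[OF runit_comp] runit_nat)

end

section \<open>Additivity and scalars\<close>

context linear_bicategory
begin

lemma add2_cell [simp]:
  assumes "arr x" "arr y" "cdom y = cdom x" "ccod y = ccod x" "par y = par x"
  shows "arr (add2 A x y)" "cdom (add2 A x y) = cdom x" "ccod (add2 A x y) = ccod x" "par (add2 A x y) = par x"
proof -
  interpret module k "hom_of A x"
    using Hom2_module arr_parallel assms(1) by simp
  show "cdom (add2 A x y) = cdom x" "ccod (add2 A x y) = ccod x" "par (add2 A x y) = par x"
    by (auto simp: add2_def)
  have "cval x \<in> carrier (hom_of A x)" "cval y \<in> carrier (hom_of A x)"
    using all_cells_carrier[OF assms(1)] all_cells_carrier[OF assms(2)] assms(3-5) by auto
  then show "arr (add2 A x y)"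
    unfolding add2_def using arr_parallel arr_par assms(1) by (intro all_cellsI a_closed)
qed

lemma smult2_cell [simp]:
  assumes "arr x" "r \<in> carrier k"
  shows "arr (smult2 A r x)" "cdom (smult2 A r x) = cdom x" "ccod (smult2 A r x) = ccod x" "par (smult2 A r x) = par x"
proof -
  interpret module k "hom_of A x"
    using Hom2_module arr_parallel assms(1) by simp
  show "cdom (smult2 A r x) = cdom x" "ccod (smult2 A r x) = ccod x" "par (smult2 A r x) = par x"
    by (auto simp: smult2_def)
  show "arr (smult2 A r x)"
    unfolding smult2_def using arr_parallel arr_par assms all_cells_carrier[OF assms(1)]
    by (intro all_cellsI smult_closed)
qed

lemma neg2_add2:
  assumes "arr x" "arr y" "cdom y = cdom x" "ccod y = ccod x" "par y = par x"
  shows "neg2 A (add2 A x y) = add2 A (neg2 A x) (neg2 A y)"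
proof -
  interpret module k "hom_of A x"
    using Hom2_module arr_parallel assms(1) by simp
  have "cval x \<in> carrier (hom_of A x)" "cval y \<in> carrier (hom_of A x)"
    using all_cells_carrier[OF assms(1)] all_cells_carrier[OF assms(2)] assms(3-5) by auto
  then show ?thesis
    using minus_add assms(3-5) by (simp add: neg2_def add2_def)
qed

lemma neg2_smult2:
  assumes "arr x" "r \<in> carrier k"
  shows "neg2 A (smult2 A r x) = smult2 A r (neg2 A x)"
proof -
  interpret module k "hom_of A x"
    using Hom2_module arr_parallel assms(1) by simp
  show ?thesis
    using smult_r_minus[OF assms(2) all_cells_carrier[OF assms(1)]] by (simp add: neg2_def smult2_def)
qed

lemma vcomp_add2:
  "\<lbrakk>arr x; arr x'; arr y; ccod x = cdom y; cdom x' = cdom x; ccod x' = cdom y; par x' = par x\<rbrakk> \<Longrightarrow>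
    y \<cdot> add2 A x x' = add2 A (y \<cdot> x) (y \<cdot> x')"
  "\<lbrakk>arr x; arr y; arr y'; ccod x = cdom y; cdom y' = cdom y; ccod y' = ccod y; par y' = par y\<rbrakk> \<Longrightarrow>
    add2 A y y' \<cdot> x = add2 A (y \<cdot> x) (y' \<cdot> x)"
  using vcomp_add_right[of x "cdom x" "cdom y" "par x" x' y "ccod y" "par y"]
    vcomp_add_left[of x "cdom x" "cdom y" "par x" y "ccod y" "par y" y']
  by (auto simp: mem_cells_iff[of _ P])

lemma hcomp_add2:
  "\<lbrakk>arr x; arr x'; arr y; src A (cdom y) = tgt A (cdom x); cdom x' = cdom x; ccod x' = ccod x; par x' = par x\<rbrakk> \<Longrightarrow>
    y \<star> add2 A x x' = add2 A (y \<star> x) (y \<star> x')"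
  "\<lbrakk>arr x; arr y; arr y'; src A (cdom y) = tgt A (cdom x); cdom y' = cdom y; ccod y' = ccod y; par y' = par y\<rbrakk> \<Longrightarrow>
    add2 A y y' \<star> x = add2 A (y \<star> x) (y' \<star> x)"
  using hcomp_add_right[of "cdom y" "cdom x" x "ccod x" "par x" x' y "ccod y" "par y"]
    hcomp_add_left[of "cdom y" "cdom x" x "ccod x" "par x" y "ccod y" "par y" y']
  by (auto simp: mem_cells_iff[of _ P] composable_def)

lemma vcomp_smult2:
  assumes "arr x" "arr y" "ccod x = cdom y" "r \<in> carrier k"
  shows "y \<cdot> smult2 A r x = smult2 A r (y \<cdot> x)" "smult2 A r y \<cdot> x = smult2 A r (y \<cdot> x)"
  using assms vcomp_smult[of x "cdom x" "cdom y" "par x" y "ccod y" "par y" r] 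
  by (auto simp: mem_cells_iff[of _ P])

lemma hcomp_smult2:
  assumes "arr x" "arr y" "src A (cdom y) = tgt A (cdom x)" "r \<in> carrier k"
  shows "y \<star> smult2 A r x = smult2 A r (y \<star> x)" "smult2 A r y \<star> x = smult2 A r (y \<star> x)"
  using assms hcomp_smult[of "cdom y" "cdom x" x "ccod x" "par x" y "ccod y" "par y" r]
  by (auto simp: mem_cells_iff[of _ P] composable_def)

lemmas bilinear_rules = vcomp_add2 hcomp_add2 vcomp_smult2 hcomp_smult2 neg2_add2 neg2_smult2

end

context pi_2category
begin

lemma isos_D_even:
  assumes "arr x" "inverse2 A x y"
  shows "inverse2 D x y"
  using assms inverse2_arr[OF assms] by (auto simp: inverse2_def)

text \<open>The inverse of \<zeta> has to be an odd 2-morphism 1 \<Rightarrow> \<pi>, so it is given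
  by a 2-morphism 1 \<Rightarrow> \<pi>\<pi> of \<open>A\<close>, namely the inverse of
  \<xi>.\<close>

lemma inverse_zeta_D:
  assumes "u \<in> Ob A"
  shows "inverse2 D (shift (unit1 A u) (runit' (p u))) (shift (p u) (inv2 A (xi A u)))"
proof -
  have "xi_at A (unit1 A u) \<cdot> (p u \<triangleright> runit' (p u)) \<cdot> inv2 A (xi A u) = id2 A (unit1 A u)"
    using assms by (simp add: xi_at_unit)
  moreover have "xi_at A (p u) \<cdot> (p u \<triangleright> inv2 A (xi A u)) \<cdot> runit' (p u) = id2 A (p u)"
    using assms by (simp add: xi_at_p)
  ultimately show ?thesis
    using assms by (simp add: inverse2_def mem_cells_iff[of _ UNIV])
qed

lemma zeta_D: "zeta D u = shift (unit1 A u) (runit' (p u))" if "u \<in> Ob A"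
  using that by (simp add: D2_obj_def shift_def)

lemma vcomp_D_add:
  assumes "arrD x" "arrD y" "ccod x = cdom y"
  shows "\<lbrakk>arrD x'; cdom x' = cdom x; ccod x' = cdom y; par x' = par x\<rbrakk> \<Longrightarrow>
      y \<cdot>\<^bsub>D\<^esub> add2 D x x' = add2 D (y \<cdot>\<^bsub>D\<^esub> x) (y \<cdot>\<^bsub>D\<^esub> x')"
    "\<lbrakk>arrD y'; cdom y' = cdom y; ccod y' = ccod y; par y' = par y\<rbrakk> \<Longrightarrow>
      add2 D y y' \<cdot>\<^bsub>D\<^esub> x = add2 D (y \<cdot>\<^bsub>D\<^esub> x) (y' \<cdot>\<^bsub>D\<^esub> x)"
  using assms arrD_composable_ends[OF assms(1,3)] by (elim arrD_cases; simp add: bilinear_rules)+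

lemma vcomp_D_smult:
  assumes "arrD x" "arrD y" "ccod x = cdom y" "r \<in> carrier k"
  shows "y \<cdot>\<^bsub>D\<^esub> smult2 D r x = smult2 D r (y \<cdot>\<^bsub>D\<^esub> x)" "smult2 D r y \<cdot>\<^bsub>D\<^esub> x = smult2 D r (y \<cdot>\<^bsub>D\<^esub> x)"
  using assms arrD_composable_ends[OF assms(1,3)] by (elim arrD_cases; simp add: bilinear_rules)+

lemma hcomp_D_add:
  assumes "arrD x" "arrD y" "src A (cdom y) = tgt A (cdom x)"
  shows "\<lbrakk>arrD x'; cdom x' = cdom x; ccod x' = ccod x; par x' = par x\<rbrakk> \<Longrightarrow>
      y \<star>\<^bsub>D\<^esub> add2 D x x' = add2 D (y \<star>\<^bsub>D\<^esub> x) (y \<star>\<^bsub>D\<^esub> x')"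
    "\<lbrakk>arrD y'; cdom y' = cdom y; ccod y' = ccod y; par y' = par y\<rbrakk> \<Longrightarrow>
      add2 D y y' \<star>\<^bsub>D\<^esub> x = add2 D (y \<star>\<^bsub>D\<^esub> x) (y' \<star>\<^bsub>D\<^esub> x)"
  using assms by (elim arrD_cases; simp add: bilinear_rules)+

lemma hcomp_D_smult:
  assumes "arrD x" "arrD y" "src A (cdom y) = tgt A (cdom x)" "r \<in> carrier k"
  shows "y \<star>\<^bsub>D\<^esub> smult2 D r x = smult2 D r (y \<star>\<^bsub>D\<^esub> x)" "smult2 D r y \<star>\<^bsub>D\<^esub> x = smult2 D r (y \<star>\<^bsub>D\<^esub> x)"
  using assms by (elim arrD_cases; simp add: bilinear_rules)+

lemma Hom2_module_D:
  assumes "parallel A F G"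
  shows "module k (Hom2 D F G r)"
  using assms Hom2_module[of F G 0] Hom2_module[of F "pi_comp A G" 0]
  by (cases r rule: bit_cases) (simp_all add: parallel_def pi_comp_def)

lemma isos_D: "x \<in> isos A F G 0 \<Longrightarrow> x \<in> isos D F G 0"
  using isos_D_even[of x] mem_cells_iff[OF zero_parity, of x A F G] by (auto simp: isos_def)

theorem pi_2supercategory_D2_obj: "pi_2supercategory k D"
proof (intro pi_2supercategory.intro linear_bicategory.intro pi_2supercategory_axioms.intro)
  show "cring k" by (rule ground)
next
  fix F assume "F \<in> Mor D"
  then show "id2 D F \<in> cells D F F 0"
    by (simp add: id2_cell)
next
  fix u assume "u \<in> Ob D"
  then show "zeta D u \<in> isos D (pi1 D u) (unit1 D u) 1"
    using inverse_zeta_D[of u] by (auto simp: isos_def zeta_D mem_cells_iff[of _ UNIV])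
qed (auto simp: composable_def Hom2_module_D mem_cells_iff[of _ UNIV] vcomp_D_add vcomp_D_smult hcomp_D_add
    hcomp_D_smult interchange_D assoc_nat_D lunit_nat_D runit_nat_D pentagon_arr triangle_arr intro!: isos_D isosI)

end

section \<open>The \<open>\<Pi>\<close>-2-category \<open>E\<^sub>2 A\<close>\<close>

text \<open>The axioms involving parities quantify over those in \<open>P\<close>, so they persist
  for a smaller set closed under addition. For \<open>Q = {0}\<close> this is the passage to the
  underlying bicategory.\<close>

lemma (in linear_bicategory) restrict_parities:
  assumes "Q \<subseteq> P" "0 \<in> Q" "\<And>p q. p \<in> Q \<Longrightarrow> q \<in> Q \<Longrightarrow> p + q \<in> Q"
  shows "linear_bicategory k Q A"
proof -
  note Q = subsetD[OF assms(1)]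
  show ?thesis
    by (rule linear_bicategory.intro; (rule ground assms(2))?;
      (blast intro: Q assms(3) mor_ends unit1 comp1 Hom2_module id2_cell vcomp_cell vcomp_add_right
        vcomp_add_left vcomp_smult vcomp_id vcomp_assoc hcomp_cell hcomp_add_right hcomp_add_left hcomp_smult
        hcomp_id interchange assoc_iso assoc_natural lunit_iso lunit_natural runit_iso runit_natural
        pentagon triangle)?;
      (rule mor_ends unit1 comp1 vcomp_smult vcomp_id hcomp_smult; blast intro: Q)?)
qed

lemma (in linear_bicategory) whisker_exchange:
  assumes "arr x" "arr y" "src A (cdom y) = tgt A (cdom x)" "F = cdom x" "F' = ccod x" "G = cdom y" "G' = ccod y"
  shows "(G' \<triangleright> x) \<cdot> (y \<triangleleft> F) = koszul A (par x) (par y) ((y \<triangleleft> F') \<cdot> (G \<triangleright> x))"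
    "(y \<triangleleft> F') \<cdot> (G \<triangleright> x) = koszul A (par x) (par y) ((G' \<triangleright> x) \<cdot> (y \<triangleleft> F))"
proof -
  show *: "(G' \<triangleright> x) \<cdot> (y \<triangleleft> F) = koszul A (par x) (par y) ((y \<triangleleft> F') \<cdot> (G \<triangleright> x))"
    unfolding assms(4-7) hcomp_split'[OF assms(1-3)] hcomp_split[OF assms(1-3), symmetric] ..
  show "(y \<triangleleft> F') \<cdot> (G \<triangleright> x) = koszul A (par x) (par y) ((G' \<triangleright> x) \<cdot> (y \<triangleleft> F))"
    unfolding * using assms by (simp add: koszul_def)
qed

lemma E2_obj_sel [simp]:
  "Ob (E2_obj A) = Ob A" "Mor (E2_obj A) = Mor A" "src (E2_obj A) = src A" "tgt (E2_obj A) = tgt A"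
  "unit1 (E2_obj A) = unit1 A" "comp1 (E2_obj A) = comp1 A" "Hom2 (E2_obj A) = Hom2 A"
  "id2 (E2_obj A) = id2 A" "vcomp (E2_obj A) = vcomp A" "hcomp (E2_obj A) = hcomp A"
  "assoc (E2_obj A) = assoc A" "lunit (E2_obj A) = lunit A" "runit (E2_obj A) = runit A"
  "pi1 (E2_obj A) = pi1 A"
  by (simp_all add: E2_obj_def pi_bicat.defs pi_2cat.defs)

lemma E2_derived [simp]:
  "composable (E2_obj A) = composable A" "parallel (E2_obj A) = parallel A" "cells (E2_obj A) = cells A"
  "all_cells (E2_obj A) = all_cells A" "add2 (E2_obj A) = add2 A" "smult2 (E2_obj A) = smult2 A"
  "neg2 (E2_obj A) = neg2 A" "koszul (E2_obj A) = koszul A" "inverse2 (E2_obj A) = inverse2 A"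
  "isos (E2_obj A) = isos A" "inv2 (E2_obj A) = inv2 A"
proof -
  show *: "composable (E2_obj A) = composable A" "parallel (E2_obj A) = parallel A"
    by (simp_all add: composable_def parallel_def fun_eq_iff)
  then show c: "cells (E2_obj A) = cells A"
    by (simp add: cells_def fun_eq_iff)
  then show "all_cells (E2_obj A) = all_cells A"
    by (simp add: all_cells_def fun_eq_iff)
  show n: "neg2 (E2_obj A) = neg2 A" and "add2 (E2_obj A) = add2 A" "smult2 (E2_obj A) = smult2 A"
    by (simp_all add: add2_def smult2_def neg2_def fun_eq_iff)
  from n show "koszul (E2_obj A) = koszul A"
    by (simp add: koszul_def fun_eq_iff)
  show i: "inverse2 (E2_obj A) = inverse2 A"
    using c by (simp add: inverse2_def fun_eq_iff)
  with c show "isos (E2_obj A) = isos A" "inv2 (E2_obj A) = inv2 A"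
    by (simp_all add: isos_def inv2_def fun_eq_iff)
qed

lemma linear_bicategory_E2_obj: "linear_bicategory k P (E2_obj A) \<longleftrightarrow> linear_bicategory k P A"
  by (simp add: linear_bicategory_def)

section \<open>Whiskerings of \<zeta>, and \<beta> and \<xi> expressed by them\<close>

context pi_2supercategory
begin

abbreviation p :: "'o \<Rightarrow> 'm" where "p \<equiv> pi1 A"

lemma p_simps [simp]:
  "u \<in> Ob A \<Longrightarrow> p u \<in> Mor A" "u \<in> Ob A \<Longrightarrow> src A (p u) = u" "u \<in> Ob A \<Longrightarrow> tgt A (p u) = u"
  using pi1 by auto

lemma zeta_simps [simp]:
  assumes "u \<in> Ob A"
  shows "arr (zeta A u)" "cdom (zeta A u) = p u" "ccod (zeta A u) = unit1 A u" "par (zeta A u) = 1" "iso2 A (zeta A u)"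
  using isosD[OF zeta_iso UNIV_I] assms by auto

definition lzeta :: "'m \<Rightarrow> ('m, 'c) cell" where
  "lzeta F = lunit A F \<cdot> (zeta A (tgt A F) \<triangleleft> F)"

definition rzeta :: "'m \<Rightarrow> ('m, 'c) cell" where
  "rzeta F = runit A F \<cdot> (F \<triangleright> zeta A (src A F))"

lemma lzeta_simps [simp]:
  assumes "F \<in> Mor A"
  shows "arr (lzeta F)" "cdom (lzeta F) = p (tgt A F) \<bullet> F" "ccod (lzeta F) = F" "par (lzeta F) = 1" "iso2 A (lzeta F)"
  unfolding lzeta_def using assms by (simp_all add: vcomp_iso rw_iso)

lemma rzeta_simps [simp]:
  assumes "F \<in> Mor A"
  shows "arr (rzeta F)" "cdom (rzeta F) = F \<bullet> p (src A F)" "ccod (rzeta F) = F" "par (rzeta F) = 1" "iso2 A (rzeta F)"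
  unfolding rzeta_def using assms by (simp_all add: vcomp_iso lw_iso)

text \<open>Since \<zeta> is odd, moving it past \<open>x\<close> costs a sign exactly when
  \<open>x\<close> is odd.\<close>

lemma lzeta_nat:
  assumes "arr x" "u = tgt A (cdom x)" "G = ccod x"
  shows "lzeta G \<cdot> (p u \<triangleright> x) = koszul A (par x) 1 (x \<cdot> lzeta (cdom x))"
proof -
  have "(zeta A u \<triangleleft> G) \<cdot> (p u \<triangleright> x) = koszul A (par x) 1 ((unit1 A u \<triangleright> x) \<cdot> (zeta A u \<triangleleft> cdom x))"
    using assms by (subst whisker_exchange(2)[of x "zeta A u" "cdom x" _ _ "unit1 A u"]) simp_all
  then show ?thesis
    unfolding lzeta_def using assms by (simp add: reassoc[OF lunit_nat])
qed

lemma rzeta_nat: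
  assumes "arr x" "u = src A (cdom x)" "G = ccod x"
  shows "rzeta G \<cdot> (x \<triangleleft> p u) = koszul A 1 (par x) (x \<cdot> rzeta (cdom x))"
proof -
  have "(G \<triangleright> zeta A u) \<cdot> (x \<triangleleft> p u) = koszul A 1 (par x) ((x \<triangleleft> unit1 A u) \<cdot> (cdom x \<triangleright> zeta A u))"
    using assms by (subst whisker_exchange(1)[of "zeta A u" x _ "unit1 A u" "cdom x"]) simp_all
  then show ?thesis
    unfolding rzeta_def using assms by (simp add: reassoc[OF runit_nat])
qed

lemma lzeta_comp:
  assumes "G \<in> Mor A" "F \<in> Mor A" "src A G = tgt A F" "u = tgt A G"
  shows "lzeta (G \<bullet> F) \<cdot> assoc A (p u) G F = lzeta G \<triangleleft> F"
proof -
  have "lzeta (G \<bullet> F) \<cdot> assoc A (p u) G F =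
    lunit A (G \<bullet> F) \<cdot> assoc A (unit1 A u) G F \<cdot> (zeta A u \<triangleleft> G \<triangleleft> F)"
    unfolding lzeta_def using assms by (simp add: nat_rules)
  also have "\<dots> = lzeta G \<triangleleft> F"
    unfolding lzeta_def using assms by (simp add: rw_vcomp reassoc[OF lunit_comp])
  finally show ?thesis .
qed

lemma rzeta_comp:
  assumes "G \<in> Mor A" "F \<in> Mor A" "src A G = tgt A F" "u = src A F"
  shows "(G \<triangleright> rzeta F) \<cdot> assoc A G F (p u) = rzeta (G \<bullet> F)"
proof -
  have "(G \<triangleright> rzeta F) \<cdot> assoc A G F (p u) = (G \<triangleright> runit A F) \<cdot> assoc A G F (unit1 A u) \<cdot> ((G \<bullet> F) \<triangleright> zeta A u)"
    unfolding rzeta_def using assms by (simp add: nat_rules lw_vcomp)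
  also have "\<dots> = rzeta (G \<bullet> F)"
    unfolding rzeta_def using assms by (simp add: reassoc[OF runit_comp])
  finally show ?thesis .
qed

text \<open>The \<pi> in the middle of G\<pi>F can be removed towards either neighbour; the triangle
  identifies the two ways.\<close>

lemma lzeta_rzeta:
  assumes "G \<in> Mor A" "F \<in> Mor A" "src A G = tgt A F" "u = src A G"
  shows "(G \<triangleright> lzeta F) \<cdot> assoc A G (p u) F = rzeta G \<triangleleft> F"
proof -
  have "(G \<triangleright> lzeta F) \<cdot> assoc A G (p u) F = (G \<triangleright> lunit A F) \<cdot> assoc A G (unit1 A u) F \<cdot> ((G \<triangleright> zeta A u) \<triangleleft> F)"
    unfolding lzeta_def using assms by (simp add: nat_rules lw_vcomp)
  also have "\<dots> = rzeta G \<triangleleft> F"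
    unfolding rzeta_def using assms by (simp add: reassoc[OF triangle_arr] rw_vcomp)
  finally show ?thesis .
qed

text \<open>The sign comes from exchanging \<zeta> with itself. It matches the one in
  \<open>E2_obj\<close>, so that \<xi> there is a vertical composite of two whiskerings of
  \<zeta>.\<close>

lemma zeta_lzeta_pi:
  assumes "u \<in> Ob A"
  shows "zeta A u \<cdot> lzeta (p u) = neg2 A (lunit A (unit1 A u) \<cdot> (zeta A u \<star> zeta A u))"
proof -
  have "zeta A u \<cdot> lzeta (p u) = lunit A (unit1 A u) \<cdot> (unit1 A u \<triangleright> zeta A u) \<cdot> (zeta A u \<triangleleft> p u)"
    unfolding lzeta_def using assms by (simp add: lunit_rules)
  then show ?thesis
    using assms hcomp_split'[of "zeta A u" "zeta A u"] by simp
qed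

text \<open>Composed with \<zeta>, the two whiskerings become the two orders of writing
  \<zeta>\<zeta> as a vertical composite, which differ by a sign. This is the source of
  \<beta>_\<pi> = -1.\<close>

lemma lzeta_pi:
  assumes "u \<in> Ob A"
  shows "lzeta (p u) = neg2 A (rzeta (p u))"
proof (rule iso_lcancel[of "zeta A u"])
  have "zeta A u \<cdot> rzeta (p u) = lunit A (unit1 A u) \<cdot> (zeta A u \<triangleleft> unit1 A u) \<cdot> (p u \<triangleright> zeta A u)"
    unfolding rzeta_def using assms by (simp add: lunit_eq_runit runit_rules)
  then show "zeta A u \<cdot> lzeta (p u) = zeta A u \<cdot> neg2 A (rzeta (p u))"
    using assms hcomp_split[of "zeta A u" "zeta A u"] by (simp add: zeta_lzeta_pi)
qed (use assms in simp_all)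

definition E2_beta :: "'m \<Rightarrow> ('m, 'c) cell" where "E2_beta F = beta (E2_obj A) F"

definition E2_xi :: "'o \<Rightarrow> ('m, 'c) cell" where "E2_xi u = xi (E2_obj A) u"

lemma E2_beta_raw:
  "E2_beta F = neg2 A ((lunit A F \<triangleleft> p (src A F)) \<cdot> ((zeta A (tgt A F) \<triangleleft> F) \<star> inv2 A (zeta A (src A F))) \<cdot>
     runit' (p (tgt A F) \<bullet> F))"
  by (simp add: E2_beta_def E2_obj_def pi_bicat.defs pi_2cat.defs)

lemma E2_xi_eq: "u \<in> Ob A \<Longrightarrow> E2_xi u = zeta A u \<cdot> lzeta (p u)"
  by (simp add: E2_xi_def E2_obj_def pi_bicat.defs pi_2cat.defs zeta_lzeta_pi)

text \<open>With two odd 2-morphisms \<open>unit_conj\<close> yields the negative of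
  \<open>lzeta F\<close>; the minus sign in the definition of \<beta> compensates for it.\<close>

lemma E2_beta_eq:
  assumes "F \<in> Mor A"
  shows "E2_beta F = inv2 A (rzeta F) \<cdot> lzeta F"
proof (rule iso_lmove)
  let ?b = "(lunit A F \<triangleleft> p (src A F)) \<cdot> ((zeta A (tgt A F) \<triangleleft> F) \<star> inv2 A (zeta A (src A F))) \<cdot> runit' (p (tgt A F) \<bullet> F)"
  have "rzeta F \<cdot> ?b = neg2 A (lzeta F)"
    using unit_conj[of F "zeta A (tgt A F)" "zeta A (src A F)"] assms
    by (simp add: rzeta_def lzeta_def)
  then show "rzeta F \<cdot> E2_beta F = lzeta F"
    unfolding E2_beta_raw using assms by simp
qed (use assms in \<open>simp_all add: E2_beta_raw\<close>)

lemma E2_beta_simps [simp]: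
  assumes "F \<in> Mor A"
  shows "arr (E2_beta F)" "cdom (E2_beta F) = p (tgt A F) \<bullet> F" "ccod (E2_beta F) = F \<bullet> p (src A F)" "par (E2_beta F) = 0"
    "iso2 A (E2_beta F)"
  using assms by (simp_all add: E2_beta_eq vcomp_iso)

lemma E2_xi_simps [simp]:
  assumes "u \<in> Ob A"
  shows "arr (E2_xi u)" "cdom (E2_xi u) = p u \<bullet> p u" "ccod (E2_xi u) = unit1 A u" "par (E2_xi u) = 0"
    "iso2 A (E2_xi u)"
  using assms by (simp_all add: E2_xi_eq vcomp_iso)

lemma rzeta_beta: "F \<in> Mor A \<Longrightarrow> rzeta F \<cdot> E2_beta F = lzeta F"
  by (simp add: E2_beta_eq)

lemma E2_beta_nat:
  assumes "arr x" "par x = 0"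
  shows "E2_beta (ccod x) \<cdot> (p (tgt A (cdom x)) \<triangleright> x) = (x \<triangleleft> p (src A (cdom x))) \<cdot> E2_beta (cdom x)"
  by (rule iso_lcancel[of "rzeta (ccod x)"])
    (use assms in \<open>simp_all add: reassoc[OF rzeta_beta] rzeta_beta lzeta_nat reassoc[OF rzeta_nat]\<close>)

text \<open>After composing with \<open>rzeta (G \<bullet> F)\<close>, \<zeta> travels to the left:
  past \<open>F\<close> by \<beta>_F, across the bracket by \<open>lzeta_rzeta\<close>, past
  \<open>G\<close> by \<beta>_G, until it has become \<open>lzeta (G \<bullet> F)\<close>.\<close>

lemma E2_beta_comp:
  assumes "G \<in> Mor A" "F \<in> Mor A" "src A G = tgt A F"
  shows "E2_beta (G \<bullet> F) = assoc' G F (p (src A F)) \<cdot> (G \<triangleright> E2_beta F) \<cdot> assoc A G (p (tgt A F)) F \<cdot>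
    (E2_beta G \<triangleleft> F) \<cdot> assoc' (p (tgt A G)) G F"
proof (rule iso_lcancel[of "rzeta (G \<bullet> F)"])
  have "rzeta (G \<bullet> F) \<cdot> assoc' G F (p (src A F)) \<cdot> (G \<triangleright> E2_beta F) \<cdot> assoc A G (p (tgt A F)) F \<cdot>
    (E2_beta G \<triangleleft> F) \<cdot> assoc' (p (tgt A G)) G F =
    (G \<triangleright> (rzeta F \<cdot> E2_beta F)) \<cdot> assoc A G (p (tgt A F)) F \<cdot> (E2_beta G \<triangleleft> F) \<cdot> assoc' (p (tgt A G)) G F"
    using assms by (simp add: rzeta_comp[symmetric] lw_vcomp)
  also have "\<dots> = ((rzeta G \<cdot> E2_beta G) \<triangleleft> F) \<cdot> assoc' (p (tgt A G)) G F"
    using assms by (simp add: rzeta_beta[of F] reassoc[OF lzeta_rzeta] rw_vcomp)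
  also have "\<dots> = lzeta (G \<bullet> F)"
    using assms by (simp add: rzeta_beta[of G] lzeta_comp[symmetric])
  finally show "rzeta (G \<bullet> F) \<cdot> E2_beta (G \<bullet> F) = rzeta (G \<bullet> F) \<cdot> assoc' G F (p (src A F)) \<cdot> (G \<triangleright> E2_beta F) \<cdot>
    assoc A G (p (tgt A F)) F \<cdot> (E2_beta G \<triangleleft> F) \<cdot> assoc' (p (tgt A G)) G F"
    using assms by (simp add: rzeta_beta)
qed (use assms in simp_all)

text \<open>At a unit, naturality of the unitors turns \<open>rzeta\<close> and \<open>lzeta\<close>
  into \<zeta> after the left and the right unitor of \<pi>, respectively.\<close>

lemma E2_beta_unit:
  assumes "u \<in> Ob A"
  shows "E2_beta (unit1 A u) = lunit' (p u) \<cdot> runit A (p u)"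
proof (rule iso_lcancel[of "rzeta (unit1 A u)"])
  have "rzeta (unit1 A u) = zeta A u \<cdot> lunit A (p u)"
    unfolding rzeta_def using assms by (simp add: lunit_nat flip: lunit_eq_runit)
  moreover have "lzeta (unit1 A u) = zeta A u \<cdot> runit A (p u)"
    unfolding lzeta_def using assms by (simp add: runit_nat lunit_eq_runit)
  ultimately show "rzeta (unit1 A u) \<cdot> E2_beta (unit1 A u) = rzeta (unit1 A u) \<cdot> lunit' (p u) \<cdot> runit A (p u)"
    using assms rzeta_beta[of "unit1 A u"] by simp
qed (use assms in simp_all)

lemma E2_beta_pi: "u \<in> Ob A \<Longrightarrow> E2_beta (p u) = neg2 A (id2 A (p u \<bullet> p u))"
  by (simp add: E2_beta_eq lzeta_pi)

text \<open>Both sides are compared after composing with F\<xi>, where \<xi> is \<zeta> after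
  \<open>lzeta\<close> at \<pi>. An odd \<open>lzeta\<close> passes \<open>rzeta F\<close> and then
  \<open>lzeta F\<close>, and the two signs cancel.\<close>

lemma E2_xi_beta:
  assumes "F \<in> Mor A" "u = tgt A F" "w = src A F"
  shows "(lunit A F \<triangleleft> (p w \<bullet> p w)) \<cdot> ((E2_xi u \<triangleleft> F) \<star> inv2 A (E2_xi w)) \<cdot> runit' ((p u \<bullet> p u) \<bullet> F) =
    assoc A F (p w) (p w) \<cdot> (E2_beta F \<triangleleft> p w) \<cdot> assoc' (p u) F (p w) \<cdot> (p u \<triangleright> E2_beta F) \<cdot> assoc A (p u) (p u) F"
proof (rule iso_lcancel[of "runit A F \<cdot> (F \<triangleright> E2_xi w)"])
  have "(runit A F \<cdot> (F \<triangleright> E2_xi w)) \<cdot> assoc A F (p w) (p w) \<cdot> (E2_beta F \<triangleleft> p w) \<cdot> assoc' (p u) F (p w) \<cdot>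
      (p u \<triangleright> E2_beta F) \<cdot> assoc A (p u) (p u) F =
    rzeta F \<cdot> ((F \<triangleright> lzeta (p w)) \<cdot> assoc A F (p w) (p w)) \<cdot> (E2_beta F \<triangleleft> p w) \<cdot> assoc' (p u) F (p w) \<cdot>
      (p u \<triangleright> E2_beta F) \<cdot> assoc A (p u) (p u) F"
    using assms by (simp add: E2_xi_eq rzeta_def lw_vcomp)
  also have "\<dots> = rzeta F \<cdot> ((rzeta F \<cdot> E2_beta F) \<triangleleft> p w) \<cdot> assoc' (p u) F (p w) \<cdot>
      (p u \<triangleright> E2_beta F) \<cdot> assoc A (p u) (p u) F"
    using assms by (subst lzeta_rzeta) (simp_all add: rw_vcomp)
  also have "\<dots> = rzeta F \<cdot> lzeta (F \<bullet> p w) \<cdot> (p u \<triangleright> E2_beta F) \<cdot> assoc A (p u) (p u) F"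
    using assms by (simp add: rzeta_beta lzeta_comp[symmetric])
  also have "\<dots> = neg2 A (lzeta F \<cdot> (p u \<triangleright> (rzeta F \<cdot> E2_beta F)) \<cdot> assoc A (p u) (p u) F)"
    using assms by (simp add: lw_vcomp reassoc[OF lzeta_nat])
  also have "\<dots> = lzeta F \<cdot> lzeta (p u \<bullet> F) \<cdot> assoc A (p u) (p u) F"
    using assms by (simp add: rzeta_beta reassoc[OF lzeta_nat])
  also have "\<dots> = lunit A F \<cdot> (E2_xi u \<triangleleft> F)"
    using assms by (simp add: lzeta_comp E2_xi_eq rw_vcomp lzeta_def[of F])
  finally show "(runit A F \<cdot> (F \<triangleright> E2_xi w)) \<cdot> (lunit A F \<triangleleft> (p w \<bullet> p w)) \<cdot> ((E2_xi u \<triangleleft> F) \<star> inv2 A (E2_xi w)) \<cdot>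
      runit' ((p u \<bullet> p u) \<bullet> F) =
    (runit A F \<cdot> (F \<triangleright> E2_xi w)) \<cdot> assoc A F (p w) (p w) \<cdot> (E2_beta F \<triangleleft> p w) \<cdot> assoc' (p u) F (p w) \<cdot>
      (p u \<triangleright> E2_beta F) \<cdot> assoc A (p u) (p u) F"
    using assms unit_conj[of F "E2_xi u" "E2_xi w"] by simp
qed (use assms in \<open>simp_all add: vcomp_iso lw_iso\<close>)

theorem pi_2category_E2_obj: "pi_2category k (E2_obj A)"
proof (intro pi_2category.intro pi_2category_axioms.intro)
  show "linear_bicategory k {0} (E2_obj A)"
    unfolding linear_bicategory_E2_obj by (rule restrict_parities) auto
qed (auto simp: pi1 E2_beta_def[symmetric] E2_xi_def[symmetric] composable_def mem_cells_iff[of _ UNIV] E2_beta_nat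
    E2_beta_comp E2_beta_unit E2_beta_pi E2_xi_beta intro!: isosI)

end

section \<open>Pseudofunctors\<close>

text \<open>The locale \<open>linear_pseudofunctor\<close> does not include the bicategory axioms
  for \<open>A\<close> and \<open>B\<close>; they are added here together with their
  calculus.\<close>

locale lin_psf = A: linear_bicategory k P A + B: linear_bicategory k P B + linear_pseudofunctor k P A B R
  for k :: "'k ring" and P :: "bit set" and A :: "('k, 'o, 'm, 'c, 'z) bicat_scheme"
    and B :: "('k, 'o, 'm, 'c, 'y) bicat_scheme" (structure) and R :: "('o, 'm, 'c, 'w) psfunctor_scheme"
begin

lemma fmor_simps [simp]:
  "u \<in> Ob A \<Longrightarrow> fob R u \<in> Ob B"
  "F \<in> Mor A \<Longrightarrow> fmor R F \<in> Mor B" "F \<in> Mor A \<Longrightarrow> src B (fmor R F) = fob R (src A F)"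
  "F \<in> Mor A \<Longrightarrow> tgt B (fmor R F) = fob R (tgt A F)"
  using fob fmor by auto

lemma fcell_simps [simp]:
  assumes "A.arr x"
  shows "B.arr (fcell R x)" "cdom (fcell R x) = fmor R (cdom x)" "ccod (fcell R x) = fmor R (ccod x)"
    "par (fcell R x) = par x"
proof -
  have "fcell R x \<in> cells B (fmor R (cdom x)) (fmor R (ccod x)) (par x)"
    using fcell[OF A.arr_cells[OF assms]] assms by auto
  then show "B.arr (fcell R x)" "cdom (fcell R x) = fmor R (cdom x)" "ccod (fcell R x) = fmor R (ccod x)"
    "par (fcell R x) = par x"
    using assms cells_imp_all_cells[of "fcell R x" B _ _ "par x" P] by (auto simp: cells_simps)
qed

lemma fcell_id2 [simp]: "F \<in> Mor A \<Longrightarrow> fcell R (id2 A F) = id2 B (fmor R F)"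
  by (rule fcell_id)

lemma fcell_vcomp_arr: "\<lbrakk>A.arr x; A.arr y; ccod x = cdom y\<rbrakk> \<Longrightarrow> fcell R (y \<cdot>\<^bsub>A\<^esub> x) = fcell R y \<cdot> fcell R x"
  using fcell_vcomp[of x "cdom x" "cdom y" "par x" y "ccod y" "par y"] by (auto simp: mem_cells_iff[of _ P])

lemma fcell_add2:
  "\<lbrakk>A.arr x; A.arr y; cdom y = cdom x; ccod y = ccod x; par y = par x\<rbrakk> \<Longrightarrow>
    fcell R (add2 A x y) = add2 B (fcell R x) (fcell R y)"
  using fcell_add[of x "cdom x" "ccod x" "par x" y] by (auto simp: mem_cells_iff[of _ P])

lemma fcell_smult2:
  "\<lbrakk>A.arr x; r \<in> carrier k\<rbrakk> \<Longrightarrow> fcell R (smult2 A r x) = smult2 B r (fcell R x)"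
  using fcell_smult[of x "cdom x" "ccod x" "par x" r] by (auto simp: mem_cells_iff[of _ P])

lemma fcell_iso [simp]:
  assumes "A.arr x" "iso2 A x"
  shows "iso2 B (fcell R x)" "inv2 B (fcell R x) = fcell R (inv2 A x)"
proof -
  have "inverse2 B (fcell R x) (fcell R (inv2 A x))"
    using assms by (auto simp: inverse2_def mem_cells_iff[of _ P] fcell_vcomp_arr[symmetric])
  then show "iso2 B (fcell R x)" "inv2 B (fcell R x) = fcell R (inv2 A x)"
    using assms B.isoI B.inv2_eqI by simp_all
qed

lemma fcell_inv [simp]:
  assumes "A.arr x" "iso2 A x"
  shows "fcell R x \<cdot> fcell R (inv2 A x) = id2 B (fmor R (ccod x))"
    "fcell R (inv2 A x) \<cdot> fcell R x = id2 B (fmor R (cdom x))"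
    "\<lbrakk>B.arr t; ccod t = fmor R (ccod x)\<rbrakk> \<Longrightarrow> fcell R x \<cdot> fcell R (inv2 A x) \<cdot> t = t"
    "\<lbrakk>B.arr t; ccod t = fmor R (cdom x)\<rbrakk> \<Longrightarrow> fcell R (inv2 A x) \<cdot> fcell R x \<cdot> t = t"
proof -
  show 1: "fcell R x \<cdot> fcell R (inv2 A x) = id2 B (fmor R (ccod x))"
    "fcell R (inv2 A x) \<cdot> fcell R x = id2 B (fmor R (cdom x))"
    using assms by (simp_all flip: fcell_vcomp_arr)
  show "\<lbrakk>B.arr t; ccod t = fmor R (ccod x)\<rbrakk> \<Longrightarrow> fcell R x \<cdot> fcell R (inv2 A x) \<cdot> t = t"
    "\<lbrakk>B.arr t; ccod t = fmor R (cdom x)\<rbrakk> \<Longrightarrow> fcell R (inv2 A x) \<cdot> fcell R x \<cdot> t = t"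
    using assms by (simp_all add: B.reassoc[OF 1(1)] B.reassoc[OF 1(2)])
qed

lemma cmap_simps [simp]:
  assumes "G \<in> Mor A" "F \<in> Mor A" "src A G = tgt A F"
  shows "B.arr (cmap R (G, F))" "cdom (cmap R (G, F)) = fmor R G \<bullet> fmor R F"
    "ccod (cmap R (G, F)) = fmor R (G \<bullet>\<^bsub>A\<^esub> F)" "par (cmap R (G, F)) = 0" "iso2 B (cmap R (G, F))"
  using B.isosD[OF cmap_iso A.zero_parity] assms by (simp_all add: composable_def)

lemma imap_simps [simp]:
  assumes "u \<in> Ob A"
  shows "B.arr (imap R u)" "cdom (imap R u) = unit1 B (fob R u)"
    "ccod (imap R u) = fmor R (unit1 A u)" "par (imap R u) = 0" "iso2 B (imap R u)"
  using B.isosD[OF imap_iso A.zero_parity] assms by simp_all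

lemma cmap_nat:
  assumes "A.arr x" "A.arr y" "src A (cdom y) = tgt A (cdom x)" "G' = ccod y" "F' = ccod x"
  shows "cmap R (G', F') \<cdot> (fcell R y \<star> fcell R x) = fcell R (y \<star>\<^bsub>A\<^esub> x) \<cdot> cmap R (cdom y, cdom x)"
  using cmap_natural[of "cdom y" "cdom x" x F' "par x" y G' "par y"] assms
  by (auto simp: mem_cells_iff[of _ P] composable_def)

lemma cmap_nat_lw:
  assumes "A.arr x" "G \<in> Mor A" "src A G = tgt A (cdom x)" "F' = ccod x"
  shows "cmap R (G, F') \<cdot> (fmor R G \<triangleright> fcell R x) = fcell R (G \<triangleright>\<^bsub>A\<^esub> x) \<cdot> cmap R (G, cdom x)"
  using cmap_nat[of x "id2 A G" G F'] assms by simp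

lemma cmap_nat_rw:
  assumes "A.arr y" "F \<in> Mor A" "src A (cdom y) = tgt A F" "G' = ccod y"
  shows "cmap R (G', F) \<cdot> (fcell R y \<triangleleft> fmor R F) = fcell R (y \<triangleleft>\<^bsub>A\<^esub> F) \<cdot> cmap R (cdom y, F)"
  using cmap_nat[of "id2 A F" y G' F] assms by simp

lemma cmap_nat_lw_rev:
  assumes "A.arr x" "G \<in> Mor A" "src A G = tgt A (cdom x)" "F = cdom x"
  shows "fcell R (G \<triangleright>\<^bsub>A\<^esub> x) \<cdot> cmap R (G, F) = cmap R (G, ccod x) \<cdot> (fmor R G \<triangleright> fcell R x)"
  using cmap_nat_lw[of x G] assms by simp

lemma cmap_nat_rw_rev:
  assumes "A.arr y" "F \<in> Mor A" "src A (cdom y) = tgt A F" "G = cdom y"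
  shows "fcell R (y \<triangleleft>\<^bsub>A\<^esub> F) \<cdot> cmap R (G, F) = cmap R (ccod y, F) \<cdot> (fcell R y \<triangleleft> fmor R F)"
  using cmap_nat_rw[of y F] assms by simp

lemma coh_assoc_arr:
  assumes "H \<in> Mor A" "G \<in> Mor A" "F \<in> Mor A" "src A H = tgt A G" "src A G = tgt A F"
  shows "fcell R (assoc A H G F) \<cdot> cmap R (H \<bullet>\<^bsub>A\<^esub> G, F) \<cdot> (cmap R (H, G) \<triangleleft> fmor R F) =
      cmap R (H, G \<bullet>\<^bsub>A\<^esub> F) \<cdot> (fmor R H \<triangleright> cmap R (G, F)) \<cdot> assoc B (fmor R H) (fmor R G) (fmor R F)"
  using coh_assoc[of H G F] assms by (simp add: composable_def)

end

lemma lin_psfI: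
  "\<lbrakk>linear_bicategory k P A; linear_bicategory k P B; linear_pseudofunctor k P A B R\<rbrakk> \<Longrightarrow> lin_psf k P A B R"
  by (simp add: lin_psf_def)

lemma psf_sel [simp]:
  "u \<in> Ob A \<Longrightarrow> fob (psf_id P A) u = u"
  "F \<in> Mor A \<Longrightarrow> fmor (psf_id P A) F = F"
  "x \<in> all_cells A P \<Longrightarrow> fcell (psf_id P A) x = x"
  "composable A G F \<Longrightarrow> cmap (psf_id P A) (G, F) = id2 A (G \<bullet>\<^bsub>A\<^esub> F)"
  "u \<in> Ob A \<Longrightarrow> imap (psf_id P A) u = id2 A (unit1 A u)"
  "u \<in> Ob A \<Longrightarrow> fob (psf_comp P A C S R) u = fob S (fob R u)"
  "F \<in> Mor A \<Longrightarrow> fmor (psf_comp P A C S R) F = fmor S (fmor R F)"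
  "x \<in> all_cells A P \<Longrightarrow> fcell (psf_comp P A C S R) x = fcell S (fcell R x)"
  "composable A G F \<Longrightarrow> cmap (psf_comp P A C S R) (G, F) = fcell S (cmap R (G, F)) \<cdot>\<^bsub>C\<^esub> cmap S (fmor R G, fmor R F)"
  "u \<in> Ob A \<Longrightarrow> imap (psf_comp P A C S R) u = fcell S (imap R u) \<cdot>\<^bsub>C\<^esub> imap S (fob R u)"
  by (simp_all add: psf_id_def psf_comp_def)

lemma psf_ext [simp]:
  "fob (psf_id P A) \<in> extensional (Ob A)" "fmor (psf_id P A) \<in> extensional (Mor A)"
  "fcell (psf_id P A) \<in> extensional (all_cells A P)" "cmap (psf_id P A) \<in> extensional {(G, F). composable A G F}"
  "imap (psf_id P A) \<in> extensional (Ob A)"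
  "fob (psf_comp P A C S R) \<in> extensional (Ob A)" "fmor (psf_comp P A C S R) \<in> extensional (Mor A)"
  "fcell (psf_comp P A C S R) \<in> extensional (all_cells A P)"
  "cmap (psf_comp P A C S R) \<in> extensional {(G, F). composable A G F}"
  "imap (psf_comp P A C S R) \<in> extensional (Ob A)"
  by (simp_all add: psf_id_def psf_comp_def)

lemma (in linear_bicategory) linear_pseudofunctor_id: "linear_pseudofunctor k P A A (psf_id P A)"
  by (rule linear_pseudofunctor.intro) ((rule psf_ext)+, auto simp: composable_def mem_cells_iff[of _ P] intro!: isosI)

text \<open>In each coherence law, naturality of \<open>cmap S\<close> gathers the factors coming
  from \<open>R\<close> under \<open>S\<close>; there the law for \<open>R\<close> applies, and what
  is left is the law for \<open>S\<close>.\<close>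

theorem linear_pseudofunctor_comp:
  fixes A B C :: "('k, 'o, 'm, 'c, 'z) bicat_scheme"
  assumes "lin_psf k P A B R" "lin_psf k P B C S"
  shows "linear_pseudofunctor k P A C (psf_comp P A C S R)"
proof -
  interpret R: lin_psf k P A B R by fact
  interpret S: lin_psf k P B C S by fact
  let ?T = "psf_comp P A C S R"
  show ?thesis
  proof (rule linear_pseudofunctor.intro)
    fix H G F assume "composable A H G" "composable A G F"
    then have o: "H \<in> Mor A" "G \<in> Mor A" "F \<in> Mor A" "src A H = tgt A G" "src A G = tgt A F"
      by (auto simp: composable_def)
    let ?RH = "fmor R H" and ?RG = "fmor R G" and ?RF = "fmor R F"
    have "fcell ?T (assoc A H G F) \<cdot>\<^bsub>C\<^esub> cmap ?T (H \<bullet>\<^bsub>A\<^esub> G, F) \<cdot>\<^bsub>C\<^esub> (cmap ?T (H, G) \<triangleleft>\<^bsub>C\<^esub> fmor ?T F) =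
      fcell S (fcell R (assoc A H G F)) \<cdot>\<^bsub>C\<^esub> fcell S (cmap R (H \<bullet>\<^bsub>A\<^esub> G, F)) \<cdot>\<^bsub>C\<^esub> fcell S (cmap R (H, G) \<triangleleft>\<^bsub>B\<^esub> ?RF) \<cdot>\<^bsub>C\<^esub>
        cmap S (?RH \<bullet>\<^bsub>B\<^esub> ?RG, ?RF) \<cdot>\<^bsub>C\<^esub> (cmap S (?RH, ?RG) \<triangleleft>\<^bsub>C\<^esub> fmor S ?RF)"
      using o by (simp add: composable_def S.B.rw_vcomp S.B.reassoc[OF S.cmap_nat_rw])
    also have "\<dots> = fcell S (cmap R (H, G \<bullet>\<^bsub>A\<^esub> F)) \<cdot>\<^bsub>C\<^esub> fcell S (?RH \<triangleright>\<^bsub>B\<^esub> cmap R (G, F)) \<cdot>\<^bsub>C\<^esub>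
      fcell S (assoc B ?RH ?RG ?RF) \<cdot>\<^bsub>C\<^esub> cmap S (?RH \<bullet>\<^bsub>B\<^esub> ?RG, ?RF) \<cdot>\<^bsub>C\<^esub> (cmap S (?RH, ?RG) \<triangleleft>\<^bsub>C\<^esub> fmor S ?RF)"
    proof -
      have "fcell S (fcell R (assoc A H G F)) \<cdot>\<^bsub>C\<^esub> fcell S (cmap R (H \<bullet>\<^bsub>A\<^esub> G, F)) \<cdot>\<^bsub>C\<^esub> fcell S (cmap R (H, G) \<triangleleft>\<^bsub>B\<^esub> ?RF) =
        fcell S (fcell R (assoc A H G F) \<cdot>\<^bsub>B\<^esub> cmap R (H \<bullet>\<^bsub>A\<^esub> G, F) \<cdot>\<^bsub>B\<^esub> (cmap R (H, G) \<triangleleft>\<^bsub>B\<^esub> ?RF))"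
        using o by (simp add: S.fcell_vcomp_arr)
      also have "\<dots> = fcell S (cmap R (H, G \<bullet>\<^bsub>A\<^esub> F)) \<cdot>\<^bsub>C\<^esub> fcell S (?RH \<triangleright>\<^bsub>B\<^esub> cmap R (G, F)) \<cdot>\<^bsub>C\<^esub> fcell S (assoc B ?RH ?RG ?RF)"
        unfolding R.coh_assoc_arr[OF o] using o by (simp add: S.fcell_vcomp_arr)
      finally show ?thesis
        by (rule S.B.reassoc3[THEN trans]) (use o in simp_all)
    qed
    also have "\<dots> = cmap ?T (H, G \<bullet>\<^bsub>A\<^esub> F) \<cdot>\<^bsub>C\<^esub> (fmor ?T H \<triangleright>\<^bsub>C\<^esub> cmap ?T (G, F)) \<cdot>\<^bsub>C\<^esub> assoc C (fmor ?T H) (fmor ?T G) (fmor ?T F)"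
      using o by (simp add: composable_def S.B.lw_vcomp S.B.reassoc[OF S.cmap_nat_lw] S.coh_assoc_arr)
    finally show "fcell ?T (assoc A H G F) \<cdot>\<^bsub>C\<^esub> cmap ?T (H \<bullet>\<^bsub>A\<^esub> G, F) \<cdot>\<^bsub>C\<^esub> (cmap ?T (H, G) \<triangleleft>\<^bsub>C\<^esub> fmor ?T F) =
      cmap ?T (H, G \<bullet>\<^bsub>A\<^esub> F) \<cdot>\<^bsub>C\<^esub> (fmor ?T H \<triangleright>\<^bsub>C\<^esub> cmap ?T (G, F)) \<cdot>\<^bsub>C\<^esub> assoc C (fmor ?T H) (fmor ?T G) (fmor ?T F)" .
  next
    fix F assume o: "F \<in> Mor A"
    let ?RF = "fmor R F" and ?u = "tgt A F" and ?w = "src A F"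
    have "fcell ?T (lunit A F) \<cdot>\<^bsub>C\<^esub> cmap ?T (unit1 A ?u, F) \<cdot>\<^bsub>C\<^esub> (imap ?T ?u \<triangleleft>\<^bsub>C\<^esub> fmor ?T F) =
      fcell S (fcell R (lunit A F) \<cdot>\<^bsub>B\<^esub> cmap R (unit1 A ?u, F) \<cdot>\<^bsub>B\<^esub> (imap R ?u \<triangleleft>\<^bsub>B\<^esub> ?RF)) \<cdot>\<^bsub>C\<^esub>
        cmap S (unit1 B (fob R ?u), ?RF) \<cdot>\<^bsub>C\<^esub> (imap S (fob R ?u) \<triangleleft>\<^bsub>C\<^esub> fmor S ?RF)"
      using o by (simp add: composable_def S.B.rw_vcomp S.B.reassoc[OF S.cmap_nat_rw] S.fcell_vcomp_arr)
    also have "\<dots> = lunit C (fmor ?T F)"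
      unfolding R.coh_lunit[OF o] using o S.coh_lunit[of ?RF] by simp
    finally show "fcell ?T (lunit A F) \<cdot>\<^bsub>C\<^esub> cmap ?T (unit1 A ?u, F) \<cdot>\<^bsub>C\<^esub> (imap ?T ?u \<triangleleft>\<^bsub>C\<^esub> fmor ?T F) = lunit C (fmor ?T F)" .
    have "fcell ?T (runit A F) \<cdot>\<^bsub>C\<^esub> cmap ?T (F, unit1 A ?w) \<cdot>\<^bsub>C\<^esub> (fmor ?T F \<triangleright>\<^bsub>C\<^esub> imap ?T ?w) =
      fcell S (fcell R (runit A F) \<cdot>\<^bsub>B\<^esub> cmap R (F, unit1 A ?w) \<cdot>\<^bsub>B\<^esub> (?RF \<triangleright>\<^bsub>B\<^esub> imap R ?w)) \<cdot>\<^bsub>C\<^esub>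
        cmap S (?RF, unit1 B (fob R ?w)) \<cdot>\<^bsub>C\<^esub> (fmor S ?RF \<triangleright>\<^bsub>C\<^esub> imap S (fob R ?w))"
      using o by (simp add: composable_def S.B.lw_vcomp S.B.reassoc[OF S.cmap_nat_lw] S.fcell_vcomp_arr)
    also have "\<dots> = runit C (fmor ?T F)"
      unfolding R.coh_runit[OF o] using o S.coh_runit[of ?RF] by simp
    finally show "fcell ?T (runit A F) \<cdot>\<^bsub>C\<^esub> cmap ?T (F, unit1 A ?w) \<cdot>\<^bsub>C\<^esub> (fmor ?T F \<triangleright>\<^bsub>C\<^esub> imap ?T ?w) = runit C (fmor ?T F)" .
  next
    fix G F x F' r y G' q
    assume a: "composable A G F" "x \<in> cells A F F' r" "y \<in> cells A G G' q" "r \<in> P" "q \<in> P"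
    then have o: "R.A.arr x" "R.A.arr y" "G = cdom y" "F = cdom x" "G' = ccod y" "F' = ccod x" "src A (cdom y) = tgt A (cdom x)"
      by (auto simp: composable_def mem_cells_iff[of _ P])
    then show "cmap ?T (G', F') \<cdot>\<^bsub>C\<^esub> (fcell ?T y \<star>\<^bsub>C\<^esub> fcell ?T x) = fcell ?T (y \<star>\<^bsub>A\<^esub> x) \<cdot>\<^bsub>C\<^esub> cmap ?T (G, F)"
      by (simp add: composable_def S.cmap_nat S.B.reassoc[OF S.fcell_vcomp_arr[symmetric]] R.cmap_nat)
  qed ((rule psf_ext)+, auto simp: composable_def mem_cells_iff[of _ P] R.fcell_vcomp_arr S.fcell_vcomp_arr
      R.fcell_add2 S.fcell_add2 R.fcell_smult2 S.fcell_smult2 S.B.vcomp_iso intro!: S.B.isosI)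
qed

lemma linear_pseudofunctor_fields_eq:
  assumes "linear_pseudofunctor k P A B R" "linear_pseudofunctor k P A B' R'"
    "\<And>u. u \<in> Ob A \<Longrightarrow> fob R u = fob R' u"
    "\<And>F. F \<in> Mor A \<Longrightarrow> fmor R F = fmor R' F"
    "\<And>x. x \<in> all_cells A P \<Longrightarrow> fcell R x = fcell R' x"
    "\<And>G F. composable A G F \<Longrightarrow> cmap R (G, F) = cmap R' (G, F)"
    "\<And>u. u \<in> Ob A \<Longrightarrow> imap R u = imap R' u"
  shows "fob R = fob R' \<and> fmor R = fmor R' \<and> fcell R = fcell R' \<and> cmap R = cmap R' \<and> imap R = imap R'"
proof -
  note e = linear_pseudofunctor.ext[OF assms(1)] linear_pseudofunctor.ext[OF assms(2)]
  show ?thesis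
    using assms(3-)
    by (intro conjI extensionalityI[OF e(1,6)] extensionalityI[OF e(2,7)] extensionalityI[OF e(3,8)]
        extensionalityI[OF e(4,9)] extensionalityI[OF e(5,10)]) auto
qed

lemma psfunctor_eqI:
  fixes R R' :: "('o, 'm, 'c) psfunctor"
  assumes "linear_pseudofunctor k P A B R" "linear_pseudofunctor k P A B' R'"
    "\<And>u. u \<in> Ob A \<Longrightarrow> fob R u = fob R' u"
    "\<And>F. F \<in> Mor A \<Longrightarrow> fmor R F = fmor R' F"
    "\<And>x. x \<in> all_cells A P \<Longrightarrow> fcell R x = fcell R' x"
    "\<And>G F. composable A G F \<Longrightarrow> cmap R (G, F) = cmap R' (G, F)"
    "\<And>u. u \<in> Ob A \<Longrightarrow> imap R u = imap R' u"
  shows "R = R'"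
  using linear_pseudofunctor_fields_eq[OF assms] by simp

section \<open>\<Pi>-2-functors, their identities and composites\<close>

definition with_jmap :: "('o, 'm, 'c) psfunctor \<Rightarrow> ('o \<Rightarrow> ('m, 'c) cell) \<Rightarrow> ('o, 'm, 'c) pi_psfunctor" where
  "with_jmap R j = psfunctor.extend R (pi_psfunctor.fields j)"

lemma with_jmap_sel [simp]:
  "fob (with_jmap R j) = fob R" "fmor (with_jmap R j) = fmor R" "fcell (with_jmap R j) = fcell R"
  "cmap (with_jmap R j) = cmap R" "imap (with_jmap R j) = imap R" "jmap (with_jmap R j) = j"
  by (simp_all add: with_jmap_def psfunctor.defs pi_psfunctor.defs)

lemma linear_pseudofunctor_with_jmap [simp]:
  "linear_pseudofunctor k P A B (with_jmap R j) \<longleftrightarrow> linear_pseudofunctor k P A B R"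
  by (simp add: linear_pseudofunctor_def)

lemma pi_psfunctor_eqI:
  fixes R R' :: "('o, 'm, 'c) pi_psfunctor"
  assumes "pi_2functor k A B R" "pi_2functor k A B' R'"
    "\<And>u. u \<in> Ob A \<Longrightarrow> fob R u = fob R' u"
    "\<And>F. F \<in> Mor A \<Longrightarrow> fmor R F = fmor R' F"
    "\<And>x. x \<in> all_cells A {0} \<Longrightarrow> fcell R x = fcell R' x"
    "\<And>G F. composable A G F \<Longrightarrow> cmap R (G, F) = cmap R' (G, F)"
    "\<And>u. u \<in> Ob A \<Longrightarrow> imap R u = imap R' u"
    "\<And>u. u \<in> Ob A \<Longrightarrow> jmap R u = jmap R' u"
  shows "R = R'"
proof -
  have "jmap R = jmap R'"
    using pi_2functor.ext_j[OF assms(1)] pi_2functor.ext_j[OF assms(2)] assms(8)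
    by (rule extensionalityI)
  then show ?thesis
    using linear_pseudofunctor_fields_eq[OF assms(1,2)[THEN pi_2functor.axioms(1)] assms(3-7)] by simp
qed

locale pi_psf = A: pi_2category k A + B: pi_2category k B + pi_2functor k A B R
  for k :: "'k ring" and A :: "('k, 'o, 'm, 'c) pi_2cat" and B :: "('k, 'o, 'm, 'c) pi_2cat" (structure)
    and R :: "('o, 'm, 'c) pi_psfunctor"
begin

sublocale lin_psf k "{0}" A B R ..

lemma jmap_simps [simp]:
  assumes "u \<in> Ob A"
  shows "B.arr (jmap R u)" "cdom (jmap R u) = pi1 B (fob R u)"
    "ccod (jmap R u) = fmor R (pi1 A u)" "iso2 B (jmap R u)"
  using B.isosD[OF jmap_iso A.zero_parity] assms by simp_all

end

lemma pi_psfI: "\<lbrakk>pi_2category k A; pi_2category k B; pi_2functor k A B R\<rbrakk> \<Longrightarrow> pi_psf k A B R"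
  by (simp add: pi_psf_def)

definition pi_psf_id :: "('k, 'o, 'm, 'c) pi_2cat \<Rightarrow> ('o, 'm, 'c) pi_psfunctor" where
  "pi_psf_id A = with_jmap (psf_id {0} A) (\<lambda>u\<in>Ob A. id2 A (pi1 A u))"

definition pi_psf_comp ::
    "('k, 'o, 'm, 'c) pi_2cat \<Rightarrow> ('k, 'o, 'm, 'c) pi_2cat \<Rightarrow> ('o, 'm, 'c) pi_psfunctor \<Rightarrow>
     ('o, 'm, 'c) pi_psfunctor \<Rightarrow> ('o, 'm, 'c) pi_psfunctor" where
  "pi_psf_comp A C S R =
     with_jmap (psf_comp {0} A C S R) (\<lambda>u\<in>Ob A. fcell S (jmap R u) \<cdot>\<^bsub>C\<^esub> jmap S (fob R u))"

lemma pi_psf_sel [simp]: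
  "fob (pi_psf_id A) = fob (psf_id {0} A)" "fmor (pi_psf_id A) = fmor (psf_id {0} A)"
  "fcell (pi_psf_id A) = fcell (psf_id {0} A)" "cmap (pi_psf_id A) = cmap (psf_id {0} A)"
  "imap (pi_psf_id A) = imap (psf_id {0} A)" "u \<in> Ob A \<Longrightarrow> jmap (pi_psf_id A) u = id2 A (pi1 A u)"
  "fob (pi_psf_comp A C S R) = fob (psf_comp {0} A C S R)" "fmor (pi_psf_comp A C S R) = fmor (psf_comp {0} A C S R)"
  "fcell (pi_psf_comp A C S R) = fcell (psf_comp {0} A C S R)" "cmap (pi_psf_comp A C S R) = cmap (psf_comp {0} A C S R)"
  "imap (pi_psf_comp A C S R) = imap (psf_comp {0} A C S R)"
  "u \<in> Ob A \<Longrightarrow> jmap (pi_psf_comp A C S R) u = fcell S (jmap R u) \<cdot>\<^bsub>C\<^esub> jmap S (fob R u)"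
  by (simp_all add: pi_psf_id_def pi_psf_comp_def)

lemma Pi_2_Cat_sel [simp]:
  "Obj (Pi_2_Cat k) = {A. pi_2category k A}" "Arr (Pi_2_Cat k) A B = {R. pi_2functor k A B R}"
  "Idt (Pi_2_Cat k) A = pi_psf_id A" "Cmp (Pi_2_Cat k) A B C S R = pi_psf_comp A C S R"
  by (simp_all add: Pi_2_Cat_def pi_psf_id_def pi_psf_comp_def with_jmap_def)

lemma Pi_2_SCat_sel [simp]:
  "Obj (Pi_2_SCat k) = {A. pi_2supercategory k A}" "Arr (Pi_2_SCat k) A B = {R. linear_pseudofunctor k UNIV A B R}"
  "Idt (Pi_2_SCat k) A = psf_id UNIV A" "Cmp (Pi_2_SCat k) A B C S R = psf_comp UNIV A C S R"
  by (simp_all add: Pi_2_SCat_def)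

lemma (in pi_2category) pi_2functor_id:
  "pi_2functor k A A (pi_psf_id A)"
proof (intro pi_2functor.intro pi_2functor_axioms.intro)
  show "linear_pseudofunctor k {0} A A (pi_psf_id A)" "jmap (pi_psf_id A) \<in> extensional (Ob A)"
    by (simp_all add: pi_psf_id_def linear_pseudofunctor_id)
qed (auto simp: composable_def intro!: isosI)

theorem pi_2functor_comp:
  assumes "pi_psf k A B R" "pi_psf k B C S"
  shows "pi_2functor k A C (pi_psf_comp A C S R)"
proof -
  interpret R: pi_psf k A B R by fact
  interpret S: pi_psf k B C S by fact
  let ?T = "pi_psf_comp A C S R"
  show ?thesis
  proof (intro pi_2functor.intro pi_2functor_axioms.intro)
    show "linear_pseudofunctor k {0} A C ?T" "jmap ?T \<in> extensional (Ob A)"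
      using linear_pseudofunctor_comp[OF R.lin_psf_axioms S.lin_psf_axioms] by (simp_all add: pi_psf_comp_def)
    fix F assume o: "F \<in> Mor A"
    let ?RF = "fmor R F" and ?u = "tgt A F" and ?w = "src A F"
    let ?p = "pi1 A" and ?q = "pi1 B"
    have "fcell ?T (beta A F) \<cdot>\<^bsub>C\<^esub> cmap ?T (?p ?u, F) \<cdot>\<^bsub>C\<^esub> (jmap ?T ?u \<triangleleft>\<^bsub>C\<^esub> fmor ?T F) =
      fcell S (fcell R (beta A F) \<cdot>\<^bsub>B\<^esub> cmap R (?p ?u, F) \<cdot>\<^bsub>B\<^esub> (jmap R ?u \<triangleleft>\<^bsub>B\<^esub> ?RF)) \<cdot>\<^bsub>C\<^esub>
        cmap S (?q (fob R ?u), ?RF) \<cdot>\<^bsub>C\<^esub> (jmap S (fob R ?u) \<triangleleft>\<^bsub>C\<^esub> fmor S ?RF)"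
      using o by (simp add: composable_def S.B.rw_vcomp S.B.reassoc[OF S.cmap_nat_rw] S.fcell_vcomp_arr)
    also have "\<dots> = fcell S (cmap R (F, ?p ?w)) \<cdot>\<^bsub>C\<^esub> fcell S (?RF \<triangleright>\<^bsub>B\<^esub> jmap R ?w) \<cdot>\<^bsub>C\<^esub>
        fcell S (beta B ?RF) \<cdot>\<^bsub>C\<^esub> cmap S (?q (fob R ?u), ?RF) \<cdot>\<^bsub>C\<^esub> (jmap S (fob R ?u) \<triangleleft>\<^bsub>C\<^esub> fmor S ?RF)"
      unfolding R.jmap_beta[OF o] using o by (simp add: S.fcell_vcomp_arr)
    also have "\<dots> = cmap ?T (F, ?p ?w) \<cdot>\<^bsub>C\<^esub> (fmor ?T F \<triangleright>\<^bsub>C\<^esub> jmap ?T ?w) \<cdot>\<^bsub>C\<^esub> beta C (fmor ?T F)"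
      using o S.jmap_beta[of ?RF] by (simp add: composable_def S.B.lw_vcomp S.B.reassoc[OF S.cmap_nat_lw])
    finally show "fcell ?T (beta A F) \<cdot>\<^bsub>C\<^esub> cmap ?T (?p ?u, F) \<cdot>\<^bsub>C\<^esub> (jmap ?T ?u \<triangleleft>\<^bsub>C\<^esub> fmor ?T F) =
      cmap ?T (F, ?p ?w) \<cdot>\<^bsub>C\<^esub> (fmor ?T F \<triangleright>\<^bsub>C\<^esub> jmap ?T ?w) \<cdot>\<^bsub>C\<^esub> beta C (fmor ?T F)" .
  next
    fix u assume o: "u \<in> Ob A"
    let ?p = "pi1 A u" and ?q = "pi1 B (fob R u)"
    have "fcell ?T (xi A u) \<cdot>\<^bsub>C\<^esub> cmap ?T (?p, ?p) \<cdot>\<^bsub>C\<^esub> (jmap ?T u \<star>\<^bsub>C\<^esub> jmap ?T u) =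
      fcell S (fcell R (xi A u) \<cdot>\<^bsub>B\<^esub> cmap R (?p, ?p) \<cdot>\<^bsub>B\<^esub> (jmap R u \<star>\<^bsub>B\<^esub> jmap R u)) \<cdot>\<^bsub>C\<^esub>
        cmap S (?q, ?q) \<cdot>\<^bsub>C\<^esub> (jmap S (fob R u) \<star>\<^bsub>C\<^esub> jmap S (fob R u))"
    proof -
      \<comment> \<open>All factors are even, so interchange separates the parts from
        \<open>R\<close> and \<open>S\<close> without a sign.\<close>
      have "(fcell S (jmap R u) \<cdot>\<^bsub>C\<^esub> jmap S (fob R u)) \<star>\<^bsub>C\<^esub> (fcell S (jmap R u) \<cdot>\<^bsub>C\<^esub> jmap S (fob R u)) =
        (fcell S (jmap R u) \<star>\<^bsub>C\<^esub> fcell S (jmap R u)) \<cdot>\<^bsub>C\<^esub> (jmap S (fob R u) \<star>\<^bsub>C\<^esub> jmap S (fob R u))"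
        using o by (simp add: S.B.interchange_arr)
      then show ?thesis
        using o by (simp add: composable_def S.B.reassoc[OF S.cmap_nat] S.fcell_vcomp_arr)
    qed
    also have "\<dots> = imap ?T u \<cdot>\<^bsub>C\<^esub> xi C (fob ?T u)"
      unfolding R.jmap_xi[OF o] using o S.jmap_xi[of "fob R u"] by (simp add: S.fcell_vcomp_arr)
    finally show "fcell ?T (xi A u) \<cdot>\<^bsub>C\<^esub> cmap ?T (?p, ?p) \<cdot>\<^bsub>C\<^esub> (jmap ?T u \<star>\<^bsub>C\<^esub> jmap ?T u) = imap ?T u \<cdot>\<^bsub>C\<^esub> xi C (fob ?T u)" .
  qed (auto simp: S.B.vcomp_iso intro!: S.B.isosI)
qed

section \<open>The categories of \<Pi>-2-supercategories and of \<Pi>-2-categories\<close>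

lemma supercat_linear: "pi_2supercategory k A \<Longrightarrow> linear_bicategory k UNIV A"
  by (rule pi_2supercategory.axioms)

theorem category_Pi_2_SCat:
  "category (Pi_2_SCat k :: (('k, 'o, 'm, 'c) pi_2scat, ('o, 'm, 'c) psfunctor) cat)"
proof -
  let ?lin = "\<lambda>A :: ('k, 'o, 'm, 'c) pi_2scat. linear_bicategory k UNIV A"
  let ?psf = "\<lambda>(A :: ('k, 'o, 'm, 'c) pi_2scat) B (R :: ('o, 'm, 'c) psfunctor). linear_pseudofunctor k UNIV A B R"
  have idl: "psf_comp UNIV A B (psf_id UNIV B) R = R" if "?lin A" "?lin B" "?psf A B R" for A B R
  proof -
    interpret R: lin_psf k UNIV A B R
      using that by (rule lin_psfI)
    show ?thesis
      by (rule psfunctor_eqI[OF linear_pseudofunctor_comp[OF R.lin_psf_axioms lin_psfI[OF that(2,2) R.B.linear_pseudofunctor_id]] that(3)])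
        (simp_all add: composable_def)
  qed
  have idr: "psf_comp UNIV A B R (psf_id UNIV A) = R" if "?lin A" "?lin B" "?psf A B R" for A B R
  proof -
    interpret R: lin_psf k UNIV A B R
      using that by (rule lin_psfI)
    show ?thesis
      by (rule psfunctor_eqI[OF linear_pseudofunctor_comp[OF lin_psfI[OF that(1,1) R.A.linear_pseudofunctor_id] R.lin_psf_axioms] that(3)])
        (simp_all add: composable_def)
  qed
  have assc: "psf_comp UNIV A E T (psf_comp UNIV A C S R) = psf_comp UNIV A E (psf_comp UNIV B E T S) R"
    if "?lin A" "?lin B" "?lin C" "?lin E" "?psf A B R" "?psf B C S" "?psf C E T" for A B C E R S T
  proof -
    interpret R: lin_psf k UNIV A B R
      by (rule lin_psfI) fact+
    interpret S: lin_psf k UNIV B C S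
      by (rule lin_psfI) fact+
    interpret T: lin_psf k UNIV C E T
      by (rule lin_psfI) fact+
    note SR = linear_pseudofunctor_comp[OF R.lin_psf_axioms S.lin_psf_axioms]
    note TS = linear_pseudofunctor_comp[OF S.lin_psf_axioms T.lin_psf_axioms]
    show ?thesis
      by (rule psfunctor_eqI[OF linear_pseudofunctor_comp[OF lin_psfI[OF that(1,3) SR] T.lin_psf_axioms]
            linear_pseudofunctor_comp[OF R.lin_psf_axioms lin_psfI[OF that(2,4) TS]]])
        (simp_all add: composable_def T.fcell_vcomp_arr)
  qed
  have ids: "?psf A A (psf_id UNIV A)" if "?lin A" for A
    using that by (rule linear_bicategory.linear_pseudofunctor_id)
  have comps: "?psf A C (psf_comp UNIV A C S R)" if "?lin A" "?lin B" "?lin C" "?psf A B R" "?psf B C S" for A B C R S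
    using linear_pseudofunctor_comp[OF lin_psfI lin_psfI] that by blast
  show ?thesis
    unfolding category_def
    by (simp add: supercat_linear idl idr) (blast intro: supercat_linear ids comps assc)
qed

theorem category_Pi_2_Cat:
  "category (Pi_2_Cat k :: (('k, 'o, 'm, 'c) pi_2cat, ('o, 'm, 'c) pi_psfunctor) cat)"
proof -
  let ?cat = "\<lambda>A :: ('k, 'o, 'm, 'c) pi_2cat. pi_2category k A"
  let ?psf = "\<lambda>(A :: ('k, 'o, 'm, 'c) pi_2cat) B (R :: ('o, 'm, 'c) pi_psfunctor). pi_2functor k A B R"
  have ids: "?psf A A (pi_psf_id A)" if "?cat A" for A
    using that by (rule pi_2category.pi_2functor_id)
  have comps: "?psf A C (pi_psf_comp A C S R)" if "?cat A" "?cat B" "?cat C" "?psf A B R" "?psf B C S" for A B C R S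
    using pi_2functor_comp[OF pi_psfI pi_psfI] that by blast
  have idl: "pi_psf_comp A B (pi_psf_id B) R = R" if "?cat A" "?cat B" "?psf A B R" for A B R
  proof -
    interpret R: pi_psf k A B R
      using that by (rule pi_psfI)
    show ?thesis
      by (rule pi_psfunctor_eqI[OF comps[OF that(1,2,2,3) ids[OF that(2)]] that(3)]) (simp_all add: composable_def)
  qed
  have idr: "pi_psf_comp A B R (pi_psf_id A) = R" if "?cat A" "?cat B" "?psf A B R" for A B R
  proof -
    interpret R: pi_psf k A B R
      using that by (rule pi_psfI)
    show ?thesis
      by (rule pi_psfunctor_eqI[OF comps[OF that(1,1,2) ids[OF that(1)] that(3)] that(3)]) (simp_all add: composable_def)
  qed
  have assc: "pi_psf_comp A E T (pi_psf_comp A C S R) = pi_psf_comp A E (pi_psf_comp B E T S) R"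
    if "?cat A" "?cat B" "?cat C" "?cat E" "?psf A B R" "?psf B C S" "?psf C E T" for A B C E R S T
  proof -
    interpret R: pi_psf k A B R
      by (rule pi_psfI) fact+
    interpret S: pi_psf k B C S
      by (rule pi_psfI) fact+
    interpret T: pi_psf k C E T
      by (rule pi_psfI) fact+
    show ?thesis
      by (rule pi_psfunctor_eqI[OF comps[OF that(1,3,4) comps[OF that(1,2,3,5,6)] that(7)]
            comps[OF that(1,2,4,5) comps[OF that(2,3,4,6,7)]]])
        (simp_all add: composable_def T.fcell_vcomp_arr)
  qed
  show ?thesis
    unfolding category_def
    using ids comps assc by (simp add: idl idr)
qed

section \<open>\<open>E\<^sub>2\<close> on 2-superfunctors\<close>

context lin_psf
begin

lemma cmap'_nat:
  assumes "A.arr x" "A.arr y" "src A (cdom y) = tgt A (cdom x)" "G' = ccod y" "F' = ccod x"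
  shows "inv2 B (cmap R (G', F')) \<cdot> fcell R (y \<star>\<^bsub>A\<^esub> x) = (fcell R y \<star> fcell R x) \<cdot> inv2 B (cmap R (cdom y, cdom x))"
proof (rule B.iso_lcancel)
  show "cmap R (G', F') \<cdot> inv2 B (cmap R (G', F')) \<cdot> fcell R (y \<star>\<^bsub>A\<^esub> x) =
    cmap R (G', F') \<cdot> (fcell R y \<star> fcell R x) \<cdot> inv2 B (cmap R (cdom y, cdom x))"
    using assms by (simp add: B.reassoc[OF cmap_nat])
qed (use assms in simp_all)

lemma cmap'_nat_whiskers:
  "\<lbrakk>A.arr x; G \<in> Mor A; src A G = tgt A (cdom x); F' = ccod x\<rbrakk> \<Longrightarrow>
    inv2 B (cmap R (G, F')) \<cdot> fcell R (G \<triangleright>\<^bsub>A\<^esub> x) = (fmor R G \<triangleright> fcell R x) \<cdot> inv2 B (cmap R (G, cdom x))"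
  "\<lbrakk>A.arr y; F \<in> Mor A; src A (cdom y) = tgt A F; G' = ccod y\<rbrakk> \<Longrightarrow>
    inv2 B (cmap R (G', F)) \<cdot> fcell R (y \<triangleleft>\<^bsub>A\<^esub> F) = (fcell R y \<triangleleft> fmor R F) \<cdot> inv2 B (cmap R (cdom y, F))"
  using cmap'_nat[of x "id2 A G" G F'] cmap'_nat[of "id2 A F" y G' F] by simp_all

text \<open>Solved so that the image of an associator next to a single \<open>cmap\<close> can be
  replaced by an associator of \<open>B\<close>.\<close>

lemma coh_assoc':
  assumes "H \<in> Mor A" "G \<in> Mor A" "F \<in> Mor A" "src A H = tgt A G" "src A G = tgt A F"
  shows "fcell R (assoc A H G F) \<cdot> cmap R (H \<bullet>\<^bsub>A\<^esub> G, F) =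
      cmap R (H, G \<bullet>\<^bsub>A\<^esub> F) \<cdot> (fmor R H \<triangleright> cmap R (G, F)) \<cdot> assoc B (fmor R H) (fmor R G) (fmor R F) \<cdot>
        (inv2 B (cmap R (H, G)) \<triangleleft> fmor R F)"
    "fcell R (A.assoc' H G F) \<cdot> cmap R (H, G \<bullet>\<^bsub>A\<^esub> F) =
      cmap R (H \<bullet>\<^bsub>A\<^esub> G, F) \<cdot> (cmap R (H, G) \<triangleleft> fmor R F) \<cdot> B.assoc' (fmor R H) (fmor R G) (fmor R F) \<cdot>
        (fmor R H \<triangleright> inv2 B (cmap R (G, F)))"
proof -
  note c = coh_assoc_arr[OF assms]
  have "fcell R (assoc A H G F) \<cdot> cmap R (H \<bullet>\<^bsub>A\<^esub> G, F) =
    (fcell R (assoc A H G F) \<cdot> cmap R (H \<bullet>\<^bsub>A\<^esub> G, F) \<cdot> (cmap R (H, G) \<triangleleft> fmor R F)) \<cdot> (inv2 B (cmap R (H, G)) \<triangleleft> fmor R F)"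
    using assms by simp
  then show "fcell R (assoc A H G F) \<cdot> cmap R (H \<bullet>\<^bsub>A\<^esub> G, F) =
      cmap R (H, G \<bullet>\<^bsub>A\<^esub> F) \<cdot> (fmor R H \<triangleright> cmap R (G, F)) \<cdot> assoc B (fmor R H) (fmor R G) (fmor R F) \<cdot>
        (inv2 B (cmap R (H, G)) \<triangleleft> fmor R F)"
    unfolding c using assms by simp
  have "fcell R (A.assoc' H G F) \<cdot> cmap R (H, G \<bullet>\<^bsub>A\<^esub> F) =
    fcell R (A.assoc' H G F) \<cdot> (cmap R (H, G \<bullet>\<^bsub>A\<^esub> F) \<cdot> (fmor R H \<triangleright> cmap R (G, F)) \<cdot> assoc B (fmor R H) (fmor R G) (fmor R F)) \<cdot>
     B.assoc' (fmor R H) (fmor R G) (fmor R F) \<cdot> (fmor R H \<triangleright> inv2 B (cmap R (G, F)))"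
    using assms by simp
  then show "fcell R (A.assoc' H G F) \<cdot> cmap R (H, G \<bullet>\<^bsub>A\<^esub> F) =
      cmap R (H \<bullet>\<^bsub>A\<^esub> G, F) \<cdot> (cmap R (H, G) \<triangleleft> fmor R F) \<cdot> B.assoc' (fmor R H) (fmor R G) (fmor R F) \<cdot>
        (fmor R H \<triangleright> inv2 B (cmap R (G, F)))"
    unfolding c[symmetric] using assms by simp
qed

end

locale super_psf = A: pi_2supercategory k A + B: pi_2supercategory k B + linear_pseudofunctor k UNIV A B R
  for k :: "'k ring" and A :: "('k, 'o, 'm, 'c) pi_2scat" and B :: "('k, 'o, 'm, 'c) pi_2scat" (structure)
    and R :: "('o, 'm, 'c) psfunctor"
begin

sublocale lin_psf k UNIV A B R ..

text \<open>The unique solution of R\<zeta> \<cdot> j = i \<cdot> \<zeta>. It is even because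
  \<zeta> enters twice.\<close>

definition jE2 :: "'o \<Rightarrow> ('m, 'c) cell" where
  "jE2 u = inv2 B (fcell R (zeta A u)) \<cdot> imap R u \<cdot> zeta B (fob R u)"

lemma jE2_simps [simp]:
  assumes "u \<in> Ob A"
  shows "B.arr (jE2 u)" "cdom (jE2 u) = pi1 B (fob R u)" "ccod (jE2 u) = fmor R (pi1 A u)" "par (jE2 u) = 0" "iso2 B (jE2 u)"
  unfolding jE2_def using assms by (simp_all add: B.vcomp_iso)

lemma zeta_jE2: "u \<in> Ob A \<Longrightarrow> fcell R (zeta A u) \<cdot> jE2 u = imap R u \<cdot> zeta B (fob R u)"
  unfolding jE2_def by simp

text \<open>Naturality of c turns R(\<zeta>F) into (R\<zeta>)(RF), the equation for j trades
  R\<zeta> for \<zeta>, and the left unit law of \<open>R\<close> absorbs i and c.\<close>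

lemma lzeta_jE2:
  assumes "F \<in> Mor A" "u = tgt A F"
  shows "fcell R (A.lzeta F) \<cdot> cmap R (pi1 A u, F) \<cdot> (jE2 u \<triangleleft> fmor R F) = B.lzeta (fmor R F)"
proof -
  have "fcell R (A.lzeta F) \<cdot> cmap R (pi1 A u, F) \<cdot> (jE2 u \<triangleleft> fmor R F) =
    fcell R (lunit A F) \<cdot> cmap R (unit1 A u, F) \<cdot> ((fcell R (zeta A u) \<cdot> jE2 u) \<triangleleft> fmor R F)"
    unfolding A.lzeta_def using assms by (simp add: fcell_vcomp_arr B.rw_vcomp B.reassoc[OF cmap_nat_rw])
  also have "\<dots> = (fcell R (lunit A F) \<cdot> cmap R (unit1 A u, F) \<cdot> (imap R u \<triangleleft> fmor R F)) \<cdot> (zeta B (fob R u) \<triangleleft> fmor R F)"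
    using assms by (simp add: zeta_jE2 B.rw_vcomp)
  also have "\<dots> = B.lzeta (fmor R F)"
    unfolding B.lzeta_def using assms coh_lunit[of F] by simp
  finally show ?thesis .
qed

lemma rzeta_jE2:
  assumes "F \<in> Mor A" "u = src A F"
  shows "fcell R (A.rzeta F) \<cdot> cmap R (F, pi1 A u) \<cdot> (fmor R F \<triangleright> jE2 u) = B.rzeta (fmor R F)"
proof -
  have "fcell R (A.rzeta F) \<cdot> cmap R (F, pi1 A u) \<cdot> (fmor R F \<triangleright> jE2 u) =
    fcell R (runit A F) \<cdot> cmap R (F, unit1 A u) \<cdot> (fmor R F \<triangleright> (fcell R (zeta A u) \<cdot> jE2 u))"
    unfolding A.rzeta_def using assms by (simp add: fcell_vcomp_arr B.lw_vcomp B.reassoc[OF cmap_nat_lw])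
  also have "\<dots> = (fcell R (runit A F) \<cdot> cmap R (F, unit1 A u) \<cdot> (fmor R F \<triangleright> imap R u)) \<cdot> (fmor R F \<triangleright> zeta B (fob R u))"
    using assms by (simp add: zeta_jE2 B.lw_vcomp)
  also have "\<dots> = B.rzeta (fmor R F)"
    unfolding B.rzeta_def using assms coh_runit[of F] by simp
  finally show ?thesis .
qed

text \<open>Composed with the image of \<open>rzeta F\<close>, both sides become
  \<open>lzeta\<close> of \<open>fmor R F\<close>.\<close>

lemma beta_jE2:
  assumes "F \<in> Mor A" "u = tgt A F" "w = src A F"
  shows "fcell R (A.E2_beta F) \<cdot> cmap R (pi1 A u, F) \<cdot> (jE2 u \<triangleleft> fmor R F) =
    cmap R (F, pi1 A w) \<cdot> (fmor R F \<triangleright> jE2 w) \<cdot> B.E2_beta (fmor R F)"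
proof (rule B.iso_lcancel)
  have "fcell R (A.rzeta F) \<cdot> fcell R (A.E2_beta F) \<cdot> cmap R (pi1 A u, F) \<cdot> (jE2 u \<triangleleft> fmor R F) = B.lzeta (fmor R F)"
    using assms by (simp add: B.reassoc[OF fcell_vcomp_arr[symmetric]] A.rzeta_beta lzeta_jE2)
  also have "\<dots> = fcell R (A.rzeta F) \<cdot> cmap R (F, pi1 A w) \<cdot> (fmor R F \<triangleright> jE2 w) \<cdot> B.E2_beta (fmor R F)"
    using assms by (simp add: B.reassoc3[OF rzeta_jE2] B.rzeta_beta)
  finally show "fcell R (A.rzeta F) \<cdot> fcell R (A.E2_beta F) \<cdot> cmap R (pi1 A u, F) \<cdot> (jE2 u \<triangleleft> fmor R F) =
    fcell R (A.rzeta F) \<cdot> cmap R (F, pi1 A w) \<cdot> (fmor R F \<triangleright> jE2 w) \<cdot> B.E2_beta (fmor R F)" .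
qed (use assms in simp_all)

text \<open>The image of \<xi> is R\<zeta> after the image of \<open>lzeta\<close> at \<pi>. One j
  is absorbed by \<open>lzeta_jE2\<close>; the other, being even, passes \<open>lzeta\<close> and
  meets R\<zeta>.\<close>

lemma xi_jE2:
  assumes "u \<in> Ob A"
  shows "fcell R (A.E2_xi u) \<cdot> cmap R (pi1 A u, pi1 A u) \<cdot> (jE2 u \<star> jE2 u) = imap R u \<cdot> B.E2_xi (fob R u)"
proof -
  let ?p = "pi1 A u"
  have "fcell R (A.E2_xi u) \<cdot> cmap R (?p, ?p) \<cdot> (jE2 u \<star> jE2 u) =
    fcell R (zeta A u) \<cdot> (fcell R (A.lzeta ?p) \<cdot> cmap R (?p, ?p) \<cdot> (jE2 u \<triangleleft> fmor R ?p)) \<cdot> (pi1 B (fob R u) \<triangleright> jE2 u)"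
    using assms by (simp add: A.E2_xi_eq fcell_vcomp_arr B.hcomp_split[of "jE2 u" "jE2 u"])
  also have "\<dots> = (fcell R (zeta A u) \<cdot> jE2 u) \<cdot> B.lzeta (pi1 B (fob R u))"
    using assms by (subst lzeta_jE2) (simp_all add: B.lzeta_nat)
  also have "\<dots> = imap R u \<cdot> B.E2_xi (fob R u)"
    using assms by (subst zeta_jE2) (simp_all add: B.E2_xi_eq)
  finally show ?thesis .
qed

lemma E2_arr_sel [simp]:
  "fob (E2_arr A B R) = fob R" "fmor (E2_arr A B R) = fmor R" "cmap (E2_arr A B R) = cmap R" "imap (E2_arr A B R) = imap R"
  "x \<in> all_cells A {0} \<Longrightarrow> fcell (E2_arr A B R) x = fcell R x"
  "u \<in> Ob A \<Longrightarrow> jmap (E2_arr A B R) u = jE2 u"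
  by (simp_all add: E2_arr_def jE2_def)

lemma pi_2functor_E2_arr: "pi_2functor k (E2_obj A) (E2_obj B) (E2_arr A B R)"
proof (intro pi_2functor.intro pi_2functor_axioms.intro linear_pseudofunctor.intro)
  let ?R = "E2_arr A B R"
  show "fob ?R \<in> extensional (Ob (E2_obj A))" "fmor ?R \<in> extensional (Mor (E2_obj A))"
    "fcell ?R \<in> extensional (all_cells (E2_obj A) {0})" "cmap ?R \<in> extensional {(G, F). composable (E2_obj A) G F}"
    "imap ?R \<in> extensional (Ob (E2_obj A))" "jmap ?R \<in> extensional (Ob (E2_obj A))"
    using ext by (simp_all add: E2_arr_def)
qed (auto simp: all_cells_zero_iff[of _ A] mem_cells_iff[of _ UNIV] composable_def fcell_vcomp_arr coh_assoc_arr
    A.E2_beta_def[symmetric] A.E2_xi_def[symmetric] B.E2_beta_def[symmetric] B.E2_xi_def[symmetric] beta_jE2 xi_jE2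
    fcell_add2 fcell_smult2 cmap_nat coh_lunit coh_runit intro!: B.isosI)

end

section \<open>\<open>D\<^sub>2\<close> on \<open>\<Pi>\<close>-2-functors\<close>

context pi_psf
begin

text \<open>The isomorphism \<open>R(\<pi>G) \<Rightarrow> \<pi>(RG)\<close> through which \<open>D2_arr\<close> acts on odd 2-morphisms.\<close>

definition Jmap :: "'m \<Rightarrow> ('m, 'c) cell" where
  "Jmap G = (inv2 B (jmap R (tgt A G)) \<triangleleft> fmor R G) \<cdot> inv2 B (cmap R (pi1 A (tgt A G), G))"

lemma Jmap_simps [simp]:
  assumes "G \<in> Mor A"
  shows "B.arr (Jmap G)" "cdom (Jmap G) = fmor R (pi1 A (tgt A G) \<bullet>\<^bsub>A\<^esub> G)"
    "ccod (Jmap G) = pi1 B (fob R (tgt A G)) \<bullet> fmor R G" "iso2 B (Jmap G)"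
    "inv2 B (Jmap G) = cmap R (pi1 A (tgt A G), G) \<cdot> (jmap R (tgt A G) \<triangleleft> fmor R G)"
  unfolding Jmap_def using assms by (simp_all add: B.vcomp_iso B.rw_iso)

lemma Jmap_nat:
  assumes "A.arr y" "H = ccod y" "u = tgt A (cdom y)"
  shows "Jmap H \<cdot> fcell R (pi1 A u \<triangleright>\<^bsub>A\<^esub> y) = (pi1 B (fob R u) \<triangleright> fcell R y) \<cdot> Jmap (cdom y)"
proof -
  have "(inv2 B (jmap R u) \<triangleleft> fmor R H) \<cdot> (fmor R (pi1 A u) \<triangleright> fcell R y) =
    (pi1 B (fob R u) \<triangleright> fcell R y) \<cdot> (inv2 B (jmap R u) \<triangleleft> fmor R (cdom y))"
    using assms by (simp add: B.hcomp_split_rev)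
  from B.reassoc[OF this] show ?thesis
    unfolding Jmap_def using assms by (simp add: cmap'_nat_whiskers)
qed

text \<open>Serves right whiskering of odd 2-morphisms, where \<pi>(GF) and (\<pi>G)F have to be
  compared through \<open>R\<close>.\<close>

lemma Jmap_assoc:
  assumes "G \<in> Mor A" "F \<in> Mor A" "src A G = tgt A F" "u = tgt A G"
  shows "Jmap (G \<bullet>\<^bsub>A\<^esub> F) \<cdot> fcell R (assoc A (pi1 A u) G F) \<cdot> cmap R (pi1 A u \<bullet>\<^bsub>A\<^esub> G, F) =
    (pi1 B (fob R u) \<triangleright> cmap R (G, F)) \<cdot> assoc B (pi1 B (fob R u)) (fmor R G) (fmor R F) \<cdot> (Jmap G \<triangleleft> fmor R F)"
proof -
  have "(inv2 B (jmap R u) \<triangleleft> fmor R (G \<bullet>\<^bsub>A\<^esub> F)) \<cdot> (fmor R (pi1 A u) \<triangleright> cmap R (G, F)) =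
    (pi1 B (fob R u) \<triangleright> cmap R (G, F)) \<cdot> (inv2 B (jmap R u) \<triangleleft> (fmor R G \<bullet> fmor R F))"
    using assms by (simp add: B.hcomp_split_rev)
  from B.reassoc[OF this] show ?thesis
    unfolding Jmap_def using assms by (simp add: coh_assoc' B.nat_rules B.rw_vcomp)
qed

text \<open>The axiom \<open>jmap_beta\<close> with both sides inverted, as \<open>D2_hcomp\<close>
  involves the inverse of \<beta>.\<close>

lemma Jmap_beta:
  assumes "G \<in> Mor A" "w = src A G"
  shows "Jmap G \<cdot> fcell R (A.beta' G) \<cdot> cmap R (G, pi1 A w) = B.beta' (fmor R G) \<cdot> (fmor R G \<triangleright> inv2 B (jmap R w))"
proof -
  have "inv2 B (fcell R (beta A G) \<cdot> cmap R (pi1 A (tgt A G), G) \<cdot> (jmap R (tgt A G) \<triangleleft> fmor R G)) =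
    inv2 B (cmap R (G, pi1 A w) \<cdot> (fmor R G \<triangleright> jmap R w) \<cdot> beta B (fmor R G))"
    using jmap_beta[of G] assms by simp
  then have "Jmap G \<cdot> fcell R (A.beta' G) = B.beta' (fmor R G) \<cdot> (fmor R G \<triangleright> inv2 B (jmap R w)) \<cdot> inv2 B (cmap R (G, pi1 A w))"
    unfolding Jmap_def using assms by (simp add: B.vcomp_iso B.rw_iso B.lw_iso)
  from B.reassoc[OF this, of "cmap R (G, pi1 A w)"] show ?thesis
    using assms by simp
qed

text \<open>Left whiskering of an odd 2-morphism moves \<pi> across \<open>G\<close>, and this has
  to commute with \<open>R\<close>. The two preceding facts reduce it to the axiom on
  \<beta>.\<close>

lemma Jmap_beta_inv_at:
  assumes "G \<in> Mor A" "F \<in> Mor A" "src A G = tgt A F" "u = tgt A G" "w = src A G"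
  shows "Jmap (G \<bullet>\<^bsub>A\<^esub> F) \<cdot> fcell R (beta_inv_at A G F) \<cdot> cmap R (G, pi1 A w \<bullet>\<^bsub>A\<^esub> F) =
    (pi1 B (fob R u) \<triangleright> cmap R (G, F)) \<cdot> beta_inv_at B (fmor R G) (fmor R F) \<cdot> (fmor R G \<triangleright> Jmap F)"
proof -
  let ?RG = "fmor R G" and ?RF = "fmor R F" and ?p = "pi1 A u" and ?q = "pi1 A w"
    and ?p' = "pi1 B (fob R u)" and ?q' = "pi1 B (fob R w)"
  have "Jmap (G \<bullet>\<^bsub>A\<^esub> F) \<cdot> fcell R (beta_inv_at A G F) \<cdot> cmap R (G, ?q \<bullet>\<^bsub>A\<^esub> F) =
    Jmap (G \<bullet>\<^bsub>A\<^esub> F) \<cdot> fcell R (assoc A ?p G F) \<cdot> fcell R (A.beta' G \<triangleleft>\<^bsub>A\<^esub> F) \<cdot> cmap R (G \<bullet>\<^bsub>A\<^esub> ?q, F) \<cdot>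
      (cmap R (G, ?q) \<triangleleft> ?RF) \<cdot> B.assoc' ?RG (fmor R ?q) ?RF \<cdot> (?RG \<triangleright> inv2 B (cmap R (?q, F)))"
    unfolding beta_inv_at_def using assms by (simp add: fcell_vcomp_arr coh_assoc'(2))
  also have "\<dots> = (Jmap (G \<bullet>\<^bsub>A\<^esub> F) \<cdot> fcell R (assoc A ?p G F) \<cdot> cmap R (?p \<bullet>\<^bsub>A\<^esub> G, F)) \<cdot> (fcell R (A.beta' G) \<triangleleft> ?RF) \<cdot> 
      (cmap R (G, ?q) \<triangleleft> ?RF) \<cdot> B.assoc' ?RG (fmor R ?q) ?RF \<cdot> (?RG \<triangleright> inv2 B (cmap R (?q, F)))"
    using assms by (simp add: B.reassoc[OF cmap_nat_rw_rev])
  also have "\<dots> = (?p' \<triangleright> cmap R (G, F)) \<cdot> assoc B ?p' ?RG ?RF \<cdot> ((Jmap G \<cdot> fcell R (A.beta' G) \<cdot> cmap R (G, ?q)) \<triangleleft> ?RF) \<cdot> 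
      B.assoc' ?RG (fmor R ?q) ?RF \<cdot> (?RG \<triangleright> inv2 B (cmap R (?q, F)))"
    using assms by (subst Jmap_assoc) (simp_all add: B.rw_vcomp)
  also have "\<dots> = (?p' \<triangleright> cmap R (G, F)) \<cdot> assoc B ?p' ?RG ?RF \<cdot> (B.beta' ?RG \<triangleleft> ?RF) \<cdot> ((?RG \<triangleright> inv2 B (jmap R w)) \<triangleleft> ?RF) \<cdot>
      B.assoc' ?RG (fmor R ?q) ?RF \<cdot> (?RG \<triangleright> inv2 B (cmap R (?q, F)))"
    using assms by (subst Jmap_beta) (simp_all add: B.rw_vcomp)
  also have "\<dots> = (?p' \<triangleright> cmap R (G, F)) \<cdot> beta_inv_at B ?RG ?RF \<cdot> (?RG \<triangleright> Jmap F)"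
    unfolding beta_inv_at_def Jmap_def using assms by (simp add: B.lw_vcomp B.nat_rules)
  finally show ?thesis .
qed

text \<open>Needed for composites of two odd 2-morphisms. The inverses of \<open>Jmap\<close> are
  used first, because in them c and j have the direction of the axiom
  \<open>jmap_xi\<close>.\<close>

lemma Jmap_xi_at:
  assumes "H \<in> Mor A" "u = tgt A H"
  shows "xi_at B (fmor R H) \<cdot> (pi1 B (fob R u) \<triangleright> Jmap H) \<cdot> Jmap (pi1 A u \<bullet>\<^bsub>A\<^esub> H) = fcell R (xi_at A H)"
proof -
  let ?p = "pi1 A u" and ?q = "pi1 B (fob R u)" and ?RH = "fmor R H"
  let ?c = "cmap R (?p, H)" and ?j = "jmap R u"
  have "fcell R (xi_at A H) \<cdot> cmap R (?p, ?p \<bullet>\<^bsub>A\<^esub> H) \<cdot> (?j \<triangleleft> fmor R (?p \<bullet>\<^bsub>A\<^esub> H)) \<cdot> (?q \<triangleright> (?c \<cdot> (?j \<triangleleft> ?RH))) =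
    fcell R (xi_at A H) \<cdot> cmap R (?p, ?p \<bullet>\<^bsub>A\<^esub> H) \<cdot> (fmor R ?p \<triangleright> ?c) \<cdot> (?j \<star> (?j \<triangleleft> ?RH))"
  proof -
    have "(?j \<triangleleft> fmor R (?p \<bullet>\<^bsub>A\<^esub> H)) \<cdot> (?q \<triangleright> (?c \<cdot> (?j \<triangleleft> ?RH))) = (fmor R ?p \<triangleright> ?c) \<cdot> (?j \<star> (?j \<triangleleft> ?RH))"
      using assms by (simp add: B.interchange_arr)
    then show ?thesis
      using assms by simp
  qed
  also have "\<dots> = fcell R (lunit A H) \<cdot> fcell R (xi A u \<triangleleft>\<^bsub>A\<^esub> H) \<cdot> cmap R (?p \<bullet>\<^bsub>A\<^esub> ?p, H) \<cdot> (cmap R (?p, ?p) \<triangleleft> ?RH) \<cdot>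
      B.assoc' (fmor R ?p) (fmor R ?p) ?RH \<cdot> (?j \<star> (?j \<triangleleft> ?RH))"
    unfolding xi_at_def using assms by (simp add: fcell_vcomp_arr B.reassoc[OF coh_assoc'(2)])
  also have "\<dots> = fcell R (lunit A H) \<cdot> cmap R (unit1 A u, H) \<cdot> ((fcell R (xi A u) \<cdot> cmap R (?p, ?p) \<cdot> (?j \<star> ?j)) \<triangleleft> ?RH) \<cdot>
      B.assoc' ?q ?q ?RH"
    using assms by (simp add: B.nat_rules B.rw_vcomp B.reassoc[OF cmap_nat_rw])
  also have "\<dots> = (fcell R (lunit A H) \<cdot> cmap R (unit1 A u, H) \<cdot> (imap R u \<triangleleft> ?RH)) \<cdot> (xi B (fob R u) \<triangleleft> ?RH) \<cdot> B.assoc' ?q ?q ?RH"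
    using assms by (subst jmap_xi) (simp_all add: B.rw_vcomp)
  also have "\<dots> = xi_at B ?RH"
    unfolding xi_at_def using assms coh_lunit[of H] by simp
  finally have *: "fcell R (xi_at A H) \<cdot> cmap R (?p, ?p \<bullet>\<^bsub>A\<^esub> H) \<cdot> (?j \<triangleleft> fmor R (?p \<bullet>\<^bsub>A\<^esub> H)) \<cdot> (?q \<triangleright> (?c \<cdot> (?j \<triangleleft> ?RH))) = xi_at B ?RH" .
  then have **: "fcell R (xi_at A H) \<cdot> inv2 B (Jmap (?p \<bullet>\<^bsub>A\<^esub> H)) \<cdot> (?q \<triangleright> inv2 B (Jmap H)) = xi_at B ?RH"
    using assms by simp
  show ?thesis
    unfolding **[symmetric] using assms by (simp del: Jmap_simps(5))
qed

text \<open>Up to i and j, \<open>D2_arr\<close> carries \<zeta> to \<zeta>; from this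
  \<open>E2_arr\<close> recovers j.\<close>

lemma Jmap_unit:
  assumes "u \<in> Ob A"
  shows "Jmap (unit1 A u) \<cdot> fcell R (A.runit' (pi1 A u)) \<cdot> jmap R u =
    (pi1 B (fob R u) \<triangleright> imap R u) \<cdot> B.runit' (pi1 B (fob R u))"
proof -
  let ?p = "pi1 A u" and ?q = "pi1 B (fob R u)" and ?I = "unit1 A u"
  have r: "fcell R (runit A ?p) \<cdot> cmap R (?p, ?I) \<cdot> (fmor R ?p \<triangleright> imap R u) = runit B (fmor R ?p)"
    using assms coh_runit[of ?p] by simp
  have "fcell R (A.runit' ?p) = cmap R (?p, ?I) \<cdot> (fmor R ?p \<triangleright> imap R u) \<cdot> B.runit' (fmor R ?p)"
  proof -
    have "fcell R (A.runit' ?p) \<cdot> runit B (fmor R ?p) = cmap R (?p, ?I) \<cdot> (fmor R ?p \<triangleright> imap R u)"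
      unfolding r[symmetric] using assms by simp
    from B.iso_rmove[OF this] show ?thesis
      using assms by simp
  qed
  then have "Jmap ?I \<cdot> fcell R (A.runit' ?p) \<cdot> jmap R u =
    (inv2 B (jmap R u) \<triangleleft> fmor R ?I) \<cdot> (fmor R ?p \<triangleright> imap R u) \<cdot> B.runit' (fmor R ?p) \<cdot> jmap R u"
    unfolding Jmap_def using assms by simp
  also have "\<dots> = ((inv2 B (jmap R u) \<triangleleft> fmor R ?I) \<cdot> (fmor R ?p \<triangleright> imap R u)) \<cdot> (jmap R u \<triangleleft> unit1 B (fob R u)) \<cdot> B.runit' ?q"
    using assms by (simp add: B.runit'_nat)
  also have "\<dots> = (?q \<triangleright> imap R u) \<cdot> B.runit' ?q"
    using assms by (simp add: B.interchange_arr B.reassoc[OF B.interchange_arr])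
  finally show ?thesis .
qed

abbreviation R2 where "R2 \<equiv> D2_arr A B R"

lemma D2_arr_sel [simp]:
  "fob R2 = fob R" "fmor R2 = fmor R" "cmap R2 = cmap R" "imap R2 = imap R"
  "A.arr x \<Longrightarrow> fcell R2 x = fcell R x"
  by (simp_all add: D2_arr_def)

lemma D2_arr_shift [simp]:
  assumes "A.arr u" "G \<in> Mor A" "ccod u = pi1 A (tgt A G) \<bullet>\<^bsub>A\<^esub> G"
  shows "fcell R2 (shift G u) = shift (fmor R G) (Jmap G \<cdot> fcell R u)"
  using assms by (simp add: D2_arr_def Let_def) (simp add: shift_def Jmap_def)

lemma D2_arr_cell [simp]:
  assumes "A.arrD x"
  shows "B.arrD (fcell R2 x)" "cdom (fcell R2 x) = fmor R (cdom x)" "ccod (fcell R2 x) = fmor R (ccod x)"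
    "par (fcell R2 x) = par x"
  using assms by (elim A.arrD_cases; simp)+

lemma D2_arr_vcomp:
  assumes "A.arrD x" "A.arrD y" "ccod x = cdom y"
  shows "fcell R2 (y \<cdot>\<^bsub>A.D\<^esub> x) = fcell R2 y \<cdot>\<^bsub>B.D\<^esub> fcell R2 x"
proof -
  have "tgt A (cdom y) = tgt A (cdom x)" "src A (cdom y) = src A (cdom x)"
    using assms by (metis A.arrD_ends(3,4))+
  then show ?thesis
    using assms
    by (elim A.arrD_cases)
      (simp_all add: fcell_vcomp_arr B.lw_vcomp B.reassoc[OF Jmap_nat] Jmap_xi_at[symmetric])
qed

lemma D2_arr_cmap_lw:
  assumes "A.arrD x" "G \<in> Mor A" "src A G = tgt A (cdom x)"
  shows "cmap R (G, ccod x) \<cdot>\<^bsub>B.D\<^esub> (id2 B (fmor R G) \<star>\<^bsub>B.D\<^esub> fcell R2 x) =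
    fcell R2 (id2 A G \<star>\<^bsub>A.D\<^esub> x) \<cdot>\<^bsub>B.D\<^esub> cmap R (G, cdom x)"
  using assms
  by (elim A.arrD_cases)
    (simp_all add: fcell_vcomp_arr B.lw_vcomp cmap_nat_lw_rev B.reassoc3[OF Jmap_beta_inv_at])

lemma D2_arr_cmap_rw:
  assumes "A.arrD y" "F \<in> Mor A" "src A (cdom y) = tgt A F"
  shows "cmap R (ccod y, F) \<cdot>\<^bsub>B.D\<^esub> (fcell R2 y \<star>\<^bsub>B.D\<^esub> id2 B (fmor R F)) =
    fcell R2 (y \<star>\<^bsub>A.D\<^esub> id2 A F) \<cdot>\<^bsub>B.D\<^esub> cmap R (cdom y, F)"
  using assms
  by (elim A.arrD_cases)
    (simp_all add: fcell_vcomp_arr B.rw_vcomp cmap_nat_rw_rev B.reassoc3[OF Jmap_assoc])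

text \<open>Splitting into whiskers leaves the two one-sided laws, so the composite of two odd
  2-morphisms with its sign is never expanded.\<close>

lemma D2_arr_cmap_nat:
  assumes "A.arrD x" "A.arrD y" "src A (cdom y) = tgt A (cdom x)"
  shows "cmap R (ccod y, ccod x) \<cdot>\<^bsub>B.D\<^esub> (fcell R2 y \<star>\<^bsub>B.D\<^esub> fcell R2 x) =
    fcell R2 (y \<star>\<^bsub>A.D\<^esub> x) \<cdot>\<^bsub>B.D\<^esub> cmap R (cdom y, cdom x)"
proof -
  have "cmap R (ccod y, ccod x) \<cdot>\<^bsub>B.D\<^esub> (fcell R2 y \<star>\<^bsub>B.D\<^esub> fcell R2 x) =
    (cmap R (ccod y, ccod x) \<cdot>\<^bsub>B.D\<^esub> (fcell R2 y \<star>\<^bsub>B.D\<^esub> id2 B (fmor R (ccod x)))) \<cdot>\<^bsub>B.D\<^esub> (id2 B (fmor R (cdom y)) \<star>\<^bsub>B.D\<^esub> fcell R2 x)"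
    using assms B.hcomp_D_split[of "fcell R2 x" "fcell R2 y"] by simp
  also have "\<dots> = fcell R2 (y \<star>\<^bsub>A.D\<^esub> id2 A (ccod x)) \<cdot>\<^bsub>B.D\<^esub> (cmap R (cdom y, ccod x) \<cdot>\<^bsub>B.D\<^esub> (id2 B (fmor R (cdom y)) \<star>\<^bsub>B.D\<^esub> fcell R2 x))"
    using assms by (simp add: D2_arr_cmap_rw)
  also have "\<dots> = (fcell R2 (y \<star>\<^bsub>A.D\<^esub> id2 A (ccod x)) \<cdot>\<^bsub>B.D\<^esub> fcell R2 (id2 A (cdom y) \<star>\<^bsub>A.D\<^esub> x)) \<cdot>\<^bsub>B.D\<^esub> cmap R (cdom y, cdom x)"
    using assms by (simp add: D2_arr_cmap_lw)
  also have "\<dots> = fcell R2 (y \<star>\<^bsub>A.D\<^esub> x) \<cdot>\<^bsub>B.D\<^esub> cmap R (cdom y, cdom x)"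
    using assms A.hcomp_D_split[of x y] by (simp add: D2_arr_vcomp)
  finally show ?thesis .
qed

lemma D2_arr_add2:
  "\<lbrakk>A.arrD x; A.arrD y; cdom y = cdom x; ccod y = ccod x; par y = par x\<rbrakk> \<Longrightarrow>
    fcell R2 (add2 A.D x y) = add2 B.D (fcell R2 x) (fcell R2 y)"
  by (elim A.arrD_cases) (simp_all add: fcell_add2 B.bilinear_rules)

lemma D2_arr_smult2:
  "\<lbrakk>A.arrD x; r \<in> carrier k\<rbrakk> \<Longrightarrow> fcell R2 (smult2 A.D r x) = smult2 B.D r (fcell R2 x)"
  by (elim A.arrD_cases) (simp_all add: fcell_smult2 B.bilinear_rules)

theorem linear_pseudofunctor_D2_arr: "linear_pseudofunctor k UNIV (D2_obj A) (D2_obj B) R2"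
proof (intro linear_pseudofunctor.intro)
  show "fob R2 \<in> extensional (Ob A.D)" "fmor R2 \<in> extensional (Mor A.D)" "fcell R2 \<in> extensional (all_cells A.D UNIV)"
    "cmap R2 \<in> extensional {(G, F). composable A.D G F}" "imap R2 \<in> extensional (Ob A.D)"
    using ext by (simp_all add: D2_arr_def)
qed (auto simp: mem_cells_iff[of _ UNIV] composable_def D2_arr_vcomp D2_arr_add2 D2_arr_smult2 D2_arr_cmap_nat
    coh_assoc_arr coh_lunit coh_runit intro!: B.isos_D B.isosI)

end

section \<open>The equivalence\<close>

lemma super_psfI: "\<lbrakk>pi_2supercategory k A; pi_2supercategory k B; linear_pseudofunctor k UNIV A B R\<rbrakk> \<Longrightarrow> super_psf k A B R"
  by (simp add: super_psf_def)

lemma D2_arr_id: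
  assumes "pi_2category k A"
  shows "D2_arr A A (pi_psf_id A) = psf_id UNIV (D2_obj A)"
proof -
  interpret A: pi_2category k A by fact
  interpret I: pi_psf k A A "pi_psf_id A"
    by (rule pi_psfI[OF assms assms A.pi_2functor_id])
  interpret D: pi_2supercategory k "D2_obj A" by (rule A.pi_2supercategory_D2_obj)
  have J: "I.Jmap G = id2 A (pi1 A (tgt A G) \<bullet>\<^bsub>A\<^esub> G)" if "G \<in> Mor A" for G
    unfolding I.Jmap_def using that by (simp add: composable_def)
  have "fcell (D2_arr A A (pi_psf_id A)) x = x" if "A.arrD x" for x
    using that by (elim A.arrD_cases) (simp_all add: J)
  then show ?thesis
    by (intro psfunctor_eqI[OF I.linear_pseudofunctor_D2_arr D.linear_pseudofunctor_id]) (simp_all add: composable_def)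
qed

lemma D2_arr_comp:
  assumes "pi_psf k A B R" "pi_psf k B C S"
  shows "D2_arr A C (pi_psf_comp A C S R) = psf_comp UNIV (D2_obj A) (D2_obj C) (D2_arr B C S) (D2_arr A B R)"
proof -
  interpret R: pi_psf k A B R by fact
  interpret S: pi_psf k B C S by fact
  interpret T: pi_psf k A C "pi_psf_comp A C S R"
    by (rule pi_psfI[OF R.A.pi_2category_axioms S.B.pi_2category_axioms pi_2functor_comp[OF assms]])
  note psf = lin_psfI[OF R.A.pi_2supercategory_D2_obj[THEN supercat_linear] R.B.pi_2supercategory_D2_obj[THEN supercat_linear] R.linear_pseudofunctor_D2_arr]
    lin_psfI[OF R.B.pi_2supercategory_D2_obj[THEN supercat_linear] S.B.pi_2supercategory_D2_obj[THEN supercat_linear] S.linear_pseudofunctor_D2_arr]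
  \<comment> \<open>The transport isomorphisms compose like the functors; naturality of
    \<open>cmap S\<close> lets the inverse of \<open>jmap R\<close> pass.\<close>
  have J: "T.Jmap G = S.Jmap (fmor R G) \<cdot>\<^bsub>C\<^esub> fcell S (R.Jmap G)" if "G \<in> Mor A" for G
    unfolding T.Jmap_def S.Jmap_def R.Jmap_def using that
    by (simp add: composable_def S.B.vcomp_iso S.B.rw_vcomp S.fcell_vcomp_arr S.B.reassoc[OF S.cmap'_nat_whiskers(2)])
  have "fcell (D2_arr A C (pi_psf_comp A C S R)) x = fcell (D2_arr B C S) (fcell (D2_arr A B R) x)" if "R.A.arrD x" for x
    using that by (elim R.A.arrD_cases) (simp_all add: J S.fcell_vcomp_arr)
  then show ?thesis
    by (intro psfunctor_eqI[OF T.linear_pseudofunctor_D2_arr linear_pseudofunctor_comp[OF psf]]) (simp_all add: composable_def)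
qed

lemma D2_all_cells_zero [simp]: "all_cells (D2_obj A) {0} = all_cells A {0}"
  by (auto simp: all_cells_def)

lemma is_functor_D2:
  "is_functor (Pi_2_Cat k :: (('k, 'o, 'm, 'c) pi_2cat, ('o, 'm, 'c) pi_psfunctor) cat) (Pi_2_SCat k) D2"
  unfolding is_functor_def
  by (simp add: category_Pi_2_Cat category_Pi_2_SCat D2_def D2_arr_id D2_arr_comp[OF pi_psfI pi_psfI]
      pi_2category.pi_2supercategory_D2_obj pi_psf.linear_pseudofunctor_D2_arr[OF pi_psfI])

lemma E2_arr_id:
  assumes "pi_2supercategory k A"
  shows "E2_arr A A (psf_id UNIV A) = pi_psf_id (E2_obj A)"
proof -
  interpret A: pi_2supercategory k A by fact
  interpret I: super_psf k A A "psf_id UNIV A"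
    by (rule super_psfI[OF assms assms A.linear_pseudofunctor_id])
  interpret E: pi_2category k "E2_obj A" by (rule A.pi_2category_E2_obj)
  show ?thesis
    by (rule pi_psfunctor_eqI[OF I.pi_2functor_E2_arr E.pi_2functor_id]) (simp_all add: composable_def I.jE2_def all_cells_zero_iff)
qed

lemma E2_arr_comp:
  assumes "super_psf k A B R" "super_psf k B C S"
  shows "E2_arr A C (psf_comp UNIV A C S R) = pi_psf_comp (E2_obj A) (E2_obj C) (E2_arr B C S) (E2_arr A B R)"
proof -
  interpret R: super_psf k A B R by fact
  interpret S: super_psf k B C S by fact
  interpret T: super_psf k A C "psf_comp UNIV A C S R"
    by (rule super_psfI[OF R.A.pi_2supercategory_axioms S.B.pi_2supercategory_axioms
      linear_pseudofunctor_comp[OF R.lin_psf_axioms S.lin_psf_axioms]])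
  \<comment> \<open>The image of \<zeta> under \<open>S\<close> and its inverse cancel in the middle
    of the right-hand side.\<close>
  have j: "T.jE2 u = fcell S (R.jE2 u) \<cdot>\<^bsub>C\<^esub> S.jE2 (fob R u)" if "u \<in> Ob A" for u
    unfolding T.jE2_def S.jE2_def R.jE2_def using that by (simp add: S.fcell_vcomp_arr)
  show ?thesis
    by (rule pi_psfunctor_eqI[OF T.pi_2functor_E2_arr
          pi_2functor_comp[OF pi_psfI[OF R.A.pi_2category_E2_obj R.B.pi_2category_E2_obj R.pi_2functor_E2_arr]
            pi_psfI[OF R.B.pi_2category_E2_obj S.B.pi_2category_E2_obj S.pi_2functor_E2_arr]]])
      (simp_all add: composable_def all_cells_zero_iff j)
qed

lemma is_functor_E2:
  "is_functor (Pi_2_SCat k :: (('k, 'o, 'm, 'c) pi_2scat, ('o, 'm, 'c) psfunctor) cat) (Pi_2_Cat k) E2"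
  unfolding is_functor_def
  by (simp add: category_Pi_2_Cat category_Pi_2_SCat E2_def E2_arr_id E2_arr_comp[OF super_psfI super_psfI]
      pi_2supercategory.pi_2category_E2_obj super_psf.pi_2functor_E2_arr[OF super_psfI])

section \<open>Comparison of \<open>E2_obj (D2_obj A)\<close> with \<open>A\<close>\<close>

context pi_2category
begin

interpretation S: pi_2supercategory k D
  by (rule pi_2supercategory_D2_obj)

text \<open>\<open>shift\<close> forgets the target of \<open>u\<close>, hence the hypothesis on
  targets.\<close>

lemma shift_inject:
  "\<lbrakk>shift G u = shift G v; arr u; arr v; ccod u = ccod v\<rbrakk> \<Longrightarrow> u = v"
  by (auto simp: shift_def intro: cell.expand)

text \<open>The associator from the horizontal composite and the two unitors cancel by the
  triangle.\<close>

lemma lzeta_D: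
  assumes "F \<in> Mor A"
  shows "S.lzeta F = shift F (id2 A (p (tgt A F) \<bullet> F))"
  unfolding S.lzeta_def using assms by (simp add: zeta_D reassoc[OF triangle_arr])

lemma rzeta_D:
  assumes "F \<in> Mor A"
  shows "S.rzeta F = shift F (beta' F)"
  unfolding S.rzeta_def using assms by (simp add: zeta_D reassoc[OF beta_inv_at_unit_right])

lemma beta_E2_D2:
  assumes "F \<in> Mor A"
  shows "beta (E2_obj D) F = beta A F"
proof -
  have a: "arr (S.E2_beta F)" "cdom (S.E2_beta F) = p (tgt A F) \<bullet> F" "ccod (S.E2_beta F) = F \<bullet> p (src A F)"
    using S.E2_beta_simps[of F] assms unfolding D2_all_cells_even by simp_all
  have "shift F (beta' F \<cdot> S.E2_beta F) = shift F (id2 A (p (tgt A F) \<bullet> F))"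
    using S.rzeta_beta[of F] assms a by (simp add: lzeta_D rzeta_D)
  then have "beta' F \<cdot> S.E2_beta F = id2 A (p (tgt A F) \<bullet> F)"
    by (rule shift_inject) (use assms a in simp_all)
  from iso_lmove[OF this] show ?thesis
    using assms a by (simp add: S.E2_beta_def)
qed

text \<open>Here the sign chosen in \<open>E2_obj\<close> is decisive: it is the vertical composite
  of \<zeta> and \<zeta>\<pi> that returns \<xi>.\<close>

lemma xi_E2_D2:
  assumes "u \<in> Ob A"
  shows "xi (E2_obj D) u = xi A u"
  using S.E2_xi_eq[of u] assms by (simp add: S.E2_xi_def zeta_D lzeta_D xi_at_unit)

abbreviation A' where "A' \<equiv> E2_obj D"

lemma pi_2category_E2_D2: "pi_2category k A'"
  by (rule S.pi_2category_E2_obj)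

text \<open>The record \<open>pi_psf_id A\<close> is the identity of both \<open>A\<close> and \<open>E\<^sub>2 D\<^sub>2 A\<close>, and an isomorphism between them.\<close>

lemma pi_2functor_E2_D2:
  "pi_2functor k A' A (pi_psf_id A)" "pi_2functor k A A' (pi_psf_id A)"
proof -
  have e: "fob (pi_psf_id A) \<in> extensional (Ob A)" "fmor (pi_psf_id A) \<in> extensional (Mor A)"
    "fcell (pi_psf_id A) \<in> extensional (all_cells A {0})" "cmap (pi_psf_id A) \<in> extensional {(G, F). composable A G F}"
    "imap (pi_psf_id A) \<in> extensional (Ob A)" "jmap (pi_psf_id A) \<in> extensional (Ob A)"
    by (simp_all add: pi_psf_id_def)
  show "pi_2functor k A' A (pi_psf_id A)"
  proof (intro pi_2functor.intro pi_2functor_axioms.intro linear_pseudofunctor.intro)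
    show "fob (pi_psf_id A) \<in> extensional (Ob A')" "fmor (pi_psf_id A) \<in> extensional (Mor A')"
      "fcell (pi_psf_id A) \<in> extensional (all_cells A' {0})" "cmap (pi_psf_id A) \<in> extensional {(G, F). composable A' G F}"
      "imap (pi_psf_id A) \<in> extensional (Ob A')" "jmap (pi_psf_id A) \<in> extensional (Ob A')"
      using e by simp_all
  qed (auto simp: mem_cells_iff[of _ "{0}"] composable_def beta_E2_D2 xi_E2_D2 intro!: isosI)
  show "pi_2functor k A A' (pi_psf_id A)"
  proof (intro pi_2functor.intro pi_2functor_axioms.intro linear_pseudofunctor.intro)
    show "fob (pi_psf_id A) \<in> extensional (Ob A)" "fmor (pi_psf_id A) \<in> extensional (Mor A)"
      "fcell (pi_psf_id A) \<in> extensional (all_cells A {0})" "cmap (pi_psf_id A) \<in> extensional {(G, F). composable A G F}"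
      "imap (pi_psf_id A) \<in> extensional (Ob A)" "jmap (pi_psf_id A) \<in> extensional (Ob A)"
      using e by simp_all
  qed (auto simp: mem_cells_iff[of _ "{0}"] composable_def beta_E2_D2 xi_E2_D2 intro!: isos_D isosI)
qed

lemma pi_psf_id_E2_D2: "pi_psf_id A' = pi_psf_id A"
  by (simp add: pi_psf_id_def psf_id_def )

end

text \<open>Both sides solve R\<zeta> \<cdot> j = i \<cdot> \<zeta> in \<open>D2_obj B\<close>, one
  by \<open>Jmap_unit\<close> and the other by construction, and R\<zeta> is invertible.\<close>

lemma jE2_D2_arr:
  assumes "pi_psf k A B R" "u \<in> Ob A"
  shows "jmap (E2_arr (D2_obj A) (D2_obj B) (D2_arr A B R)) u = jmap R u"
proof -
  interpret R: pi_psf k A B R by fact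
  interpret S: super_psf k "D2_obj A" "D2_obj B" "D2_arr A B R"
    by (rule super_psfI[OF R.A.pi_2supercategory_D2_obj R.B.pi_2supercategory_D2_obj R.linear_pseudofunctor_D2_arr])
  note [simp] = assms(2)
  have "fcell (D2_arr A B R) (zeta (D2_obj A) u) \<cdot>\<^bsub>R.B.D\<^esub> jmap R u = imap R u \<cdot>\<^bsub>R.B.D\<^esub> zeta (D2_obj B) (fob R u)"
    by (simp add: R.A.zeta_D R.B.zeta_D R.Jmap_unit)
  also have "\<dots> = fcell (D2_arr A B R) (zeta (D2_obj A) u) \<cdot>\<^bsub>R.B.D\<^esub> S.jE2 u"
    using S.zeta_jE2[of u] by simp
  finally have "jmap R u = S.jE2 u"
    by (rule S.B.iso_lcancel) (use S.jE2_simps[of u] S.A.zeta_simps[of u] in simp_all)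
  then show ?thesis
    by simp
qed

lemma E2_D2_naturally_isomorphic:
  "naturally_isomorphic (Pi_2_Cat k :: (('k, 'o, 'm, 'c) pi_2cat, ('o, 'm, 'c) pi_psfunctor) cat) (Pi_2_Cat k)
    (functor_comp E2 D2) functor_id"
  unfolding naturally_isomorphic_def
\<comment> \<open>The two records may differ in the odd Hom modules and in composites of cells that
  are odd or do not fit together, so an isomorphism takes the place of an equality.\<close>
proof (intro exI[of _ pi_psf_id] conjI ballI)
  fix A :: "('k, 'o, 'm, 'c) pi_2cat" assume "A \<in> Obj (Pi_2_Cat k)"
  then interpret A: pi_2category k A by simp
  have "pi_psf_comp A A (pi_psf_id A) (pi_psf_id A) = pi_psf_id A"
    by (rule pi_psfunctor_eqI[OF pi_2functor_comp A.pi_2functor_id])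
      (auto intro!: pi_psfI A.pi_2category_axioms A.pi_2functor_id simp: composable_def)
  moreover have "pi_psf_comp A.A' A.A' (pi_psf_id A) (pi_psf_id A) = pi_psf_id A"
    by (rule pi_psfunctor_eqI[OF pi_2functor_comp[OF
          pi_psfI[OF A.pi_2category_E2_D2 A.pi_2category_axioms A.pi_2functor_E2_D2(1)]
          pi_psfI[OF A.pi_2category_axioms A.pi_2category_E2_D2 A.pi_2functor_E2_D2(2)]] pi_2category.pi_2functor_id[OF A.pi_2category_E2_D2, unfolded A.pi_psf_id_E2_D2]])
      (simp_all add: composable_def)
  ultimately show "cat_iso (Pi_2_Cat k) (on_obj (functor_comp E2 D2) A) (on_obj functor_id A) (pi_psf_id A)"
    using A.pi_2functor_E2_D2 unfolding cat_iso_def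
    by (simp add: functor_comp_def functor_id_def E2_def D2_def A.pi_psf_id_E2_D2) blast
next
  fix A B :: "('k, 'o, 'm, 'c) pi_2cat" and R :: "('o, 'm, 'c) pi_psfunctor"
  assume "A \<in> Obj (Pi_2_Cat k)" "B \<in> Obj (Pi_2_Cat k)" "R \<in> Arr (Pi_2_Cat k) A B"
  then interpret R: pi_psf k A B R
    by (simp add: pi_psfI)
  interpret S: super_psf k "D2_obj A" "D2_obj B" "D2_arr A B R"
    by (rule super_psfI[OF R.A.pi_2supercategory_D2_obj R.B.pi_2supercategory_D2_obj R.linear_pseudofunctor_D2_arr])
  note 1 = pi_2functor_comp[OF pi_psfI[OF R.A.pi_2category_E2_D2 R.B.pi_2category_E2_D2 S.pi_2functor_E2_arr]
      pi_psfI[OF R.B.pi_2category_E2_D2 R.B.pi_2category_axioms R.B.pi_2functor_E2_D2(1)]]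
  note 2 = pi_2functor_comp[OF pi_psfI[OF R.A.pi_2category_E2_D2 R.A.pi_2category_axioms R.A.pi_2functor_E2_D2(1)] R.pi_psf_axioms]
  have "pi_psf_comp R.A.A' B (pi_psf_id B) (E2_arr (D2_obj A) (D2_obj B) (D2_arr A B R)) = pi_psf_comp R.A.A' B R (pi_psf_id A)"
  proof (rule pi_psfunctor_eqI[OF 1 2])
    fix u assume "u \<in> Ob R.A.A'"
    moreover from this have "S.jE2 u = jmap R u"
      using jE2_D2_arr[OF R.pi_psf_axioms, of u] by simp
    ultimately show "jmap (pi_psf_comp R.A.A' B (pi_psf_id B) (E2_arr (D2_obj A) (D2_obj B) (D2_arr A B R))) u =
      jmap (pi_psf_comp R.A.A' B R (pi_psf_id A)) u"
      by simp
  qed (simp_all add: composable_def)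
  then show "Cmp (Pi_2_Cat k) (on_obj (functor_comp E2 D2) A) (on_obj (functor_comp E2 D2) B) (on_obj functor_id B) (pi_psf_id B)
      (on_arr (functor_comp E2 D2) A B R) =
    Cmp (Pi_2_Cat k) (on_obj (functor_comp E2 D2) A) (on_obj functor_id A) (on_obj functor_id B) (on_arr functor_id A B R) (pi_psf_id A)"
    by (simp add: functor_comp_def functor_id_def E2_def D2_def)
qed

section \<open>Isomorphisms that are the identity on objects and 1-morphisms\<close>

definition strict_psf :: "bit set \<Rightarrow> ('k, 'o, 'm, 'c, 'z) bicat_scheme \<Rightarrow> (('m, 'c) cell \<Rightarrow> ('m, 'c) cell) \<Rightarrow>
    ('o, 'm, 'c) psfunctor" where
  "strict_psf P A f = psf_id P A \<lparr> fcell := restrict f (all_cells A P) \<rparr>"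

lemma strict_psf_sel [simp]:
  "fob (strict_psf P A f) = fob (psf_id P A)" "fmor (strict_psf P A f) = fmor (psf_id P A)"
  "x \<in> all_cells A P \<Longrightarrow> fcell (strict_psf P A f) x = f x"
  "cmap (strict_psf P A f) = cmap (psf_id P A)" "imap (strict_psf P A f) = imap (psf_id P A)"
  by (simp_all add: strict_psf_def)

text \<open>With identities for c and i, the laws of a pseudofunctor reduce to strict preservation
  of both compositions, the identities and the coherence maps.\<close>

locale strict_map = A: linear_bicategory k P A + B: linear_bicategory k P B
  for k :: "'k ring" and P :: "bit set" and A :: "('k, 'o, 'm, 'c, 'z) bicat_scheme"
    and B :: "('k, 'o, 'm, 'c, 'z) bicat_scheme" (structure) +
  fixes f :: "('m, 'c) cell \<Rightarrow> ('m, 'c) cell"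
  assumes same: "Ob B = Ob A" "Mor B = Mor A" "src B = src A" "tgt B = tgt A" "unit1 B = unit1 A" "comp1 B = comp1 A"
      "id2 B = id2 A" "assoc B = assoc A" "lunit B = lunit A" "runit B = runit A"
    and f_cell: "A.arr x \<Longrightarrow> B.arr (f x) \<and> cdom (f x) = cdom x \<and> ccod (f x) = ccod x \<and> par (f x) = par x"
    and f_add: "\<lbrakk>A.arr x; A.arr y; cdom y = cdom x; ccod y = ccod x; par y = par x\<rbrakk> \<Longrightarrow> f (add2 A x y) = add2 B (f x) (f y)"
    and f_smult: "\<lbrakk>A.arr x; r \<in> carrier k\<rbrakk> \<Longrightarrow> f (smult2 A r x) = smult2 B r (f x)"
    and f_vcomp: "\<lbrakk>A.arr x; A.arr y; ccod x = cdom y\<rbrakk> \<Longrightarrow> f (y \<cdot>\<^bsub>A\<^esub> x) = f y \<cdot> f x"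
    and f_hcomp: "\<lbrakk>A.arr x; A.arr y; src A (cdom y) = tgt A (cdom x)\<rbrakk> \<Longrightarrow> f (y \<star>\<^bsub>A\<^esub> x) = f y \<star> f x"
    and f_id: "F \<in> Mor A \<Longrightarrow> f (id2 A F) = id2 A F"
    and f_assoc: "\<lbrakk>composable A H G; composable A G F\<rbrakk> \<Longrightarrow> f (assoc A H G F) = assoc A H G F"
    and f_lunit: "F \<in> Mor A \<Longrightarrow> f (lunit A F) = lunit A F"
    and f_runit: "F \<in> Mor A \<Longrightarrow> f (runit A F) = runit A F"
begin

lemmas f_cell' [simp] =
  f_cell[THEN conjunct1] f_cell[THEN conjunct2, THEN conjunct1]
  f_cell[THEN conjunct2, THEN conjunct2, THEN conjunct1] f_cell[THEN conjunct2, THEN conjunct2, THEN conjunct2]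

lemma B_arr_simps [simp]:
  "F \<in> Mor A \<Longrightarrow> B.arr (id2 A F)" "F \<in> Mor A \<Longrightarrow> iso2 B (id2 A F)"
  "F \<in> Mor A \<Longrightarrow> B.arr (lunit A F)" "F \<in> Mor A \<Longrightarrow> B.arr (runit A F)" 
  "\<lbrakk>H \<in> Mor A; G \<in> Mor A; F \<in> Mor A; src A H = tgt A G; src A G = tgt A F\<rbrakk> \<Longrightarrow> B.arr (assoc A H G F)"
  "\<lbrakk>G \<in> Mor A; F \<in> Mor A; src A G = tgt A F\<rbrakk> \<Longrightarrow> id2 A G \<star> id2 A F = id2 A (G \<bullet>\<^bsub>A\<^esub> F)"
  "\<lbrakk>B.arr x; cdom x = F\<rbrakk> \<Longrightarrow> x \<cdot> id2 A F = x" "\<lbrakk>B.arr x; ccod x = F\<rbrakk> \<Longrightarrow> id2 A F \<cdot> x = x"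
  using B.id2_simps(1)[of F] B.id2_iso[of F] B.lunit_simps(1)[of F] B.runit_simps(1)[of F] B.assoc_simps(1)[of H G F] B.hid[of G F]
    B.vid[of x F] 
  by (simp_all add: same)

lemma linear_pseudofunctor_strict_psf: "linear_pseudofunctor k P A B (strict_psf P A f)"
proof (rule linear_pseudofunctor.intro)
  show "fob (strict_psf P A f) \<in> extensional (Ob A)" "fmor (strict_psf P A f) \<in> extensional (Mor A)"
    "fcell (strict_psf P A f) \<in> extensional (all_cells A P)"
    "cmap (strict_psf P A f) \<in> extensional {(G, F). composable A G F}" "imap (strict_psf P A f) \<in> extensional (Ob A)"
    by (simp_all add: strict_psf_def)
qed (auto simp: mem_cells_iff[of _ P] composable_def f_add f_smult f_vcomp f_hcomp f_id f_assoc f_lunit f_runit same intro!: B.isosI)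

lemma strict_map_inverse:
  assumes g: "\<And>y. B.arr y \<Longrightarrow> A.arr (g y)" and fg: "\<And>y. B.arr y \<Longrightarrow> f (g y) = y" and gf: "\<And>x. A.arr x \<Longrightarrow> g (f x) = x"
  shows "strict_map k P B A g"
proof
  have gc: "cdom (g y) = cdom y" "ccod (g y) = ccod y" "par (g y) = par y" if "B.arr y" for y
    using f_cell[OF g[OF that]] unfolding fg[OF that] by simp_all
  fix x y assume xy: "B.arr x" "B.arr y"
  \<comment> \<open>To evaluate \<open>g\<close> it suffices to exhibit a preimage under
    \<open>f\<close>, so every law for \<open>g\<close> follows from the law for
    \<open>f\<close>.\<close>
  have eq: "g z = w" if "f w = z" "A.arr w" for z w
    using gf[OF that(2)] that by simp
  show "A.arr (g x) \<and> cdom (g x) = cdom x \<and> ccod (g x) = ccod x \<and> par (g x) = par x"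
    using xy g gc by simp
  show "g (add2 B x y) = add2 A (g x) (g y)" if "cdom y = cdom x" "ccod y = ccod x" "par y = par x"
    by (rule eq) (use that xy same g gc fg in \<open>simp_all add: f_add\<close>)
  show "g (smult2 B r x) = smult2 A r (g x)" if "r \<in> carrier k" for r
    by (rule eq) (use that xy same g gc fg in \<open>simp_all add: f_smult\<close>)
  show "g (y \<cdot> x) = g y \<cdot>\<^bsub>A\<^esub> g x" if "ccod x = cdom y"
    by (rule eq) (use that xy same g gc fg in \<open>simp_all add: f_vcomp\<close>)
  show "g (y \<star> x) = g y \<star>\<^bsub>A\<^esub> g x" if "src B (cdom y) = tgt B (cdom x)"
    by (rule eq) (use that xy same g gc fg in \<open>simp_all add: f_hcomp\<close>)
next
  have eq: "g z = z" if "f z = z" "A.arr z" for z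
    using gf[OF that(2)] that by simp
  fix H G F
  show "g (id2 B F) = id2 B F" if "F \<in> Mor B"
    using that by (auto intro: eq simp: same f_id)
  show "g (lunit B F) = lunit B F" if "F \<in> Mor B"
    using that by (auto intro: eq simp: same f_lunit)
  show "g (runit B F) = runit B F" if "F \<in> Mor B"
    using that by (auto intro: eq simp: same f_runit)
  show "g (assoc B H G F) = assoc B H G F" if "composable B H G" "composable B G F"
    using that by (auto intro: eq simp: same f_assoc composable_def)
qed (simp_all add: same)

lemma strict_psf_inverse:
  assumes g: "\<And>y. B.arr y \<Longrightarrow> A.arr (g y)" and gf: "\<And>x. A.arr x \<Longrightarrow> g (f x) = x" and lin: "linear_pseudofunctor k P B A (strict_psf P B g)"
  shows "psf_comp P A A (strict_psf P B g) (strict_psf P A f) = psf_id P A"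
proof (rule psfunctor_eqI[OF linear_pseudofunctor_comp A.linear_pseudofunctor_id])
  show "lin_psf k P A B (strict_psf P A f)"
    by (intro lin_psfI A.linear_bicategory_axioms B.linear_bicategory_axioms linear_pseudofunctor_strict_psf)
  show "lin_psf k P B A (strict_psf P B g)"
    by (intro lin_psfI A.linear_bicategory_axioms B.linear_bicategory_axioms lin)
  have "g (id2 A F) = id2 A F" if "F \<in> Mor A" for F
    using gf[of "id2 A F"] f_id that by simp
  then show "\<And>G F. composable A G F \<Longrightarrow> cmap (psf_comp P A A (strict_psf P B g) (strict_psf P A f)) (G, F) = cmap (psf_id P A) (G, F)"
    "\<And>u. u \<in> Ob A \<Longrightarrow> imap (psf_comp P A A (strict_psf P B g) (strict_psf P A f)) u = imap (psf_id P A) u"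
    by (simp_all add: composable_def same)
qed (simp_all add: gf same)

end

section \<open>Comparison of \<open>D2_obj (E2_obj A)\<close> with \<open>A\<close>\<close>

context pi_2supercategory
begin

interpretation E: pi_2category k "E2_obj A"
  by (rule pi_2category_E2_obj)

abbreviation A'' where "A'' \<equiv> D2_obj (E2_obj A)"

text \<open>Odd 2-morphisms of \<open>A\<close> occur here as well, so those of
  \<open>E2_obj A\<close> are described by \<open>arr x\<close> together with
  \<open>par x = 0\<close>.\<close>

declare E.arr_par0 [simp del]
declare all_cells_zero_iff [of _ A, simp]

lemma even_cell_D2_E2: "\<lbrakk>arr x; par x = 0\<rbrakk> \<Longrightarrow> x \<in> all_cells A'' UNIV"
  using E.arrD_even[of x] by simp

text \<open>For an even v : G \<Rightarrow> \<pi>H, naturality of \<open>lzeta\<close> then turns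
  the composite of two odd 2-morphisms in \<open>D2_obj\<close> into the composite of their images
  under \<open>Phi\<close>.\<close>

lemma xi_at_E2: 
  assumes "H \<in> Mor A"
  shows "xi_at (E2_obj A) H = lzeta H \<cdot> lzeta (p (tgt A H) \<bullet> H)"
proof -
  have "xi_at (E2_obj A) H = (lunit A H \<cdot> (zeta A (tgt A H) \<triangleleft> H)) \<cdot> (lzeta (p (tgt A H)) \<triangleleft> H) \<cdot> assoc' (p (tgt A H)) (p (tgt A H)) H"
    unfolding xi_at_def using assms by (simp add: E2_xi_def[symmetric] E2_xi_eq rw_vcomp)
  also have "\<dots> = lzeta H \<cdot> lzeta (p (tgt A H) \<bullet> H)"
    using assms by (simp add: lzeta_comp[symmetric] lzeta_def[symmetric])
  finally show ?thesis .
qed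

lemma beta_inv_at_E2 [simp]:
  assumes "K \<in> Mor A" "H \<in> Mor A" "src A K = tgt A H"
  shows "arr (beta_inv_at (E2_obj A) K H)" "cdom (beta_inv_at (E2_obj A) K H) = K \<bullet> (p (src A K) \<bullet> H)"
    "ccod (beta_inv_at (E2_obj A) K H) = p (tgt A K) \<bullet> (K \<bullet> H)" "par (beta_inv_at (E2_obj A) K H) = 0"
  unfolding beta_inv_at_def using assms by (simp_all add: E2_beta_def[symmetric])

text \<open>Composed with the inverse of \<beta>_K, \<open>lzeta K\<close> becomes
  \<open>rzeta K\<close>, and \<open>lzeta_rzeta\<close> passes \<zeta> on to \<open>H\<close>. This
  makes \<open>Phi\<close> compatible with left whiskering.\<close>

lemma lzeta_beta_inv_at:
  assumes "K \<in> Mor A" "H \<in> Mor A" "src A K = tgt A H"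
  shows "lzeta (K \<bullet> H) \<cdot> beta_inv_at (E2_obj A) K H = K \<triangleright> lzeta H"
proof -
  have b: "lzeta K \<cdot> inv2 A (E2_beta K) = rzeta K"
    using assms by (simp add: rzeta_beta[symmetric])
  have "lzeta (K \<bullet> H) \<cdot> beta_inv_at (E2_obj A) K H = ((lzeta K \<cdot> inv2 A (E2_beta K)) \<triangleleft> H) \<cdot> assoc' K (p (src A K)) H"
    unfolding beta_inv_at_def using assms by (simp add: E2_beta_def[symmetric] reassoc[OF lzeta_comp] rw_vcomp)
  also have "\<dots> = K \<triangleright> lzeta H"
    unfolding b using assms by (simp add: lzeta_rzeta[symmetric])
  finally show ?thesis .
qed

definition Phi :: "('m, 'c) cell \<Rightarrow> ('m, 'c) cell" where
  "Phi x = (if par x = 0 then x else lzeta (ccod x) \<cdot> underlying (E2_obj A) x)"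

definition Psi :: "('m, 'c) cell \<Rightarrow> ('m, 'c) cell" where
  "Psi y = (if par y = 0 then y else shift (ccod y) (inv2 A (lzeta (ccod y)) \<cdot> y))"

lemma Phi_simps [simp]:
  "par x = 0 \<Longrightarrow> Phi x = x"
  "\<lbrakk>arr u; par u = 0; ccod u = p (tgt A G) \<bullet> G\<rbrakk> \<Longrightarrow> Phi (shift G u) = lzeta G \<cdot> u"
  using E.underlying_simps(2)[of u G] by (simp_all add: Phi_def)

lemma arr_cases:
  assumes "x \<in> all_cells A'' UNIV"
  obtains (even) "arr x" "par x = 0"
  | (odd) u G where "x = shift G u" "arr u" "par u = 0" "G \<in> Mor A" "ccod u = p (tgt A G) \<bullet> G"
      "src A G = src A (cdom u)" "tgt A G = tgt A (cdom u)"
  using assms by (rule E.arrD_cases) auto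

lemma Phi_cell [simp]:
  assumes "x \<in> all_cells A'' UNIV"
  shows "arr (Phi x)" "cdom (Phi x) = cdom x" "ccod (Phi x) = ccod x" "par (Phi x) = par x"
  using assms by (elim arr_cases; simp)+

lemma Phi_vcomp:
  assumes "x \<in> all_cells A'' UNIV" "y \<in> all_cells A'' UNIV" "ccod x = cdom y"
  shows "Phi (y \<cdot>\<^bsub>A''\<^esub> x) = Phi y \<cdot> Phi x"
proof -
  have "tgt A (cdom y) = tgt A (cdom x)" "src A (cdom y) = src A (cdom x)"
    using E.arrD_ends(3,4)[OF assms(1)] assms(3) by simp_all
  then show ?thesis
    using assms by (elim arr_cases) (simp_all add: reassoc[OF lzeta_nat] xi_at_E2)
qed

lemma Phi_lw:
  assumes "x \<in> all_cells A'' UNIV" "G \<in> Mor A" "src A G = tgt A (cdom x)"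
  shows "Phi (G \<triangleright>\<^bsub>A''\<^esub> x) = G \<triangleright> Phi x"
  using assms by (elim arr_cases) (simp_all add: reassoc[OF lzeta_beta_inv_at] lw_vcomp)

lemma Phi_rw:
  assumes "y \<in> all_cells A'' UNIV" "F \<in> Mor A" "src A (cdom y) = tgt A F"
  shows "Phi (y \<triangleleft>\<^bsub>A''\<^esub> F) = Phi y \<triangleleft> F"
  using assms by (elim arr_cases) (simp_all add: reassoc[OF lzeta_comp] rw_vcomp)

text \<open>Both horizontal compositions split into whiskers in the same order, so neither parities
  nor signs have to be compared.\<close>

lemma Phi_hcomp:
  assumes "x \<in> all_cells A'' UNIV" "y \<in> all_cells A'' UNIV" "src A (cdom y) = tgt A (cdom x)"
  shows "Phi (y \<star>\<^bsub>A''\<^esub> x) = Phi y \<star> Phi x"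
  using assms E.hcomp_D_split[of x y] hcomp_split[of "Phi x" "Phi y"] E.arrD_ends[OF assms(1)] E.arrD_ends[OF assms(2)]
  by (simp add: Phi_vcomp Phi_lw[simplified] Phi_rw[simplified])

lemma strict_map_Phi: "strict_map k UNIV A'' A Phi"
proof (intro strict_map.intro strict_map_axioms.intro)
  show "linear_bicategory k UNIV A''"
    by (rule supercat_linear[OF E.pi_2supercategory_D2_obj])
  show "linear_bicategory k UNIV A"
    by (rule linear_bicategory_axioms)
  fix x y :: "('m, 'c) cell" and r
  assume x: "x \<in> all_cells A'' UNIV"
  show "Phi (add2 A'' x y) = add2 A (Phi x) (Phi y)"
    if "y \<in> all_cells A'' UNIV" "cdom y = cdom x" "ccod y = ccod x" "par y = par x"
    using x that by (elim arr_cases) (simp_all add: bilinear_rules)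
  show "Phi (smult2 A'' r x) = smult2 A r (Phi x)" if "r \<in> carrier k"
    using x that by (elim arr_cases) (simp_all add: bilinear_rules)
qed (simp_all add: Phi_vcomp Phi_hcomp composable_def)

lemma Psi_cell [simp]: "arr y \<Longrightarrow> Psi y \<in> all_cells A'' UNIV"
  using E.arrD_even[of y] E.arrD_shift[of "inv2 A (lzeta (ccod y)) \<cdot> y" "ccod y"]
  by (cases "par y" rule: bit_cases) (simp_all add: Psi_def)

lemma Phi_Psi: "arr y \<Longrightarrow> Phi (Psi y) = y"
  by (cases "par y" rule: bit_cases) (simp_all add: Psi_def)

lemma Psi_Phi: "x \<in> all_cells A'' UNIV \<Longrightarrow> Psi (Phi x) = x"
  by (elim arr_cases) (simp_all add: Psi_def)

lemma strict_map_Psi: "strict_map k UNIV A A'' Psi"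
  by (rule strict_map.strict_map_inverse[OF strict_map_Phi]) (simp_all add: Phi_Psi Psi_Phi)

lemma cat_iso_Phi: "cat_iso (Pi_2_SCat k) A'' A (strict_psf UNIV A'' Phi)"
proof -
  note lin = strict_map.linear_pseudofunctor_strict_psf[OF strict_map_Phi] strict_map.linear_pseudofunctor_strict_psf[OF strict_map_Psi]
  have "psf_comp UNIV A'' A'' (strict_psf UNIV A Psi) (strict_psf UNIV A'' Phi) = psf_id UNIV A''"
    by (rule strict_map.strict_psf_inverse[OF strict_map_Phi]) (simp_all add: Psi_Phi lin)
  moreover have "psf_comp UNIV A A (strict_psf UNIV A'' Phi) (strict_psf UNIV A Psi) = psf_id UNIV A"
    by (rule strict_map.strict_psf_inverse[OF strict_map_Psi]) (simp_all add: Phi_Psi lin)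
  ultimately show ?thesis
    unfolding cat_iso_def using lin
    by (auto intro!: bexI[of _ "strict_psf UNIV A Psi"])
qed

end

text \<open>For an odd 2-morphism with target G, the left side first transports along R(\<pi>G)
  \<Rightarrow> \<pi>(RG) and then applies \<open>lzeta\<close>; by \<open>lzeta_jE2\<close> this is
  the image of \<open>lzeta G\<close>.\<close>

lemma Phi_natural:
  assumes "super_psf k A B R" and x: "x \<in> all_cells (D2_obj (E2_obj A)) UNIV"
  shows "pi_2supercategory.Phi B (fcell (D2_arr (E2_obj A) (E2_obj B) (E2_arr A B R)) x) = fcell R (pi_2supercategory.Phi A x)"
proof -
  interpret R: super_psf k A B R by fact
  have J: "pi_psf.Jmap (E2_obj A) (E2_obj B) (E2_arr A B R) G =
      (inv2 B (R.jE2 (tgt A G)) \<triangleleft>\<^bsub>B\<^esub> fmor R G) \<cdot>\<^bsub>B\<^esub> inv2 B (cmap R (pi1 A (tgt A G), G))" if "G \<in> Mor A" for G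
    using that pi_psf.Jmap_def[OF pi_psfI[OF R.A.pi_2category_E2_obj R.B.pi_2category_E2_obj R.pi_2functor_E2_arr], of G]
    by simp
  have lz: "R.B.lzeta (fmor R G) \<cdot>\<^bsub>B\<^esub> (inv2 B (R.jE2 (tgt A G)) \<triangleleft>\<^bsub>B\<^esub> fmor R G) \<cdot>\<^bsub>B\<^esub> inv2 B (cmap R (pi1 A (tgt A G), G)) =
      fcell R (R.A.lzeta G)" if "G \<in> Mor A" for G
    unfolding R.lzeta_jE2[OF that refl, symmetric] using that by simp
  note E = pi_psfI[OF R.A.pi_2category_E2_obj R.B.pi_2category_E2_obj R.pi_2functor_E2_arr]
  show ?thesis
    using x
  proof (cases x rule: R.A.arr_cases)
    case even
    then have "x \<in> all_cells A {0}"
      using all_cells_zero_iff by blast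
    then show ?thesis
      using even pi_psf.D2_arr_sel(5)[OF E, of x] by simp
  next
    case (odd u G)
    then have u: "u \<in> all_cells A {0}"
      using all_cells_zero_iff by blast
    have "fcell (D2_arr (E2_obj A) (E2_obj B) (E2_arr A B R)) x = shift (fmor R G)
      ((inv2 B (R.jE2 (tgt A G)) \<triangleleft>\<^bsub>B\<^esub> fmor R G) \<cdot>\<^bsub>B\<^esub> inv2 B (cmap R (pi1 A (tgt A G), G)) \<cdot>\<^bsub>B\<^esub> fcell R u)"
      using odd u pi_psf.D2_arr_shift[OF E, of u G] by (simp add: J)
    then show ?thesis
      using odd R.B.reassoc3[OF lz, of G "fcell R u"] by (simp add: R.fcell_vcomp_arr)
  qed
qed

lemma D2_E2_naturally_isomorphic:
  "naturally_isomorphic (Pi_2_SCat k :: (('k, 'o, 'm, 'c) pi_2scat, ('o, 'm, 'c) psfunctor) cat) (Pi_2_SCat k)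
    (functor_comp D2 E2) functor_id"
  unfolding naturally_isomorphic_def
proof (intro exI[of _ "\<lambda>A. strict_psf UNIV (D2_obj (E2_obj A)) (pi_2supercategory.Phi A)"] conjI ballI)
  fix A :: "('k, 'o, 'm, 'c) pi_2scat" assume "A \<in> Obj (Pi_2_SCat k)"
  then interpret A: pi_2supercategory k A by simp
  show "cat_iso (Pi_2_SCat k) (on_obj (functor_comp D2 E2) A) (on_obj functor_id A) (strict_psf UNIV A.A'' A.Phi)"
    using A.cat_iso_Phi by (simp add: functor_comp_def functor_id_def E2_def D2_def)
next
  fix A B :: "('k, 'o, 'm, 'c) pi_2scat" and R :: "('o, 'm, 'c) psfunctor"
  assume "A \<in> Obj (Pi_2_SCat k)" "B \<in> Obj (Pi_2_SCat k)" "R \<in> Arr (Pi_2_SCat k) A B"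
  then interpret R: super_psf k A B R
    by (simp add: super_psfI)
  note E = pi_psfI[OF R.A.pi_2category_E2_obj R.B.pi_2category_E2_obj R.pi_2functor_E2_arr]
  let ?PA = "strict_psf UNIV R.A.A'' R.A.Phi" and ?PB = "strict_psf UNIV R.B.A'' R.B.Phi"
  let ?R = "D2_arr (E2_obj A) (E2_obj B) (E2_arr A B R)"
  note lin = R.A.pi_2category_E2_obj[THEN pi_2category.pi_2supercategory_D2_obj, THEN supercat_linear]
    R.B.pi_2category_E2_obj[THEN pi_2category.pi_2supercategory_D2_obj, THEN supercat_linear]
    R.A.linear_bicategory_axioms R.B.linear_bicategory_axioms
  note R' = lin_psfI[OF lin(1,2) pi_psf.linear_pseudofunctor_D2_arr[OF E]]
  note 1 = linear_pseudofunctor_comp[OF R'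
      lin_psfI[OF lin(2,4) strict_map.linear_pseudofunctor_strict_psf[OF R.B.strict_map_Phi]]]
  note 2 = linear_pseudofunctor_comp[OF lin_psfI[OF lin(1,3) strict_map.linear_pseudofunctor_strict_psf[OF R.A.strict_map_Phi]]
      R.lin_psf_axioms]
  have "psf_comp UNIV R.A.A'' B ?PB ?R = psf_comp UNIV R.A.A'' B R ?PA"
    by (rule psfunctor_eqI[OF 1 2]) (simp_all add: composable_def pi_psf.D2_arr_sel(1-4)[OF E] lin_psf.fcell_simps(1)[OF R']
      Phi_natural[OF R.super_psf_axioms] R.B.even_cell_D2_E2)
  then show "Cmp (Pi_2_SCat k) (on_obj (functor_comp D2 E2) A) (on_obj (functor_comp D2 E2) B) (on_obj functor_id B) ?PB
      (on_arr (functor_comp D2 E2) A B R) =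
    Cmp (Pi_2_SCat k) (on_obj (functor_comp D2 E2) A) (on_obj functor_id A) (on_obj functor_id B) (on_arr functor_id A B R) ?PA"
    by (simp add: functor_comp_def functor_id_def E2_def D2_def)
qed

theorem lemma5p4:
  fixes k :: "'k ring"
  assumes "cring k"
  shows "mutually_inverse_equivalences
           (Pi_2_Cat k :: (('k, 'o, 'm, 'c) pi_2cat, ('o, 'm, 'c) pi_psfunctor) cat)
           (Pi_2_SCat k :: (('k, 'o, 'm, 'c) pi_2scat, ('o, 'm, 'c) psfunctor) cat)
           D2 E2"
  unfolding mutually_inverse_equivalences_def
  using is_functor_D2 is_functor_E2 E2_D2_naturally_isomorphic D2_E2_naturally_isomorphic by blast

end
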